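(* Let $J\in\{I,J_1,J_+\}$, let $G$ be an abelian group, and let $(X,c)$ be a closure space with interior operator $i$. Let $Z\subseteq A\subseteq X$ be such that $c(Z)\subseteq i(A)$. Then the inclusion $(X\setminus Z,A\setminus Z)\to(X,A)$ induces isomorphisms $$H_J^n(X\setminus Z,A\setminus Z;G)\cong H_J^n(X,A;G)\quad\text{and}\quad H_{(J,\times)}^n(X\setminus Z,A\setminus Z;G)\cong H_{(J,\times)}^n(X,A;G)$$ for all $n$. Equivalently, for every interior cover $\{A,B\}$ of $(X,c)$, the inclusion $(B,A\cap B)\to(X,A)$ induces isomorphisms $H_J^n(B,A\cap B;G)\cong H_J^n(X,A;G)$ and $H_{(J,\times)}^n(B,A\cap B;G)\cong H_{(J,\times)}^n(X,A;G)$ for all $n$.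
   Context: A closure space $(X,c)$ is a set $X$ with a map $c:\mathcal P(X)\to\mathcal P(X)$ such that $c(\emptyset)=\emptyset$, $A\subseteq c(A)$, and $c(A\cup B)=c(A)\cup c(B)$. A subset $A\subseteq X$ carries the subspace closure $B\mapsto c(B)\cap A$. The interior operator is $i(A)=X\setminus c(X\setminus A)$, and $V$ is a neighborhood of $x$ if $x\in i(V)$. An interior cover of $X$ is a family $\mathcal U$ of subsets with $X=\bigcup_{U\in\mathcal U}i(U)$. A map $f:(X,c)\to(Y,d)$ is continuous if $f(c(A))\subseteq d(f(A))$ for all $A\subseteq X$. Topological spaces are closure spaces via the topological closure. The product $X\times Y$ is the set product with the closure for which the sets $U\times V$ ($U$ a neighborhood of $x$, $V$ of $y$) form a neighborhood base at $(x,y)$. Spaces: $I=[0,1]$ with the usual topology; $J_1=\{0,1\}$ with the indiscrete closure; $J_+=\{0,1\}$ with $c(\{0\})=\{0,1\}$, $c(\{1\})=\{1\}$. Singular simplices: $|\Delta^n|^{I}$ is the standard topological $n$-simplex; $|\Delta^n|^{J_1}$ is $\{0,\dots,n\}$ with the indiscrete closure; $|\Delta^n|^{J_+}$ is $\{0,\dots,n\}$ with $c(\{i\})=\{j: j\ge i\}$. $C^J_n(X)$ is the free abelian group on continuous maps $\sigma:|\Delta^n|^J\to X$, with $\partial\sigma=\sum_{i=0}^n(-1)^i\sigma\circ d^i$, $d^i$ the $i$-th face inclusion. Singular cubes: $J^{\times n}$ is the $n$-fold product (a point if $n=0$). Let $Q_n(X)$ be the free abelian group on continuous maps $\sigma:J^{\times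 n}\to X$ and $D_n(X)$ the subgroup generated by the degenerate $\sigma$, i.e. those that do not depend on their $i$-th coordinate for some $1\le i\le n$. Then $C^{(J,\times)}_n(X)=Q_n(X)/D_n(X)$, with $\partial\sigma=\sum_{i=1}^n(-1)^i(A_i\sigma-B_i\sigma)$, where $A_i\sigma$ (resp. $B_i\sigma$) is $\sigma$ with $0$ (resp. $1$) inserted in the $i$-th coordinate. For a subspace $A\subseteq X$, $H_J^n(X,A;G)$ and $H_{(J,\times)}^n(X,A;G)$ are the cohomology groups of the cochain complexes obtained by applying $\operatorname{Hom}_{\mathbb Z}(-,G)$ to $C^J_\bullet(X)/C^J_\bullet(A)$ and $C^{(J,\times)}_\bullet(X)/C^{(J,\times)}_\bullet(A)$. *)

theory Defs
  imports "HOL-Homology.Homology"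
begin

section \<open>Closure spaces\<close>

text \<open>
  A closure space is a carrier set together with an operator that is only meaningful on subsets
  of the carrier.
\<close>

record 'a cspace =
  pts :: "'a set"
  cls :: "'a set \<Rightarrow> 'a set"

definition closure_space :: "'a cspace \<Rightarrow> bool" where
  "closure_space X \<longleftrightarrow>
     cls X {} = {} \<and>
     (\<forall>A. A \<subseteq> pts X \<longrightarrow> A \<subseteq> cls X A \<and> cls X A \<subseteq> pts X) \<and>
     (\<forall>A B. A \<subseteq> pts X \<longrightarrow> B \<subseteq> pts X \<longrightarrow> cls X (A \<union> B) = cls X A \<union> cls X B)"

definition subcspace :: "'a cspace \<Rightarrow> 'a set \<Rightarrow> 'a cspace" where
  "subcspace X A = \<lparr>pts = A, cls = (\<lambda>B. cls X B \<inter> A)\<rparr>"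

definition cinterior :: "'a cspace \<Rightarrow> 'a set \<Rightarrow> 'a set" where
  "cinterior X A = pts X - cls X (pts X - A)"

definition cnbhd :: "'a cspace \<Rightarrow> 'a \<Rightarrow> 'a set \<Rightarrow> bool" where
  "cnbhd X x V \<longleftrightarrow> V \<subseteq> pts X \<and> x \<in> cinterior X V"

definition interior_cover :: "'a cspace \<Rightarrow> 'a set set \<Rightarrow> bool" where
  "interior_cover X \<U> \<longleftrightarrow> (\<forall>U\<in>\<U>. U \<subseteq> pts X) \<and> pts X = (\<Union>U\<in>\<U>. cinterior X U)"

text \<open>
  Maps are extensional (they are \<open>undefined\<close> outside the carrier), so that distinct elements of
  the following set are distinct as maps between the carriers.
\<close>

definition cmaps :: "'a cspace \<Rightarrow> 'b cspace \<Rightarrow> ('a \<Rightarrow> 'b) set" where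
  "cmaps X Y =
     {f \<in> pts X \<rightarrow>\<^sub>E pts Y. \<forall>A. A \<subseteq> pts X \<longrightarrow> f ` cls X A \<subseteq> cls Y (f ` A)}"

definition top_cspace :: "'a topology \<Rightarrow> 'a cspace" where
  "top_cspace T = \<lparr>pts = topspace T, cls = (\<lambda>A. T closure_of A)\<rparr>"

definition indiscrete_cspace :: "'a set \<Rightarrow> 'a cspace" where
  "indiscrete_cspace S = \<lparr>pts = S, cls = (\<lambda>A. if A = {} then {} else S)\<rparr>"

definition upset_cspace :: "'a::order set \<Rightarrow> 'a cspace" where
  "upset_cspace S = \<lparr>pts = S, cls = (\<lambda>A. {j \<in> S. \<exists>i\<in>A. i \<le> j})\<rparr>"

text \<open>
  The \<open>n\<close>-fold power of a closure space, with coordinates indexed by \<open>1, \<dots>, n\<close>: the closure for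
  which the boxes of neighbourhoods form a neighbourhood base (see \<open>cnbhd_cpower_iff\<close> below).
  For \<open>n = 0\<close> the carrier is a single point.
\<close>

definition cpower :: "'a cspace \<Rightarrow> nat \<Rightarrow> (nat \<Rightarrow> 'a) cspace" where
  "cpower J n =
     \<lparr>pts = {1..n} \<rightarrow>\<^sub>E pts J,
      cls = (\<lambda>A. {x \<in> {1..n} \<rightarrow>\<^sub>E pts J.
                    \<forall>U. (\<forall>i\<in>{1..n}. cnbhd J (x i) (U i)) \<longrightarrow> PiE {1..n} U \<inter> A \<noteq> {}})\<rparr>"

lemma cnbhd_cpower_iff:
  assumes "x \<in> pts (cpower J n)"
  shows "cnbhd (cpower J n) x V \<longleftrightarrow>
           V \<subseteq> pts (cpower J n) \<and> (\<exists>U. (\<forall>i\<in>{1..n}. cnbhd J (x i) (U i)) \<and> PiE {1..n} U \<subseteq> V)"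
proof -
  have box: "PiE {1..n} U \<subseteq> pts (cpower J n)" if "\<forall>i\<in>{1..n}. cnbhd J (x i) (U i)" for U
    using that unfolding cpower_def cnbhd_def by (auto intro!: PiE_mono)
  have "x \<in> cinterior (cpower J n) V \<longleftrightarrow>
          (\<exists>U. (\<forall>i\<in>{1..n}. cnbhd J (x i) (U i)) \<and> PiE {1..n} U \<inter> (pts (cpower J n) - V) = {})"
    using assms unfolding cinterior_def by (auto simp: cpower_def)
  also have "\<dots> \<longleftrightarrow> (\<exists>U. (\<forall>i\<in>{1..n}. cnbhd J (x i) (U i)) \<and> PiE {1..n} U \<subseteq> V)"
    using box by blast
  finally show ?thesis unfolding cnbhd_def by blast
qed


section \<open>The three intervals and their simplices\<close>

definition int_I :: "real cspace" where
  "int_I = top_cspace (top_of_set {0..1})"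

definition int_J1 :: "real cspace" where
  "int_J1 = indiscrete_cspace {0, 1}"

definition int_Jplus :: "real cspace" where
  "int_Jplus = upset_cspace {0, 1}"

lemma cls_int_Jplus: "cls int_Jplus {0} = {0, 1}" "cls int_Jplus {1} = {1}"
  by (auto simp: int_Jplus_def upset_cspace_def)

text \<open>
  The point types of the three families of simplices differ, so the singular complex is
  parametrized by a family of simplices with its face inclusions \<open>d\<^sup>i\<close>; these are given by
  a formula that does not depend on the dimension.
\<close>

record 'p simplices =
  simplex :: "nat \<Rightarrow> 'p cspace"
  face :: "nat \<Rightarrow> 'p \<Rightarrow> 'p"

definition simp_I :: "(nat \<Rightarrow> real) simplices" where
  "simp_I =
     \<lparr>simplex = (\<lambda>n. top_cspace (subtopology (powertop_real UNIV) (standard_simplex n))),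
      face = simplical_face\<rparr>"

definition simp_J1 :: "nat simplices" where
  "simp_J1 =
     \<lparr>simplex = (\<lambda>n. indiscrete_cspace {0..n}), face = (\<lambda>i j. if j < i then j else Suc j)\<rparr>"

definition simp_Jplus :: "nat simplices" where
  "simp_Jplus =
     \<lparr>simplex = (\<lambda>n. upset_cspace {0..n}), face = (\<lambda>i j. if j < i then j else Suc j)\<rparr>"


section \<open>Chain complexes and cohomology\<close>

text \<open>
  The map \<open>bd C n\<close> is the boundary from degree \<open>Suc n\<close> to degree \<open>n\<close>. All chain groups
  in negative degrees are zero.
\<close>

record 'c chain_cplx =
  chains :: "nat \<Rightarrow> 'c monoid"
  bd :: "nat \<Rightarrow> 'c \<Rightarrow> 'c"

text \<open>
  The map induced by \<open>h\<close> into the quotient of \<open>H\<close> by \<open>N\<close>, on cosets \<open>K\<close> of some \<open>N'\<close> that \<open>h\<close> maps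
  into \<open>N\<close>: it sends \<open>K\<close> to the coset \<open>N + h(K)\<close>.
\<close>

definition coset_map ::
    "('b, 'm) monoid_scheme \<Rightarrow> 'b set \<Rightarrow> ('a \<Rightarrow> 'b) \<Rightarrow> 'a set \<Rightarrow> 'b set" where
  "coset_map H N h K = N <#>\<^bsub>H\<^esub> (h ` K)"

lemma coset_map_r_coset:
  assumes h: "h \<in> hom G H" and "group G" "group H"
    and N': "subgroup N' G" and N: "subgroup N H" and sub: "h ` N' \<subseteq> N" and x: "x \<in> carrier G"
  shows "coset_map H N h (N' #>\<^bsub>G\<^esub> x) = N #>\<^bsub>H\<^esub> h x"
proof -
  interpret G: group G by fact
  interpret H: group H by fact
  interpret N: subgroup N H by fact
  interpret N': subgroup N' G by fact
  have hx: "h x \<in> carrier H" using hom_in_carrier[OF h x] .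
  have img: "h (y \<otimes>\<^bsub>G\<^esub> x) = h y \<otimes>\<^bsub>H\<^esub> h x" "h y \<in> N" if "y \<in> N'" for y
    using hom_mult[OF h _ x] that sub by auto
  show ?thesis
  proof
    show "coset_map H N h (N' #>\<^bsub>G\<^esub> x) \<subseteq> N #>\<^bsub>H\<^esub> h x"
      using img hx by (force simp: coset_map_def set_mult_def r_coset_def H.m_assoc[symmetric])
    show "N #>\<^bsub>H\<^esub> h x \<subseteq> coset_map H N h (N' #>\<^bsub>G\<^esub> x)"
      using N'.one_closed x
      by (force simp: coset_map_def set_mult_def r_coset_def intro!: bexI[of _ "\<one>\<^bsub>G\<^esub>"])
  qed
qed

definition quotient_cplx :: "'c chain_cplx \<Rightarrow> (nat \<Rightarrow> 'c set) \<Rightarrow> 'c set chain_cplx" where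
  "quotient_cplx C N =
     \<lparr>chains = (\<lambda>n. chains C n Mod N n),
      bd = (\<lambda>n. coset_map (chains C n) (N n) (bd C n))\<rparr>"

definition hom_group ::
    "('c, 'k) monoid_scheme \<Rightarrow> ('g, 'm) monoid_scheme \<Rightarrow> ('c \<Rightarrow> 'g) monoid" where
  "hom_group C G =
     \<lparr>carrier = hom C G \<inter> extensional (carrier C),
      mult = (\<lambda>\<phi> \<psi>. \<lambda>x\<in>carrier C. \<phi> x \<otimes>\<^bsub>G\<^esub> \<psi> x),
      one = (\<lambda>x\<in>carrier C. \<one>\<^bsub>G\<^esub>)\<rparr>"

definition cochains ::
    "'c chain_cplx \<Rightarrow> ('g, 'm) monoid_scheme \<Rightarrow> nat \<Rightarrow> ('c \<Rightarrow> 'g) monoid" where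
  "cochains C G n = hom_group (chains C n) G"

definition coboundary :: "'c chain_cplx \<Rightarrow> nat \<Rightarrow> ('c \<Rightarrow> 'g) \<Rightarrow> ('c \<Rightarrow> 'g)" where
  "coboundary C n \<phi> = (\<lambda>x\<in>carrier (chains C (Suc n)). \<phi> (bd C n x))"

definition cocycles ::
    "'c chain_cplx \<Rightarrow> ('g, 'm) monoid_scheme \<Rightarrow> nat \<Rightarrow> ('c \<Rightarrow> 'g) set" where
  "cocycles C G n = kernel (cochains C G n) (cochains C G (Suc n)) (coboundary C n)"

definition coboundaries ::
    "'c chain_cplx \<Rightarrow> ('g, 'm) monoid_scheme \<Rightarrow> nat \<Rightarrow> ('c \<Rightarrow> 'g) set" where
  "coboundaries C G n =
     (case n of 0 \<Rightarrow> {\<one>\<^bsub>cochains C G 0\<^esub>}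
              | Suc m \<Rightarrow> coboundary C m ` carrier (cochains C G m))"

definition cohomology ::
    "'c chain_cplx \<Rightarrow> ('g, 'm) monoid_scheme \<Rightarrow> nat \<Rightarrow> ('c \<Rightarrow> 'g) set monoid" where
  "cohomology C G n = (cochains C G n)\<lparr>carrier := cocycles C G n\<rparr> Mod coboundaries C G n"

text \<open>The map from the cohomology of \<open>C\<close> to that of \<open>C'\<close> induced by a chain map \<open>f\<close> from \<open>C'\<close> to \<open>C\<close>.\<close>

definition cohomology_map ::
    "'c chain_cplx \<Rightarrow> 'd chain_cplx \<Rightarrow> (nat \<Rightarrow> 'd \<Rightarrow> 'c) \<Rightarrow> ('g, 'm) monoid_scheme \<Rightarrow> nat
     \<Rightarrow> ('c \<Rightarrow> 'g) set \<Rightarrow> ('d \<Rightarrow> 'g) set" where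
  "cohomology_map C C' f G n =
     coset_map (cochains C' G n) (coboundaries C' G n)
       (\<lambda>\<phi>. \<lambda>x\<in>carrier (chains C' n). \<phi> (f n x))"


section \<open>Singular simplices\<close>

definition simplicial_bd ::
    "'p simplices \<Rightarrow> nat \<Rightarrow> (('p \<Rightarrow> 'a) \<Rightarrow>\<^sub>0 int) \<Rightarrow> (('p \<Rightarrow> 'a) \<Rightarrow>\<^sub>0 int)" where
  "simplicial_bd \<Delta> n =
     frag_extend (\<lambda>\<sigma>. \<Sum>i = 0..Suc n.
       frag_cmul ((-1) ^ i) (frag_of (\<lambda>x\<in>pts (simplex \<Delta> n). \<sigma> (face \<Delta> i x))))"

definition simplicial_cplx ::
    "'p simplices \<Rightarrow> 'a cspace \<Rightarrow> (('p \<Rightarrow> 'a) \<Rightarrow>\<^sub>0 int) chain_cplx" where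
  "simplicial_cplx \<Delta> X =
     \<lparr>chains = (\<lambda>n. free_Abelian_group (cmaps (simplex \<Delta> n) X)),
      bd = simplicial_bd \<Delta>\<rparr>"

text \<open>
  A simplex of a subspace is literally a simplex of the whole space, so the chains of the subspace
  form a subset of the chains of the whole space.
\<close>

definition simplicial_rel_cplx ::
    "'p simplices \<Rightarrow> 'a cspace \<Rightarrow> 'a set \<Rightarrow> (('p \<Rightarrow> 'a) \<Rightarrow>\<^sub>0 int) set chain_cplx" where
  "simplicial_rel_cplx \<Delta> X A =
     quotient_cplx (simplicial_cplx \<Delta> X) (\<lambda>n. carrier (chains (simplicial_cplx \<Delta> (subcspace X A)) n))"

text \<open>The chain map induced by the inclusion into \<open>(X, A)\<close> of any pair \<open>(Y, B)\<close> contained in it.\<close>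

definition simplicial_rel_incl ::
    "'p simplices \<Rightarrow> 'a cspace \<Rightarrow> 'a set \<Rightarrow> nat
     \<Rightarrow> (('p \<Rightarrow> 'a) \<Rightarrow>\<^sub>0 int) set \<Rightarrow> (('p \<Rightarrow> 'a) \<Rightarrow>\<^sub>0 int) set" where
  "simplicial_rel_incl \<Delta> X A n =
     coset_map (chains (simplicial_cplx \<Delta> X) n)
       (carrier (chains (simplicial_cplx \<Delta> (subcspace X A)) n)) id"

definition simplicial_cohomology ::
    "'p simplices \<Rightarrow> nat \<Rightarrow> 'a cspace \<Rightarrow> 'a set \<Rightarrow> ('g, 'm) monoid_scheme
     \<Rightarrow> ((('p \<Rightarrow> 'a) \<Rightarrow>\<^sub>0 int) set \<Rightarrow> 'g) set monoid" where
  "simplicial_cohomology \<Delta> n X A G = cohomology (simplicial_rel_cplx \<Delta> X A) G n"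

definition simplicial_incl_iso ::
    "'p simplices \<Rightarrow> nat \<Rightarrow> 'a set \<Rightarrow> 'a set \<Rightarrow> 'a cspace \<Rightarrow> 'a set \<Rightarrow> ('g, 'm) monoid_scheme \<Rightarrow> bool"
  where
  "simplicial_incl_iso \<Delta> n Y B X A G \<longleftrightarrow>
     cohomology_map (simplicial_rel_cplx \<Delta> X A) (simplicial_rel_cplx \<Delta> (subcspace X Y) B)
       (simplicial_rel_incl \<Delta> X A) G n
     \<in> iso (simplicial_cohomology \<Delta> n X A G) (simplicial_cohomology \<Delta> n (subcspace X Y) B G)"


section \<open>Singular cubes\<close>

definition cubes :: "real cspace \<Rightarrow> nat \<Rightarrow> 'a cspace \<Rightarrow> ((nat \<Rightarrow> real) \<Rightarrow> 'a) set" where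
  "cubes J n X = cmaps (cpower J n) X"

text \<open>\<open>insert_coord n i t x\<close> is the point of the \<open>Suc n\<close>-cube with \<open>t\<close> inserted as \<open>i\<close>-th coordinate.\<close>

definition insert_coord :: "nat \<Rightarrow> nat \<Rightarrow> real \<Rightarrow> (nat \<Rightarrow> real) \<Rightarrow> (nat \<Rightarrow> real)" where
  "insert_coord n i t x =
     (\<lambda>k\<in>{1..Suc n}. if k < i then x k else if k = i then t else x (k - 1))"

definition cube_face ::
    "real cspace \<Rightarrow> nat \<Rightarrow> nat \<Rightarrow> real \<Rightarrow> ((nat \<Rightarrow> real) \<Rightarrow> 'a) \<Rightarrow> ((nat \<Rightarrow> real) \<Rightarrow> 'a)" where
  "cube_face J n i t \<sigma> = (\<lambda>x\<in>pts (cpower J n). \<sigma> (insert_coord n i t x))"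

definition degenerate_cube :: "real cspace \<Rightarrow> nat \<Rightarrow> ((nat \<Rightarrow> real) \<Rightarrow> 'a) \<Rightarrow> bool" where
  "degenerate_cube J n \<sigma> \<longleftrightarrow>
     (\<exists>i\<in>{1..n}. \<forall>x\<in>pts (cpower J n). \<forall>t\<in>pts J. \<sigma> (x(i := t)) = \<sigma> x)"

definition cube_bd ::
    "real cspace \<Rightarrow> nat \<Rightarrow> (((nat \<Rightarrow> real) \<Rightarrow> 'a) \<Rightarrow>\<^sub>0 int) \<Rightarrow> (((nat \<Rightarrow> real) \<Rightarrow> 'a) \<Rightarrow>\<^sub>0 int)" where
  "cube_bd J n =
     frag_extend (\<lambda>\<sigma>. \<Sum>i = 1..Suc n.
       frag_cmul ((-1) ^ i) (frag_of (cube_face J n i 0 \<sigma>) - frag_of (cube_face J n i 1 \<sigma>)))"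

definition cube_cplx ::
    "real cspace \<Rightarrow> 'a cspace \<Rightarrow> (((nat \<Rightarrow> real) \<Rightarrow> 'a) \<Rightarrow>\<^sub>0 int) chain_cplx" where
  "cube_cplx J X =
     \<lparr>chains = (\<lambda>n. free_Abelian_group (cubes J n X)), bd = cube_bd J\<rparr>"

definition degenerate_chains ::
    "real cspace \<Rightarrow> 'a cspace \<Rightarrow> nat \<Rightarrow> (((nat \<Rightarrow> real) \<Rightarrow> 'a) \<Rightarrow>\<^sub>0 int) set" where
  "degenerate_chains J X n =
     generate (chains (cube_cplx J X) n) (frag_of ` {\<sigma> \<in> cubes J n X. degenerate_cube J n \<sigma>})"

definition cubical_cplx ::
    "real cspace \<Rightarrow> 'a cspace \<Rightarrow> (((nat \<Rightarrow> real) \<Rightarrow> 'a) \<Rightarrow>\<^sub>0 int) set chain_cplx" where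
  "cubical_cplx J X = quotient_cplx (cube_cplx J X) (degenerate_chains J X)"

text \<open>The chain map from the cubical complex of any subspace of \<open>X\<close> into that of \<open>X\<close>.\<close>

definition cubical_incl ::
    "real cspace \<Rightarrow> 'a cspace \<Rightarrow> nat
     \<Rightarrow> (((nat \<Rightarrow> real) \<Rightarrow> 'a) \<Rightarrow>\<^sub>0 int) set \<Rightarrow> (((nat \<Rightarrow> real) \<Rightarrow> 'a) \<Rightarrow>\<^sub>0 int) set" where
  "cubical_incl J X n = coset_map (chains (cube_cplx J X) n) (degenerate_chains J X n) id"

definition cubical_subchains ::
    "real cspace \<Rightarrow> 'a cspace \<Rightarrow> 'a set \<Rightarrow> nat \<Rightarrow> (((nat \<Rightarrow> real) \<Rightarrow> 'a) \<Rightarrow>\<^sub>0 int) set set" where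
  "cubical_subchains J X A n =
     cubical_incl J X n ` carrier (chains (cubical_cplx J (subcspace X A)) n)"

definition cubical_rel_cplx ::
    "real cspace \<Rightarrow> 'a cspace \<Rightarrow> 'a set
     \<Rightarrow> (((nat \<Rightarrow> real) \<Rightarrow> 'a) \<Rightarrow>\<^sub>0 int) set set chain_cplx" where
  "cubical_rel_cplx J X A = quotient_cplx (cubical_cplx J X) (cubical_subchains J X A)"

text \<open>The chain map induced by the inclusion into \<open>(X, A)\<close> of any pair \<open>(Y, B)\<close> contained in it.\<close>

definition cubical_rel_incl ::
    "real cspace \<Rightarrow> 'a cspace \<Rightarrow> 'a set \<Rightarrow> nat
     \<Rightarrow> (((nat \<Rightarrow> real) \<Rightarrow> 'a) \<Rightarrow>\<^sub>0 int) set set \<Rightarrow> (((nat \<Rightarrow> real) \<Rightarrow> 'a) \<Rightarrow>\<^sub>0 int) set set" where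
  "cubical_rel_incl J X A n =
     coset_map (chains (cubical_cplx J X) n) (cubical_subchains J X A n) (cubical_incl J X n)"

definition cubical_cohomology ::
    "real cspace \<Rightarrow> nat \<Rightarrow> 'a cspace \<Rightarrow> 'a set \<Rightarrow> ('g, 'm) monoid_scheme
     \<Rightarrow> ((((nat \<Rightarrow> real) \<Rightarrow> 'a) \<Rightarrow>\<^sub>0 int) set set \<Rightarrow> 'g) set monoid" where
  "cubical_cohomology J n X A G = cohomology (cubical_rel_cplx J X A) G n"

definition cubical_incl_iso ::
    "real cspace \<Rightarrow> nat \<Rightarrow> 'a set \<Rightarrow> 'a set \<Rightarrow> 'a cspace \<Rightarrow> 'a set \<Rightarrow> ('g, 'm) monoid_scheme \<Rightarrow> bool"
  where
  "cubical_incl_iso J n Y B X A G \<longleftrightarrow>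
     cohomology_map (cubical_rel_cplx J X A) (cubical_rel_cplx J (subcspace X Y) B)
       (cubical_rel_incl J X A) G n
     \<in> iso (cubical_cohomology J n X A G) (cubical_cohomology J n (subcspace X Y) B G)"

end

theory Submission
  imports Defs
begin

text \<open>
  A relative cochain on \<open>(X, A)\<close> is a homomorphism on the free group over all simplices (or cubes) of
  \<open>X\<close> that vanishes on those in \<open>A\<close> (and on degenerate cubes). Restriction to \<open>B\<close> is therefore an
  isomorphism in cohomology as soon as the free complex of \<open>X\<close> modulo its subcomplex \<open>S\<close>, spanned by
  the simplices that are degenerate or lie in \<open>A\<close> or in \<open>B\<close>, is acyclic: being free and acyclic, the
  quotient is contractible, so a cocycle that vanishes on \<open>S\<close> is the coboundary of a cochain
  that vanishes on \<open>S\<close>.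

  For \<open>J\<^sub>1\<close> and \<open>J\<^sub>+\<close> every simplex and every cube has a point whose only neighbourhood is
  everything, so it lies in \<open>A\<close> or in \<open>B\<close> and \<open>S\<close> is the whole complex. For \<open>I\<close> the acyclicity follows by
  iterated subdivision, which makes every singular simplex or cube small by compactness. The simplices
  use the barycentric subdivision of the topological simplex, the cubes are cut into \<open>2\<^sup>n\<close> subcubes. All
  operators precompose a singular map with maps between topological simplices or cubes, so that
  it does not matter that \<open>X\<close> is only a closure space.
\<close>

section \<open>Free abelian groups\<close>

text \<open>The relative chain groups consist of cosets, for cubes even of cosets of cosets. Every
  complex is therefore handled through a basis \<open>U\<close> and a part \<open>T\<close> of that
  basis which spans the kernel. As all subgroups involved are spanned by basis elements, repeated
  quotients just unite subsets of the basis, and a cochain may be prescribed generator by generator.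
  The interior of a set in a closure space need not be open, so the preimages of the interiors of
  \<open>A\<close> and \<open>B\<close> under a singular map need not be open either. Continuity
  still gives a neighbourhood of each single point, and this is turned into an open cover of the
  simplex, or fed into a compactness argument on the cube. A square that links an interval to its
  two halves has a fourth edge. Here that edge is constant, so the cubical homotopy closes up modulo
  degenerate cubes. This is why the criterion for acyclicity tolerates errors in
  \<open>S\<close>.\<close>

definition frags :: "'b set \<Rightarrow> ('b \<Rightarrow>\<^sub>0 int) set" where
  "frags S = {c. Poly_Mapping.keys c \<subseteq> S}"

lemma carrier_free_Abelian_group_frags [simp]: "carrier (free_Abelian_group S) = frags S"
  by (auto simp: frags_def)

lemma frags_0 [simp]: "0 \<in> frags S"
  by (simp add: frags_def)

lemma frags_of [simp]: "frag_of x \<in> frags S \<longleftrightarrow> x \<in> S"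
  by (simp add: frags_def)

lemma frags_add: "a \<in> frags S \<Longrightarrow> b \<in> frags S \<Longrightarrow> a + b \<in> frags S"
  using keys_add[of a b] by (auto simp: frags_def)

lemma frags_diff: "a \<in> frags S \<Longrightarrow> b \<in> frags S \<Longrightarrow> a - b \<in> frags S"
  using keys_diff[of a b] by (auto simp: frags_def)

lemma frags_minus [simp]: "- a \<in> frags S \<longleftrightarrow> a \<in> frags S"
  by (simp add: frags_def)

lemma frags_cmul: "a \<in> frags S \<Longrightarrow> frag_cmul k a \<in> frags S"
  by (auto simp: frags_def)

lemma frags_sum: "(\<And>i. i \<in> I \<Longrightarrow> f i \<in> frags S) \<Longrightarrow> sum f I \<in> frags S"
  by (induction I rule: infinite_finite_induct) (auto intro: frags_add)

lemma frags_extend: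
  assumes "c \<in> frags S" "\<And>x. x \<in> S \<Longrightarrow> f x \<in> frags T"
  shows "frag_extend f c \<in> frags T"
  unfolding frag_extend_def using assms by (auto intro!: frags_sum frags_cmul simp: frags_def[of S])

lemma frags_mono: "a \<in> frags S \<Longrightarrow> S \<subseteq> T \<Longrightarrow> a \<in> frags T"
  by (auto simp: frags_def)

lemma frags_empty [simp]: "frags {} = {0}"
  by (auto simp: frags_def)

lemma frags_Int: "a \<in> frags (S \<inter> T) \<longleftrightarrow> a \<in> frags S \<and> a \<in> frags T"
  by (auto simp: frags_def)

lemma frags_induct [consumes 1, case_names zero one diff]:
  assumes "c \<in> frags S" "P 0" "\<And>x. x \<in> S \<Longrightarrow> P (frag_of x)"
    "\<And>a b. a \<in> frags S \<Longrightarrow> b \<in> frags S \<Longrightarrow> P a \<Longrightarrow> P b \<Longrightarrow> P (a - b)"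
  shows "P c"
  using free_Abelian_group_induct[of c S P] assms by (auto simp: frags_def)

lemma frags_Un_split:
  assumes "c \<in> frags (S \<union> T)"
  obtains a b where "a \<in> frags S" "b \<in> frags T" "c = a + b"
  using frag_split[of c S T] assms that by (metis frags_def mem_Collect_eq)

lemma inv_frags: "a \<in> frags S \<Longrightarrow> inv\<^bsub>free_Abelian_group S\<^esub> a = - a"
  by (simp add: frags_def)

lemma subgroup_frags:
  assumes "T \<subseteq> S"
  shows "subgroup (frags T) (free_Abelian_group S)"
proof (rule group.subgroupI)
  show "inv\<^bsub>free_Abelian_group S\<^esub> a \<in> frags T" if "a \<in> frags T" for a
    using inv_frags[OF frags_mono[OF that assms]] that by simp
  show "frags T \<noteq> {}"
    using frags_0[of T] by blast
qed (auto intro: frags_mono[OF _ assms] frags_add)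

lemma hom_frags_diff:
  assumes "\<phi> \<in> hom (free_Abelian_group U) G" "group G" "a \<in> frags U" "b \<in> frags U"
  shows "\<phi> (a - b) = \<phi> a \<otimes>\<^bsub>G\<^esub> inv\<^bsub>G\<^esub> \<phi> b"
proof -
  interpret group_hom "free_Abelian_group U" G \<phi>
    using assms by (simp add: group_hom_def group_hom_axioms_def)
  show ?thesis
    using hom_mult[of a "- b"] hom_inv[of b] assms by (simp add: inv_frags)
qed

lemma hom_frags_0:
  assumes "\<phi> \<in> hom (free_Abelian_group U) G" "group G"
  shows "\<phi> 0 = \<one>\<^bsub>G\<^esub>"
  using hom_one[OF assms(1) _ assms(2)] by simp

lemma hom_frags_eq:
  assumes \<phi>: "\<phi> \<in> hom (free_Abelian_group U) G" and \<psi>: "\<psi> \<in> hom (free_Abelian_group V) G"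
    and "group G" "T \<subseteq> U" "T \<subseteq> V" "c \<in> frags T"
    and "\<And>x. x \<in> T \<Longrightarrow> \<phi> (frag_of x) = \<psi> (frag_of x)"
  shows "\<phi> c = \<psi> c"
  using assms(6)
proof (induction rule: frags_induct)
  case zero
  show ?case
    by (simp add: hom_frags_0[OF \<phi>] hom_frags_0[OF \<psi>] assms)
next
  case (diff a b)
  then show ?case
    using frags_mono[OF _ assms(4)] frags_mono[OF _ assms(5)]
    by (simp add: hom_frags_diff[OF \<phi>] hom_frags_diff[OF \<psi>] assms(3))
qed (use assms in auto)

text \<open>Assuming just the difference law makes this applicable to expressions that are not a
  single \<open>frag_extend\<close>, such as the defect of a homotopy identity.\<close>

lemma linear_frags:
  assumes "c \<in> frags P" "\<And>u. u \<in> P \<Longrightarrow> f (frag_of u) \<in> frags Q" "\<And>a b. f (a - b) = f a - f b"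
  shows "f c \<in> frags Q"
  using assms(1)
proof (induction rule: frags_induct)
  case zero
  show ?case
    using assms(3)[of 0 0] by simp
qed (simp_all add: assms frags_diff)

lemma frag_cmul_diff_right: "frag_cmul k (a - b) = frag_cmul k a - frag_cmul k b"
  by (rule poly_mapping_eqI) (simp add: lookup_minus right_diff_distrib)

text \<open>Lets \<open>degenerate_chains\<close>, which is given as a generated subgroup, be
  described by supports, so that membership becomes inclusion of sets of generators.\<close>

lemma generate_frag_of:
  assumes "D \<subseteq> U"
  shows "generate (free_Abelian_group U) (frag_of ` D) = frags D"
proof -
  interpret group "free_Abelian_group U"
    by simp
  have sub: "frag_of ` D \<subseteq> carrier (free_Abelian_group U)"
    using assms by auto
  show ?thesis
  proof
    show "generate (free_Abelian_group U) (frag_of ` D) \<subseteq> frags D"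
      by (rule generate_subgroup_incl[OF _ subgroup_frags[OF assms]]) auto
    show "frags D \<subseteq> generate (free_Abelian_group U) (frag_of ` D)"
    proof
      fix c assume "c \<in> frags D"
      then show "c \<in> generate (free_Abelian_group U) (frag_of ` D)"
      proof (induction rule: frags_induct)
        case zero
        show ?case
          using generate.one[of "free_Abelian_group U"] by simp
      next
        case (one x)
        then show ?case
          by (intro generate.incl) auto
      next
        case (diff a b)
        have b: "b \<in> frags U"
          using diff assms frags_mono by blast
        have "a \<otimes>\<^bsub>free_Abelian_group U\<^esub> inv\<^bsub>free_Abelian_group U\<^esub> b
            \<in> generate (free_Abelian_group U) (frag_of ` D)"
          using diff generate_m_inv_closed[OF sub] by (intro generate.eng) auto
        then show ?case
          using inv_frags[OF b] by simp
      qed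
    qed
  qed
qed


section \<open>Cohomology classes and induced maps\<close>

text \<open>The hypotheses make \<open>M\<close> the full preimage of \<open>N\<close> and let
  \<open>h\<close> meet every coset of \<open>N\<close>, which is injectivity and surjectivity on
  the quotients. In the application the groups consist of cocycles and the subgroups of
  coboundaries.\<close>

lemma group_hom_coset_map_iso:
  assumes G: "comm_group G" and H: "comm_group H" and h: "h \<in> hom G H"
    and M: "subgroup M G" and N: "subgroup N H" and sub: "h ` M \<subseteq> N"
    and inj: "\<And>x. x \<in> carrier G \<Longrightarrow> h x \<in> N \<Longrightarrow> x \<in> M"
    and surj: "\<And>y. y \<in> carrier H \<Longrightarrow> \<exists>x\<in>carrier G. \<exists>b\<in>N. y = b \<otimes>\<^bsub>H\<^esub> h x"
  shows "coset_map H N h \<in> iso (G Mod M) (H Mod N)"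
proof -
  interpret G: comm_group G by fact
  interpret H: comm_group H by fact
  have nM: "M \<lhd> G" and nN: "N \<lhd> H"
    using M N by (auto intro: G.subgroup_imp_normal H.subgroup_imp_normal)
  have map: "coset_map H N h (M #>\<^bsub>G\<^esub> x) = N #>\<^bsub>H\<^esub> h x" if "x \<in> carrier G" for x
    using coset_map_r_coset[OF h _ _ M N sub that] by (simp add: G.group_axioms H.group_axioms)
  have hc: "h x \<in> carrier H" if "x \<in> carrier G" for x
    using hom_in_carrier[OF h that] .
  have homc: "coset_map H N h \<in> hom (G Mod M) (H Mod N)"
  proof (rule homI)
    fix a b assume "a \<in> carrier (G Mod M)" "b \<in> carrier (G Mod M)"
    then obtain x y where xy: "x \<in> carrier G" "y \<in> carrier G" "a = M #>\<^bsub>G\<^esub> x" "b = M #>\<^bsub>G\<^esub> y"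
      by (auto simp: carrier_FactGroup)
    then show "coset_map H N h (a \<otimes>\<^bsub>G Mod M\<^esub> b)
        = coset_map H N h a \<otimes>\<^bsub>H Mod N\<^esub> coset_map H N h b"
      by (simp add: normal.rcos_sum[OF nM] normal.rcos_sum[OF nN] map hc hom_mult[OF h])
  qed (auto simp: carrier_FactGroup map hc)
  interpret Q: group_hom "G Mod M" "H Mod N" "coset_map H N h"
    using homc normal.factorgroup_is_group[OF nM] normal.factorgroup_is_group[OF nN]
    by (simp add: group_hom_def group_hom_axioms_def)
  show ?thesis
    unfolding Q.iso_iff
  proof (intro conjI ballI impI subsetI)
    fix z assume "z \<in> carrier (H Mod N)"
    then obtain y where y: "y \<in> carrier H" "z = N #>\<^bsub>H\<^esub> y"
      by (auto simp: carrier_FactGroup)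
    then obtain x b where xb: "x \<in> carrier G" "b \<in> N" "y = b \<otimes>\<^bsub>H\<^esub> h x"
      using surj by blast
    have "z = N #>\<^bsub>H\<^esub> h x"
      using y xb hc H.repr_independence[OF _ _ N, of y "h x"]
      by (auto simp: r_coset_def)
    then show "z \<in> coset_map H N h ` carrier (G Mod M)"
      using xb by (auto simp: carrier_FactGroup map intro!: image_eqI[of _ _ "M #>\<^bsub>G\<^esub> x"])
  next
    fix a assume "a \<in> carrier (G Mod M)" and one: "coset_map H N h a = \<one>\<^bsub>H Mod N\<^esub>"
    then obtain x where x: "x \<in> carrier G" "a = M #>\<^bsub>G\<^esub> x"
      by (auto simp: carrier_FactGroup)
    then have "h x \<in> N"
      using one H.coset_join1[OF _ hc N] by (simp add: map)
    then show "a = \<one>\<^bsub>G Mod M\<^esub>"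
      using inj x G.coset_join2[OF _ M] by simp
  qed
qed

lemma carrier_hom_group: "carrier (hom_group C G) = hom C G \<inter> extensional (carrier C)"
  by (simp add: hom_group_def)

lemma mult_hom_group:
  "\<phi> \<otimes>\<^bsub>hom_group C G\<^esub> \<psi> = (\<lambda>x\<in>carrier C. \<phi> x \<otimes>\<^bsub>G\<^esub> \<psi> x)"
  by (simp add: hom_group_def)

lemma one_hom_group: "\<one>\<^bsub>hom_group C G\<^esub> = (\<lambda>x\<in>carrier C. \<one>\<^bsub>G\<^esub>)"
  by (simp add: hom_group_def)

lemma restrict_in_hom_group:
  assumes "group C" "\<phi> \<in> hom C G"
  shows "restrict \<phi> (carrier C) \<in> carrier (hom_group C G)"
  using assms monoid.m_closed[of C] by (auto simp: carrier_hom_group hom_def group_def)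

lemma comm_group_hom_group:
  assumes "group C" "comm_group G"
  shows "comm_group (hom_group C G)"
proof -
  interpret C: group C by fact
  interpret G: comm_group G by fact
  show ?thesis
  proof (rule comm_groupI)
    fix \<phi> \<psi> assume "\<phi> \<in> carrier (hom_group C G)" "\<psi> \<in> carrier (hom_group C G)"
    then show "\<phi> \<otimes>\<^bsub>hom_group C G\<^esub> \<psi> \<in> carrier (hom_group C G)"
      by (auto simp: carrier_hom_group mult_hom_group hom_def Pi_iff G.m_ac)
  next
    fix \<phi> assume a: "\<phi> \<in> carrier (hom_group C G)"
    then have c: "\<phi> x \<in> carrier G" if "x \<in> carrier C" for x
      using that by (auto simp: carrier_hom_group hom_def)
    show "\<one>\<^bsub>hom_group C G\<^esub> \<otimes>\<^bsub>hom_group C G\<^esub> \<phi> = \<phi>"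
      using a c by (auto simp: carrier_hom_group mult_hom_group one_hom_group extensional_def)
    have "(\<lambda>x\<in>carrier C. inv\<^bsub>G\<^esub> \<phi> x) \<in> carrier (hom_group C G)"
      using a by (auto simp: carrier_hom_group hom_def Pi_iff G.inv_mult)
    moreover have "(\<lambda>x\<in>carrier C. inv\<^bsub>G\<^esub> \<phi> x) \<otimes>\<^bsub>hom_group C G\<^esub> \<phi> = \<one>\<^bsub>hom_group C G\<^esub>"
      using c by (auto simp: mult_hom_group one_hom_group intro!: restrict_ext)
    ultimately show "\<exists>\<psi>\<in>carrier (hom_group C G). \<psi> \<otimes>\<^bsub>hom_group C G\<^esub> \<phi> = \<one>\<^bsub>hom_group C G\<^esub>"
      by blast
  qed (auto simp: carrier_hom_group mult_hom_group one_hom_group hom_def Pi_iff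
         G.m_ac intro!: restrict_ext)
qed


section \<open>Complexes presented by free groups\<close>

text \<open>
  The group \<open>chains K n\<close> is \<open>\<int>[U n] / \<int>[T n]\<close> by means of \<open>\<pi> n\<close>, with boundary induced by \<open>d\<close>.
\<close>

locale presentation =
  fixes K :: "'c chain_cplx" and U T :: "nat \<Rightarrow> 'b set"
    and d :: "nat \<Rightarrow> ('b \<Rightarrow>\<^sub>0 int) \<Rightarrow> ('b \<Rightarrow>\<^sub>0 int)" and \<pi> :: "nat \<Rightarrow> ('b \<Rightarrow>\<^sub>0 int) \<Rightarrow> 'c"
  assumes T_sub: "T n \<subseteq> U n"
    and d_diff: "d n (a - b) = d n a - d n b"
    and d_U: "x \<in> frags (U (Suc n)) \<Longrightarrow> d n x \<in> frags (U n)"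
    and d_d: "x \<in> frags (U (Suc (Suc n))) \<Longrightarrow> d n (d (Suc n) x) = 0"
    and d_T: "x \<in> frags (T (Suc n)) \<Longrightarrow> d n x \<in> frags (T n)"
    and comm_chains: "comm_group (chains K n)"
    and \<pi>_hom: "\<pi> n \<in> hom (free_Abelian_group (U n)) (chains K n)"
    and \<pi>_surj: "carrier (chains K n) = \<pi> n ` frags (U n)"
    and \<pi>_ker: "x \<in> frags (U n) \<Longrightarrow> \<pi> n x = \<one>\<^bsub>chains K n\<^esub> \<longleftrightarrow> x \<in> frags (T n)"
    and bd_\<pi>: "x \<in> frags (U (Suc n)) \<Longrightarrow> bd K n (\<pi> (Suc n) x) = \<pi> n (d n x)"
begin

lemma group_chains: "group (chains K n)"
  using comm_chains by (simp add: comm_group_def)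

lemma d_0: "d n 0 = 0"
  using d_diff[of n 0 0] by simp

lemma d_add: "d n (a + b) = d n a + d n b"
proof -
  have "d n (a - (0 - b)) = d n a - (d n 0 - d n b)"
    by (simp only: d_diff)
  then show ?thesis
    by (simp add: d_0)
qed

lemma \<pi>_carrier: "x \<in> frags (U n) \<Longrightarrow> \<pi> n x \<in> carrier (chains K n)"
  by (simp add: \<pi>_surj)

lemma \<pi>_add:
  "x \<in> frags (U n) \<Longrightarrow> y \<in> frags (U n) \<Longrightarrow> \<pi> n (x + y) = \<pi> n x \<otimes>\<^bsub>chains K n\<^esub> \<pi> n y"
  using hom_mult[OF \<pi>_hom, of x n y] by simp

lemma \<pi>_0: "\<pi> n 0 = \<one>\<^bsub>chains K n\<^esub>"
  using \<pi>_ker[of 0 n] by simp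

lemma \<pi>_eq_iff:
  assumes "x \<in> frags (U n)" "y \<in> frags (U n)"
  shows "\<pi> n x = \<pi> n y \<longleftrightarrow> x - y \<in> frags (T n)"
proof -
  interpret Kn: group "chains K n" by (rule group_chains)
  have "\<pi> n ((x - y) + y) = \<pi> n (x - y) \<otimes>\<^bsub>chains K n\<^esub> \<pi> n y"
    using assms by (intro \<pi>_add frags_diff)
  then have "\<pi> n x = \<pi> n y \<longleftrightarrow> \<pi> n (x - y) \<otimes>\<^bsub>chains K n\<^esub> \<pi> n y = \<pi> n y"
    by simp
  also have "\<dots> \<longleftrightarrow> \<pi> n (x - y) = \<one>\<^bsub>chains K n\<^esub>"
    using assms by (intro Kn.r_cancel_one \<pi>_carrier frags_diff) auto
  finally show ?thesis
    using assms \<pi>_ker frags_diff by blast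
qed

lemma bd_hom: "bd K n \<in> hom (chains K (Suc n)) (chains K n)"
proof (rule homI)
  fix a b assume "a \<in> carrier (chains K (Suc n))" "b \<in> carrier (chains K (Suc n))"
  then obtain x y where xy: "x \<in> frags (U (Suc n))" "a = \<pi> (Suc n) x"
      "y \<in> frags (U (Suc n))" "b = \<pi> (Suc n) y"
    by (auto simp: \<pi>_surj)
  then show "bd K n (a \<otimes>\<^bsub>chains K (Suc n)\<^esub> b) = bd K n a \<otimes>\<^bsub>chains K n\<^esub> bd K n b"
    by (simp add: \<pi>_add[symmetric] bd_\<pi> frags_add d_U d_add)
qed (auto simp: \<pi>_surj bd_\<pi> d_U)

lemma comm_group_cochains: "comm_group G \<Longrightarrow> comm_group (cochains K G n)"
  unfolding cochains_def by (rule comm_group_hom_group[OF group_chains])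

lemma cochain_pullback_hom:
  assumes "\<phi> \<in> carrier (cochains K G n)"
  shows "(\<lambda>x. \<phi> (\<pi> n x)) \<in> hom (free_Abelian_group (U n)) G"
  using hom_compose[OF \<pi>_hom, of \<phi>] assms
  by (auto simp: cochains_def carrier_hom_group o_def)

lemma cochain_pullback_one:
  assumes "\<phi> \<in> carrier (cochains K G n)" "group G" "x \<in> frags (T n)"
  shows "\<phi> (\<pi> n x) = \<one>\<^bsub>G\<^esub>"
proof -
  have "\<pi> n x = \<one>\<^bsub>chains K n\<^esub>"
    using \<pi>_ker assms(3) frags_mono[OF assms(3) T_sub] by blast
  then show ?thesis
    using hom_one[of \<phi> "chains K n" G] assms group_chains
    by (simp add: cochains_def carrier_hom_group)
qed

lemma cochain_ext:
  assumes "\<phi> \<in> carrier (cochains K G n)" "\<psi> \<in> carrier (cochains K G n)"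
    "\<And>x. x \<in> frags (U n) \<Longrightarrow> \<phi> (\<pi> n x) = \<psi> (\<pi> n x)"
  shows "\<phi> = \<psi>"
  using assms unfolding cochains_def carrier_hom_group
  by (intro extensionalityI[of _ "carrier (chains K n)"]) (auto simp: \<pi>_surj)

text \<open>Converse to \<open>cochain_pullback_hom\<close> and \<open>cochain_pullback_one\<close>:
  cochains of the quotient are the homomorphisms on \<open>frags (U n)\<close> that are trivial on
  \<open>frags (T n)\<close>.\<close>

lemma cochain_descend:
  assumes \<psi>: "\<psi> \<in> hom (free_Abelian_group (U n)) G" and G: "group G"
    and one: "\<And>x. x \<in> frags (T n) \<Longrightarrow> \<psi> x = \<one>\<^bsub>G\<^esub>"
  obtains \<phi> where "\<phi> \<in> carrier (cochains K G n)" "\<And>x. x \<in> frags (U n) \<Longrightarrow> \<phi> (\<pi> n x) = \<psi> x"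
proof -
  \<comment> \<open>An arbitrary representative of each class; \<open>eq\<close> below shows that
    \<psi> does not see the choice.\<close>
  define r where "r c = (SOME x. x \<in> frags (U n) \<and> \<pi> n x = c)" for c
  have r: "r c \<in> frags (U n)" "\<pi> n (r c) = c" if "c \<in> carrier (chains K n)" for c
    using someI_ex[of "\<lambda>x. x \<in> frags (U n) \<and> \<pi> n x = c"] that by (auto simp: \<pi>_surj r_def)
  interpret G: group G by fact
  have add: "\<psi> (x + y) = \<psi> x \<otimes>\<^bsub>G\<^esub> \<psi> y" if "x \<in> frags (U n)" "y \<in> frags (U n)" for x y
    using hom_mult[OF \<psi>, of x y] that by simp
  have c: "\<psi> x \<in> carrier G" if "x \<in> frags (U n)" for x
    using hom_in_carrier[OF \<psi>, of x] that by simp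
  have eq: "\<psi> x = \<psi> y" if "x \<in> frags (U n)" "y \<in> frags (U n)" "\<pi> n x = \<pi> n y" for x y
  proof -
    have "x - y \<in> frags (T n)"
      using \<pi>_eq_iff that by blast
    then have "\<psi> ((x - y) + y) = \<psi> y"
      using one add[of "x - y" y] that c by (simp add: frags_diff)
    then show ?thesis by simp
  qed
  define \<phi> where "\<phi> = (\<lambda>c\<in>carrier (chains K n). \<psi> (r c))"
  have \<phi>: "\<phi> (\<pi> n x) = \<psi> x" if "x \<in> frags (U n)" for x
    using that r[OF \<pi>_carrier[OF that]] by (simp add: \<phi>_def \<pi>_carrier) (metis eq)
  have "\<phi> \<in> hom (chains K n) G"
  proof (rule homI)
    fix a b assume "a \<in> carrier (chains K n)" "b \<in> carrier (chains K n)"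
    then obtain x y where "x \<in> frags (U n)" "a = \<pi> n x" "y \<in> frags (U n)" "b = \<pi> n y"
      by (auto simp: \<pi>_surj)
    then show "\<phi> (a \<otimes>\<^bsub>chains K n\<^esub> b) = \<phi> a \<otimes>\<^bsub>G\<^esub> \<phi> b"
      by (simp add: \<pi>_add[symmetric] \<phi> frags_add add)
  qed (auto simp: \<pi>_surj \<phi> c)
  then have "\<phi> \<in> carrier (cochains K G n)"
    by (simp add: cochains_def carrier_hom_group \<phi>_def)
  with \<phi> show ?thesis
    using that by blast
qed

lemma coboundary_apply:
  "x \<in> frags (U (Suc n)) \<Longrightarrow> coboundary K n \<phi> (\<pi> (Suc n) x) = \<phi> (\<pi> n (d n x))"
  by (simp add: coboundary_def \<pi>_carrier bd_\<pi>)

lemma coboundary_hom: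
  fixes G :: "('g, 'm) monoid_scheme"
  shows "coboundary K n \<in> hom (cochains K G n) (cochains K G (Suc n))"
proof (rule homI)
  fix \<phi> assume a: "\<phi> \<in> carrier (cochains K G n)"
  then have "(\<lambda>x. \<phi> (bd K n x)) \<in> hom (chains K (Suc n)) G"
    using hom_compose[OF bd_hom, where g = \<phi> and I = G] by (simp add: cochains_def carrier_hom_group o_def)
  then show "coboundary K n \<phi> \<in> carrier (cochains K G (Suc n))"
    unfolding cochains_def coboundary_def by (rule restrict_in_hom_group[OF group_chains])
next
  fix \<phi> \<psi>
  show "coboundary K n (\<phi> \<otimes>\<^bsub>cochains K G n\<^esub> \<psi>)
      = coboundary K n \<phi> \<otimes>\<^bsub>cochains K G (Suc n)\<^esub> coboundary K n \<psi>"
    using hom_in_carrier[OF bd_hom, of _ n]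
    by (auto simp: cochains_def mult_hom_group coboundary_def intro!: restrict_ext)
qed

lemma cocycles_iff:
  assumes "comm_group G"
  shows "\<phi> \<in> cocycles K G n \<longleftrightarrow> \<phi> \<in> carrier (cochains K G n) \<and>
     (\<forall>x\<in>frags (U (Suc n)). \<phi> (\<pi> n (d n x)) = \<one>\<^bsub>G\<^esub>)"
proof -
  have "coboundary K n \<phi> = \<one>\<^bsub>cochains K G (Suc n)\<^esub> \<longleftrightarrow>
     (\<forall>x\<in>frags (U (Suc n)). \<phi> (\<pi> n (d n x)) = \<one>\<^bsub>G\<^esub>)"
    unfolding cochains_def one_hom_group coboundary_def
    by (auto simp: fun_eq_iff restrict_def \<pi>_surj bd_\<pi>)
  then show ?thesis
    by (auto simp: cocycles_def kernel_def)
qed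

lemma subgroup_cocycles: "comm_group G \<Longrightarrow> subgroup (cocycles K G n) (cochains K G n)"
  unfolding cocycles_def
  by (rule group_hom.subgroup_kernel)
     (simp add: group_hom_def group_hom_axioms_def coboundary_hom comm_group.axioms(2)
        comm_group_cochains)

lemma coboundary_cocycle:
  assumes "comm_group G" "\<phi> \<in> carrier (cochains K G n)"
  shows "coboundary K n \<phi> \<in> cocycles K G (Suc n)"
  using assms hom_in_carrier[OF coboundary_hom assms(2)]
    hom_one[of \<phi> "chains K n" G] group_chains
  by (auto simp: cocycles_iff coboundary_apply d_U d_d \<pi>_0 cochains_def carrier_hom_group
       comm_group_def)

lemma subgroup_coboundaries:
  assumes "comm_group G"
  shows "subgroup (coboundaries K G n) (cochains K G n)" "coboundaries K G n \<subseteq> cocycles K G n"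
proof -
  have grp: "group (cochains K G m)" for m
    using comm_group_cochains[OF assms] by (simp add: comm_group_def)
  show "subgroup (coboundaries K G n) (cochains K G n)"
  proof (cases n)
    case 0
    then show ?thesis
      using group.triv_subgroup[OF grp] by (simp add: coboundaries_def)
  next
    case (Suc m)
    have "group_hom (cochains K G m) (cochains K G (Suc m)) (coboundary K m)"
      by (simp add: group_hom_def group_hom_axioms_def coboundary_hom grp)
    then show ?thesis
      using Suc group_hom.img_is_subgroup by (auto simp: coboundaries_def)
  qed
  show "coboundaries K G n \<subseteq> cocycles K G n"
    using subgroup.one_closed[OF subgroup_cocycles[OF assms]] coboundary_cocycle[OF assms]
    by (auto simp: coboundaries_def split: nat.split)
qed

lemma comm_group_cocycles:
  "comm_group G \<Longrightarrow> comm_group ((cochains K G n)\<lparr>carrier := cocycles K G n\<rparr>)"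
proof -
  assume G: "comm_group G"
  interpret C: comm_group "cochains K G n"
    by (rule comm_group_cochains[OF G])
  interpret Z: subgroup "cocycles K G n" "cochains K G n"
    by (rule subgroup_cocycles[OF G])
  show ?thesis
    by (rule group.group_comm_groupI[OF Z.subgroup_is_group[OF C.group_axioms]])
       (auto intro: C.m_comm)
qed

lemma subgroup_coboundaries_cocycles:
  "comm_group G \<Longrightarrow>
    subgroup (coboundaries K G n) ((cochains K G n)\<lparr>carrier := cocycles K G n\<rparr>)"
  by (rule group.subgroup_incl)
     (auto simp: subgroup_coboundaries subgroup_cocycles comm_group.axioms(2)[OF comm_group_cochains])

lemma subgroup_image:
  assumes "V \<subseteq> U n"
  shows "subgroup (\<pi> n ` frags V) (chains K n)"
proof -
  interpret group_hom "free_Abelian_group (U n)" "chains K n" "\<pi> n"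
    by (simp add: group_hom_def group_hom_axioms_def \<pi>_hom group_chains)
  show ?thesis
    by (rule subgroup_img_is_subgroup[OF subgroup_frags[OF assms]])
qed

end

text \<open>As every chain of \<open>K'\<close> is a class, prescribing \<open>f\<close> on classes
  compatibly with \<pi> already makes it additive. This is used for the map of cubical chains
  induced by an inclusion.\<close>

lemma presentation_map_hom:
  assumes "presentation K U T d \<pi>" "presentation K' W T' d' \<pi>'"
    and W: "W n \<subseteq> U n" and f: "\<And>x. x \<in> frags (W n) \<Longrightarrow> f (\<pi>' n x) = \<pi> n x"
  shows "f \<in> hom (chains K' n) (chains K n)"
proof -
  interpret P: presentation K U T d \<pi> by fact
  interpret P': presentation K' W T' d' \<pi>' by fact
  note mono = frags_mono[OF _ W]
  show ?thesis
  proof (rule homI)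
    fix a b assume "a \<in> carrier (chains K' n)" "b \<in> carrier (chains K' n)"
    then obtain x y where "x \<in> frags (W n)" "a = \<pi>' n x" "y \<in> frags (W n)" "b = \<pi>' n y"
      by (auto simp: P'.\<pi>_surj)
    then show "f (a \<otimes>\<^bsub>chains K' n\<^esub> b) = f a \<otimes>\<^bsub>chains K n\<^esub> f b"
      using mono by (simp add: P'.\<pi>_add[symmetric] f frags_add P.\<pi>_add)
  qed (use mono in \<open>auto simp: P'.\<pi>_surj f P.\<pi>_carrier\<close>)
qed

text \<open>Dividing by the image of a span of generators keeps the basis and just enlarges the
  kernel. Applied once this presents the relative simplicial complex, applied twice the relative
  cubical one.\<close>

lemma presentation_quotient:
  assumes "presentation K U T d \<pi>"
    and V: "\<And>n. V n \<subseteq> U n" "\<And>n x. x \<in> frags (V (Suc n)) \<Longrightarrow> d n x \<in> frags (V n)"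
    and N: "\<And>n. N n = \<pi> n ` frags (V n)"
  shows "presentation (quotient_cplx K N) U (\<lambda>n. T n \<union> V n) d
           (\<lambda>n x. N n #>\<^bsub>chains K n\<^esub> \<pi> n x)"
proof -
  interpret P: presentation K U T d \<pi> by fact
  have sub: "subgroup (N n) (chains K n)" for n
    unfolding N by (rule P.subgroup_image[OF V(1)])
  have nor: "N n \<lhd> chains K n" for n
    using comm_group.subgroup_imp_normal[OF P.comm_chains sub] .
  \<comment> \<open>The preimage of \<open>N n\<close> under \<open>\<pi> n\<close> also contains
    the old kernel, which is why \<open>T n\<close> joins \<open>V n\<close>.\<close>
  have N_iff: "\<pi> n x \<in> N n \<longleftrightarrow> x \<in> frags (T n \<union> V n)" if "x \<in> frags (U n)" for n x
  proof
    assume "\<pi> n x \<in> N n"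
    then obtain v where v: "v \<in> frags (V n)" "\<pi> n x = \<pi> n v"
      by (auto simp: N)
    then have "x - v \<in> frags (T n)"
      using P.\<pi>_eq_iff[OF that, of v] frags_mono[OF _ V(1)] by blast
    then show "x \<in> frags (T n \<union> V n)"
      using frags_add[OF frags_mono[of "x - v" "T n" "T n \<union> V n"] frags_mono[of v "V n" "T n \<union> V n"]]
        v by auto
  next
    assume "x \<in> frags (T n \<union> V n)"
    then obtain t v where tv: "t \<in> frags (T n)" "v \<in> frags (V n)" "x = t + v"
      by (rule frags_Un_split)
    then have "\<pi> n x = \<pi> n v"
      using P.\<pi>_eq_iff[OF that, of v] frags_mono[OF _ V(1)] by auto
    then show "\<pi> n x \<in> N n"
      using tv by (auto simp: N)
  qed
  show ?thesis
  proof (rule presentation.intro)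
    fix n a b x
    show "T n \<union> V n \<subseteq> U n"
      using V P.T_sub by auto
    show "d n (a - b) = d n a - d n b"
      by (rule P.d_diff)
    show "x \<in> frags (U (Suc n)) \<Longrightarrow> d n x \<in> frags (U n)"
      by (rule P.d_U)
    show "x \<in> frags (U (Suc (Suc n))) \<Longrightarrow> d n (d (Suc n) x) = 0"
      by (rule P.d_d)
    show "x \<in> frags (T (Suc n) \<union> V (Suc n)) \<Longrightarrow> d n x \<in> frags (T n \<union> V n)"
      using P.d_T[of _ n] V(2)[of _ n]
        frags_mono[of _ "T n" "T n \<union> V n"] frags_mono[of _ "V n" "T n \<union> V n"]
      by (elim frags_Un_split) (simp add: P.d_add frags_add)
    show "comm_group (chains (quotient_cplx K N) n)"
      using comm_group.abelian_FactGroup[OF P.comm_chains sub] by (simp add: quotient_cplx_def)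
    show "(\<lambda>x. N n #>\<^bsub>chains K n\<^esub> \<pi> n x) \<in> hom (free_Abelian_group (U n)) (chains (quotient_cplx K N) n)"
      using hom_compose[OF P.\<pi>_hom normal.r_coset_hom_Mod[OF nor]]
      by (simp add: quotient_cplx_def o_def)
    show "carrier (chains (quotient_cplx K N) n) = (\<lambda>x. N n #>\<^bsub>chains K n\<^esub> \<pi> n x) ` frags (U n)"
      by (auto simp: quotient_cplx_def carrier_FactGroup P.\<pi>_surj)
    show "N n #>\<^bsub>chains K n\<^esub> \<pi> n x = \<one>\<^bsub>chains (quotient_cplx K N) n\<^esub> \<longleftrightarrow> x \<in> frags (T n \<union> V n)"
      if "x \<in> frags (U n)"
      using N_iff[OF that] group.coset_join1[OF P.group_chains _ P.\<pi>_carrier[OF that] sub]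
        group.coset_join2[OF P.group_chains P.\<pi>_carrier[OF that] sub]
      by (auto simp: quotient_cplx_def)
    show "bd (quotient_cplx K N) n (N (Suc n) #>\<^bsub>chains K (Suc n)\<^esub> \<pi> (Suc n) x)
        = N n #>\<^bsub>chains K n\<^esub> \<pi> n (d n x)" if "x \<in> frags (U (Suc n))"
    proof -
      have "bd K n ` N (Suc n) \<subseteq> N n"
        unfolding N using V(2) frags_mono[OF _ V(1)] by (auto simp: P.bd_\<pi>)
      then show ?thesis
        using coset_map_r_coset[OF P.bd_hom P.group_chains P.group_chains sub sub _
            P.\<pi>_carrier[OF that]] that
        by (simp add: quotient_cplx_def P.bd_\<pi>)
    qed
  qed
qed


section \<open>Excision for presented complexes\<close>

text \<open>Vanishing homology of the complex on \<open>U\<close> modulo the one on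
  \<open>S\<close>, in terms of representatives: \<open>z\<close> is a relative cycle and
  \<open>w\<close> fills it up to an element of \<open>S\<close>. In degree 0 every chain is a
  cycle, as the premise is then vacuous.\<close>

definition acyclic_mod ::
    "(nat \<Rightarrow> 'b set) \<Rightarrow> (nat \<Rightarrow> 'b set) \<Rightarrow> (nat \<Rightarrow> ('b \<Rightarrow>\<^sub>0 int) \<Rightarrow> ('b \<Rightarrow>\<^sub>0 int)) \<Rightarrow> bool" where
  "acyclic_mod U S d \<longleftrightarrow>
     (\<forall>n. \<forall>z\<in>frags (U n). (\<forall>m. n = Suc m \<longrightarrow> d m z \<in> frags (S m)) \<longrightarrow>
        (\<exists>w\<in>frags (U (Suc n)). z - d n w \<in> frags (S n)))"

text \<open>\<open>K\<close> plays the relative complex of \<open>(X, A)\<close> and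
  \<open>K'\<close> that of \<open>(B, A \<inter> B)\<close>. The set \<open>W\<close> consists of
  the generators with values in \<open>B\<close>, so the generators killed in \<open>K'\<close> are
  those of \<open>W\<close> that are killed in \<open>K\<close>.\<close>

locale excision_pair =
  P: presentation K U T d \<pi> + P': presentation K' W "\<lambda>n. T n \<inter> W n" d \<pi>'
  for K :: "'c chain_cplx" and U T :: "nat \<Rightarrow> 'b set" and d \<pi>
    and K' :: "'d chain_cplx" and W \<pi>' +
  fixes f :: "nat \<Rightarrow> 'd \<Rightarrow> 'c" and G :: "('g, 'm) monoid_scheme"
  assumes W_sub: "W n \<subseteq> U n"
    and acyclic: "acyclic_mod U (\<lambda>n. T n \<union> W n) d"
    and f_\<pi>: "x \<in> frags (W n) \<Longrightarrow> f n (\<pi>' n x) = \<pi> n x"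
    and comm_G: "comm_group G"
begin

sublocale G: comm_group G
  by (rule comm_G)

abbreviation S where "S n \<equiv> T n \<union> W n"

lemma S_sub: "S n \<subseteq> U n"
  using W_sub P.T_sub by auto

lemma d_S: "x \<in> frags (S (Suc n)) \<Longrightarrow> d n x \<in> frags (S n)"
  using P.d_T[of _ n] P'.d_U[of _ n] frags_mono[of _ "T n" "S n"] frags_mono[of _ "W n" "S n"]
  by (elim frags_Un_split) (simp add: P.d_add frags_add)

text \<open>If \<tau> inverts \<open>d m\<close> on boundaries modulo \<open>S\<close>, then
  subtracting \<open>frag_extend \<tau> (d m x)\<close> turns any chain \<open>x\<close> into a
  relative cycle, and acyclicity fills it.\<close>

lemma contraction_step:
  fixes \<tau> :: "'b \<Rightarrow> 'b \<Rightarrow>\<^sub>0 int"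
  assumes U: "\<And>u. u \<in> U m \<Longrightarrow> \<tau> u \<in> frags (U (Suc m))"
    and \<tau>: "\<And>x. x \<in> frags (U (Suc m)) \<Longrightarrow> d m x - d m (frag_extend \<tau> (d m x)) \<in> frags (S m)"
    and x: "x \<in> frags (U (Suc m))"
  shows "\<exists>w\<in>frags (U (Suc (Suc m))). x - frag_extend \<tau> (d m x) - d (Suc m) w \<in> frags (S (Suc m))"
proof -
  let ?z = "x - frag_extend \<tau> (d m x)"
  have "?z \<in> frags (U (Suc m))"
    using x frags_extend[OF P.d_U[OF x] U] by (rule frags_diff)
  moreover have "d m ?z \<in> frags (S m)"
    using \<tau>[OF x] by (simp add: P.d_diff)
  ultimately show ?thesis
    using acyclic unfolding acyclic_mod_def by (metis nat.inject)
qed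

text \<open>The complex is free, so \<tau> may be chosen generator by generator; it is taken to be 0
  on \<open>S\<close> so that a cochain composed with it is trivial there. The last clause,
  inversion of \<open>d\<close> on boundaries modulo \<open>S\<close>, is what
  \<open>contraction_step\<close> consumes, both for the next degree and for the primitive of a
  cocycle.\<close>

lemma contraction:
  "\<exists>\<tau>. (\<forall>u\<in>U m. \<tau> u \<in> frags (U (Suc m))) \<and> (\<forall>u\<in>S m. \<tau> u = 0) \<and>
     (\<forall>x\<in>frags (U (Suc m)). d m x - d m (frag_extend \<tau> (d m x)) \<in> frags (S m))"
proof (induction m)
  case 0
  have "\<exists>w. w \<in> frags (U 1) \<and> frag_of u - d 0 w \<in> frags (S 0) \<and> (u \<in> S 0 \<longrightarrow> w = 0)" if "u \<in> U 0" for u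
  proof (cases "u \<in> S 0")
    case True
    then show ?thesis
      by (intro exI[of _ 0]) (simp add: P.d_0)
  next
    case False
    then show ?thesis
      using acyclic that unfolding acyclic_mod_def by (metis One_nat_def frags_of nat.distinct(1))
  qed
  then obtain \<tau> where \<tau>: "\<And>u. u \<in> U 0 \<Longrightarrow>
      \<tau> u \<in> frags (U 1) \<and> frag_of u - d 0 (\<tau> u) \<in> frags (S 0) \<and> (u \<in> S 0 \<longrightarrow> \<tau> u = 0)"
    by metis
  have "x - d 0 (frag_extend \<tau> x) \<in> frags (S 0)" if "x \<in> frags (U 0)" for x
    using that
  proof (induction rule: frags_induct)
    case (diff a b)
    then show ?case
      using frags_diff[of "a - d 0 (frag_extend \<tau> a)" "S 0" "b - d 0 (frag_extend \<tau> b)"]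
      by (simp add: frag_extend_diff P.d_diff algebra_simps)
  qed (use \<tau> in \<open>auto simp: P.d_0\<close>)
  then show ?case
    using \<tau> S_sub[of 0] P.d_U[of _ 0] by (intro exI[of _ \<tau>]) auto
next
  case (Suc m)
  then obtain \<tau> where \<tau>: "\<And>u. u \<in> U m \<Longrightarrow> \<tau> u \<in> frags (U (Suc m))" "\<And>u. u \<in> S m \<Longrightarrow> \<tau> u = 0"
      "\<And>x. x \<in> frags (U (Suc m)) \<Longrightarrow> d m x - d m (frag_extend \<tau> (d m x)) \<in> frags (S m)"
    by blast
  \<comment> \<open>The boundary of a generator in \<open>S\<close> stays in \<open>S\<close>, where
    \<tau> vanishes, so for such a generator the choice 0 is allowed again.\<close>
  have zero: "frag_extend \<tau> (d m (frag_of u)) = 0" if "u \<in> S (Suc m)" for u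
    using d_S[of "frag_of u" m] that \<tau>(2) by (auto intro!: frag_extend_eq_0 simp: frags_def)
  have "\<exists>w. w \<in> frags (U (Suc (Suc m))) \<and>
      frag_of u - frag_extend \<tau> (d m (frag_of u)) - d (Suc m) w \<in> frags (S (Suc m)) \<and>
      (u \<in> S (Suc m) \<longrightarrow> w = 0)" if "u \<in> U (Suc m)" for u
  proof (cases "u \<in> S (Suc m)")
    case True
    then show ?thesis
      using zero by (intro exI[of _ 0]) (simp add: P.d_0)
  next
    case False
    then show ?thesis
      using contraction_step[OF \<tau>(1,3), of "frag_of u"] that by auto
  qed
  then obtain \<tau>' where \<tau>': "\<And>u. u \<in> U (Suc m) \<Longrightarrow>
      \<tau>' u \<in> frags (U (Suc (Suc m))) \<and>
      frag_of u - frag_extend \<tau> (d m (frag_of u)) - d (Suc m) (\<tau>' u) \<in> frags (S (Suc m)) \<and>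
      (u \<in> S (Suc m) \<longrightarrow> \<tau>' u = 0)"
    by metis
  have *: "x - frag_extend \<tau> (d m x) - d (Suc m) (frag_extend \<tau>' x) \<in> frags (S (Suc m))"
    if "x \<in> frags (U (Suc m))" for x
    using that
  proof (induction rule: frags_induct)
    case (diff a b)
    then show ?case
      using frags_diff[of "a - frag_extend \<tau> (d m a) - d (Suc m) (frag_extend \<tau>' a)" "S (Suc m)"
          "b - frag_extend \<tau> (d m b) - d (Suc m) (frag_extend \<tau>' b)"]
      by (simp add: frag_extend_diff P.d_diff algebra_simps)
  qed (use \<tau>' in \<open>auto simp: P.d_0\<close>)
  \<comment> \<open>The previous identity is applied to \<open>d (Suc m) x\<close>; its term with
    the old \<tau> drops out since the boundary of a boundary is 0.\<close>
  have "d (Suc m) x - d (Suc m) (frag_extend \<tau>' (d (Suc m) x)) \<in> frags (S (Suc m))"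
    if "x \<in> frags (U (Suc (Suc m)))" for x
    using *[OF P.d_U[OF that]] that by (simp add: P.d_d)
  then show ?case
    using \<tau>' S_sub[of "Suc m"] by (intro exI[of _ \<tau>']) blast
qed

section \<open>Cocycles that are trivial on \<open>S\<close>\<close>

lemma cocycle_mod_S_0:
  assumes \<kappa>: "\<kappa> \<in> hom (free_Abelian_group (U 0)) G"
    and S: "\<And>x. x \<in> frags (S 0) \<Longrightarrow> \<kappa> x = \<one>\<^bsub>G\<^esub>"
    and cocycle: "\<And>x. x \<in> frags (U (Suc 0)) \<Longrightarrow> \<kappa> (d 0 x) = \<one>\<^bsub>G\<^esub>"
    and x: "x \<in> frags (U 0)"
  shows "\<kappa> x = \<one>\<^bsub>G\<^esub>"
proof -
  obtain w where w: "w \<in> frags (U (Suc 0))" "x - d 0 w \<in> frags (S 0)"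
    using acyclic x unfolding acyclic_mod_def by blast
  have "\<kappa> ((x - d 0 w) + d 0 w) = \<one>\<^bsub>G\<^esub>"
    using hom_mult[OF \<kappa>, of "x - d 0 w" "d 0 w"] S[OF w(2)] cocycle[OF w(1)] w x P.d_U[OF w(1)]
    by (simp add: frags_diff)
  then show ?thesis
    by simp
qed

text \<open>The primitive is \<kappa> after \<tau>: a chain \<open>x\<close> differs from
  \<open>frag_extend \<tau> (d m x)\<close> by a boundary and an element of \<open>S\<close>, and
  \<kappa> is trivial on both.\<close>

lemma cocycle_mod_S_Suc:
  assumes \<kappa>: "\<kappa> \<in> hom (free_Abelian_group (U (Suc m))) G"
    and S: "\<And>x. x \<in> frags (S (Suc m)) \<Longrightarrow> \<kappa> x = \<one>\<^bsub>G\<^esub>"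
    and cocycle: "\<And>x. x \<in> frags (U (Suc (Suc m))) \<Longrightarrow> \<kappa> (d (Suc m) x) = \<one>\<^bsub>G\<^esub>"
  obtains \<psi> where "\<psi> \<in> hom (free_Abelian_group (U m)) G"
    "\<And>x. x \<in> frags (S m) \<Longrightarrow> \<psi> x = \<one>\<^bsub>G\<^esub>"
    "\<And>x. x \<in> frags (U (Suc m)) \<Longrightarrow> \<psi> (d m x) = \<kappa> x"
proof -
  obtain \<tau> where \<tau>: "\<And>u. u \<in> U m \<Longrightarrow> \<tau> u \<in> frags (U (Suc m))" "\<And>u. u \<in> S m \<Longrightarrow> \<tau> u = 0"
      "\<And>x. x \<in> frags (U (Suc m)) \<Longrightarrow> d m x - d m (frag_extend \<tau> (d m x)) \<in> frags (S m)"
    using contraction by blast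
  have ext: "frag_extend \<tau> x \<in> frags (U (Suc m))" if "x \<in> frags (U m)" for x
    using frags_extend[OF that \<tau>(1)] .
  have add: "\<kappa> (a + b) = \<kappa> a \<otimes>\<^bsub>G\<^esub> \<kappa> b" if "a \<in> frags (U (Suc m))" "b \<in> frags (U (Suc m))" for a b
    using hom_mult[OF \<kappa>, of a b] that by simp
  have car: "\<kappa> a \<in> carrier G" if "a \<in> frags (U (Suc m))" for a
    using hom_in_carrier[OF \<kappa>, of a] that by simp
  show ?thesis
  proof
    show "(\<lambda>x. \<kappa> (frag_extend \<tau> x)) \<in> hom (free_Abelian_group (U m)) G"
      by (rule homI) (use ext add car in \<open>auto simp: frag_extend_add\<close>)
    show "\<kappa> (frag_extend \<tau> x) = \<one>\<^bsub>G\<^esub>" if "x \<in> frags (S m)" for x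
    proof -
      have "frag_extend \<tau> x = 0"
        using that \<tau>(2) by (auto intro!: frag_extend_eq_0 simp: frags_def)
      then show ?thesis
        using S[of 0] by simp
    qed
    show "\<kappa> (frag_extend \<tau> (d m x)) = \<kappa> x" if x: "x \<in> frags (U (Suc m))" for x
    proof -
      let ?y = "frag_extend \<tau> (d m x)"
      obtain w where w: "w \<in> frags (U (Suc (Suc m)))" "x - ?y - d (Suc m) w \<in> frags (S (Suc m))"
        using contraction_step[OF \<tau>(1,3) x] by blast
      have y: "?y \<in> frags (U (Suc m))" and dw: "d (Suc m) w \<in> frags (U (Suc m))"
        using ext P.d_U x w by auto
      have "\<kappa> ((x - ?y - d (Suc m) w) + (d (Suc m) w + ?y)) = \<kappa> ?y"
        using S[OF w(2)] cocycle[OF w(1)] y dw frags_mono[OF w(2) S_sub] car[OF y]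
        by (simp only: add frags_add G.l_one G.one_closed)
      then show ?thesis
        by simp
    qed
  qed
qed

text \<open>The value on each generator in \<open>U n\<close> may be prescribed. On
  \<open>T n \<inter> W n\<close> the cochain \<phi> is already trivial, so the two requirements do
  not clash.\<close>

lemma extend_by_one:
  assumes \<phi>: "\<phi> \<in> carrier (cochains K' G n)"
  obtains \<psi> where "\<psi> \<in> hom (free_Abelian_group (U n)) G"
    "\<And>x. x \<in> frags (W n) \<Longrightarrow> \<psi> x = \<phi> (\<pi>' n x)"
    "\<And>x. x \<in> frags (T n) \<Longrightarrow> \<psi> x = \<one>\<^bsub>G\<^esub>"
proof -
  let ?g = "\<lambda>u. if u \<in> W n then \<phi> (\<pi>' n (frag_of u)) else \<one>\<^bsub>G\<^esub>"
  have pull: "(\<lambda>x. \<phi> (\<pi>' n x)) \<in> hom (free_Abelian_group (W n)) G"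
    by (rule P'.cochain_pullback_hom[OF \<phi>])
  then have "?g ` U n \<subseteq> carrier G"
    using hom_in_carrier[OF pull] by auto
  then obtain \<psi> where \<psi>: "\<psi> \<in> hom (free_Abelian_group (U n)) G"
      "\<And>u. u \<in> U n \<Longrightarrow> \<psi> (frag_of u) = ?g u"
    using G.free_Abelian_group_universal[of ?g "U n"] by metis
  show ?thesis
  proof
    show "\<psi> \<in> hom (free_Abelian_group (U n)) G"
      by (rule \<psi>)
    show "\<psi> x = \<phi> (\<pi>' n x)" if "x \<in> frags (W n)" for x
      using \<psi>(2) W_sub[of n] hom_frags_eq[OF \<psi>(1) pull G.group_axioms W_sub order_refl that]
      by (simp add: subset_iff)
    have one: "(\<lambda>x. \<one>\<^bsub>G\<^esub>) \<in> hom (free_Abelian_group (U n)) G"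
      by (rule homI) auto
    show "\<psi> x = \<one>\<^bsub>G\<^esub>" if "x \<in> frags (T n)" for x
      using \<psi>(2) P.T_sub[of n] P'.cochain_pullback_one[OF \<phi> G.group_axioms]
      by (intro hom_frags_eq[OF \<psi>(1) one G.group_axioms P.T_sub P.T_sub that]) auto
  qed
qed

lemma one_on_S:
  assumes \<psi>: "\<psi> \<in> hom (free_Abelian_group (U n)) G"
    and "\<And>x. x \<in> frags (T n) \<Longrightarrow> \<psi> x = \<one>\<^bsub>G\<^esub>" "\<And>x. x \<in> frags (W n) \<Longrightarrow> \<psi> x = \<one>\<^bsub>G\<^esub>"
    and x: "x \<in> frags (S n)"
  shows "\<psi> x = \<one>\<^bsub>G\<^esub>"
proof -
  obtain t w where tw: "t \<in> frags (T n)" "w \<in> frags (W n)" "x = t + w"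
    using x by (rule frags_Un_split)
  then show ?thesis
    using hom_mult[OF \<psi>, of t w] assms(2,3) frags_mono[OF tw(1) P.T_sub] frags_mono[OF tw(2) W_sub]
    by simp
qed

section \<open>Restriction of cochains along the inclusion\<close>

definition pullback :: "nat \<Rightarrow> ('c \<Rightarrow> 'g) \<Rightarrow> ('d \<Rightarrow> 'g)" where
  "pullback n \<phi> = (\<lambda>x\<in>carrier (chains K' n). \<phi> (f n x))"

lemma f_hom: "f n \<in> hom (chains K' n) (chains K n)"
  by (rule presentation_map_hom[OF P.presentation_axioms P'.presentation_axioms W_sub f_\<pi>])

lemma pullback_hom: "pullback n \<in> hom (cochains K G n) (cochains K' G n)"
proof (rule homI)
  fix \<phi> assume "\<phi> \<in> carrier (cochains K G n)"
  then have "(\<lambda>x. \<phi> (f n x)) \<in> hom (chains K' n) G"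
    using hom_compose[OF f_hom, where g = \<phi> and I = G]
    by (simp add: cochains_def carrier_hom_group o_def)
  then show "pullback n \<phi> \<in> carrier (cochains K' G n)"
    unfolding cochains_def pullback_def by (rule restrict_in_hom_group[OF P'.group_chains])
next
  fix \<phi> \<psi>
  show "pullback n (\<phi> \<otimes>\<^bsub>cochains K G n\<^esub> \<psi>) = pullback n \<phi> \<otimes>\<^bsub>cochains K' G n\<^esub> pullback n \<psi>"
    using hom_in_carrier[OF f_hom, of _ n]
    by (auto simp: cochains_def mult_hom_group pullback_def intro!: restrict_ext)
qed

lemma pullback_apply: "x \<in> frags (W n) \<Longrightarrow> pullback n \<phi> (\<pi>' n x) = \<phi> (\<pi> n x)"
  by (simp add: pullback_def f_\<pi> P'.\<pi>_carrier)

lemma pullback_cocycle: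
  assumes "\<phi> \<in> cocycles K G n"
  shows "pullback n \<phi> \<in> cocycles K' G n"
  using assms hom_in_carrier[OF pullback_hom] frags_mono[OF _ W_sub]
  by (auto simp: P.cocycles_iff[OF comm_G] P'.cocycles_iff[OF comm_G] pullback_apply P'.d_U)

lemma pullback_coboundary:
  assumes "\<phi> \<in> coboundaries K G n"
  shows "pullback n \<phi> \<in> coboundaries K' G n"
proof (cases n)
  case 0
  have "pullback 0 \<one>\<^bsub>cochains K G 0\<^esub> = \<one>\<^bsub>cochains K' G 0\<^esub>"
    using hom_one[OF pullback_hom] P.comm_group_cochains[OF comm_G] P'.comm_group_cochains[OF comm_G]
    by (simp add: comm_group_def)
  then show ?thesis
    using assms 0 by (simp add: coboundaries_def)
next
  case (Suc m)
  then obtain \<eta> where \<eta>: "\<eta> \<in> carrier (cochains K G m)" "\<phi> = coboundary K m \<eta>"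
    using assms by (auto simp: coboundaries_def)
  have p\<eta>: "pullback m \<eta> \<in> carrier (cochains K' G m)"
    using hom_in_carrier[OF pullback_hom \<eta>(1)] .
  have "pullback (Suc m) (coboundary K m \<eta>) = coboundary K' m (pullback m \<eta>)"
    using frags_mono[OF _ W_sub]
    by (intro P'.cochain_ext[of _ G "Suc m"] hom_in_carrier[OF pullback_hom]
         hom_in_carrier[OF P.coboundary_hom] hom_in_carrier[OF P'.coboundary_hom] p\<eta> \<eta>)
       (auto simp: pullback_apply P.coboundary_apply P'.coboundary_apply P'.d_U)
  then show ?thesis
    using Suc \<eta> p\<eta> by (simp add: coboundaries_def)
qed

lemma hom_mult_inv:
  assumes "\<phi> \<in> hom (free_Abelian_group V) G" "\<psi> \<in> hom (free_Abelian_group V) G"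
  shows "(\<lambda>x. \<phi> x \<otimes>\<^bsub>G\<^esub> inv\<^bsub>G\<^esub> \<psi> x) \<in> hom (free_Abelian_group V) G"
  using assms by (auto simp: hom_def Pi_iff G.inv_mult G.m_ac)

lemma hom_d:
  assumes \<phi>: "\<phi> \<in> hom (free_Abelian_group (U n)) G"
  shows "(\<lambda>x. \<phi> (d n x)) \<in> hom (free_Abelian_group (U (Suc n))) G"
  by (rule homI)
     (use hom_in_carrier[OF \<phi>] hom_mult[OF \<phi>] in \<open>auto simp: P.d_U P.d_add\<close>)

text \<open>The extension by one need not be a cocycle, but its coboundary is trivial on
  \<open>S\<close> and hence has a primitive \<psi>1 that is trivial on \<open>S\<close>. Dividing
  by \<psi>1 makes it a cocycle without changing it on \<open>T\<close> and
  \<open>W\<close>.\<close>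

lemma cocycle_lift:
  assumes \<phi>: "\<phi> \<in> cocycles K' G n"
  obtains \<Phi> where "\<Phi> \<in> cocycles K G n" "pullback n \<Phi> = \<phi>"
proof -
  have \<phi>c: "\<phi> \<in> carrier (cochains K' G n)"
    and \<phi>d: "\<And>x. x \<in> frags (W (Suc n)) \<Longrightarrow> \<phi> (\<pi>' n (d n x)) = \<one>\<^bsub>G\<^esub>"
    using \<phi> by (auto simp: P'.cocycles_iff[OF comm_G])
  obtain \<psi>0 where \<psi>0: "\<psi>0 \<in> hom (free_Abelian_group (U n)) G"
      "\<And>x. x \<in> frags (W n) \<Longrightarrow> \<psi>0 x = \<phi> (\<pi>' n x)" "\<And>x. x \<in> frags (T n) \<Longrightarrow> \<psi>0 x = \<one>\<^bsub>G\<^esub>"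
    using extend_by_one[OF \<phi>c] by blast
  have hom: "(\<lambda>x. \<psi>0 (d n x)) \<in> hom (free_Abelian_group (U (Suc n))) G"
    by (rule hom_d[OF \<psi>0(1)])
  have S: "\<psi>0 (d n x) = \<one>\<^bsub>G\<^esub>" if "x \<in> frags (S (Suc n))" for x
    by (rule one_on_S[OF hom _ _ that]) (use \<psi>0 \<phi>d P.d_T P'.d_U in auto)
  have dd: "\<psi>0 (d n (d (Suc n) x)) = \<one>\<^bsub>G\<^esub>" if "x \<in> frags (U (Suc (Suc n)))" for x
    using that \<psi>0(3)[of 0] by (simp add: P.d_d)
  obtain \<psi>1 where \<psi>1: "\<psi>1 \<in> hom (free_Abelian_group (U n)) G"
      "\<And>x. x \<in> frags (S n) \<Longrightarrow> \<psi>1 x = \<one>\<^bsub>G\<^esub>"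
      "\<And>x. x \<in> frags (U (Suc n)) \<Longrightarrow> \<psi>1 (d n x) = \<psi>0 (d n x)"
    using cocycle_mod_S_Suc[OF hom S dd] by blast
  let ?\<psi> = "\<lambda>x. \<psi>0 x \<otimes>\<^bsub>G\<^esub> inv\<^bsub>G\<^esub> \<psi>1 x"
  have hom\<psi>: "?\<psi> \<in> hom (free_Abelian_group (U n)) G"
    using \<psi>0(1) \<psi>1(1) by (rule hom_mult_inv)
  have "?\<psi> x = \<one>\<^bsub>G\<^esub>" if "x \<in> frags (T n)" for x
    using that \<psi>0(3) \<psi>1(2)[OF frags_mono] by auto
  then obtain \<Phi> where \<Phi>: "\<Phi> \<in> carrier (cochains K G n)" "\<And>x. x \<in> frags (U n) \<Longrightarrow> \<Phi> (\<pi> n x) = ?\<psi> x"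
    using P.cochain_descend[OF hom\<psi> G.group_axioms] by blast
  show ?thesis
  proof
    show "\<Phi> \<in> cocycles K G n"
      using \<Phi> hom_in_carrier[OF \<psi>0(1)] by (simp add: P.cocycles_iff[OF comm_G] P.d_U \<psi>1)
    have "\<psi>1 x = \<one>\<^bsub>G\<^esub>" if "x \<in> frags (W n)" for x
      using \<psi>1(2)[OF frags_mono[OF that]] by auto
    then show "pullback n \<Phi> = \<phi>"
      using \<phi>c hom_in_carrier[OF pullback_hom \<Phi>(1)] frags_mono[OF _ W_sub]
        hom_in_carrier[OF P'.cochain_pullback_hom[OF \<phi>c]]
      by (intro P'.cochain_ext) (auto simp: pullback_apply \<Phi> \<psi>0)
  qed
qed

text \<open>If \<phi> restricts to the coboundary of \<eta>, extend \<eta> by one to \<eta>0. Then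
  \<phi> divided by the coboundary of \<eta>0 is a cocycle trivial on \<open>S\<close>, so it has a
  primitive \<psi> trivial on \<open>S\<close>, and the product of \<psi> and \<eta>0 is a primitive
  of \<phi>.\<close>

lemma coboundary_lift:
  assumes \<phi>: "\<phi> \<in> cocycles K G n" and cob: "pullback n \<phi> \<in> coboundaries K' G n"
  shows "\<phi> \<in> coboundaries K G n"
proof -
  have \<phi>c: "\<phi> \<in> carrier (cochains K G n)"
    and \<phi>d: "\<And>x. x \<in> frags (U (Suc n)) \<Longrightarrow> \<phi> (\<pi> n (d n x)) = \<one>\<^bsub>G\<^esub>"
    using \<phi> by (auto simp: P.cocycles_iff[OF comm_G])
  have hom\<phi>: "(\<lambda>x. \<phi> (\<pi> n x)) \<in> hom (free_Abelian_group (U n)) G"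
    by (rule P.cochain_pullback_hom[OF \<phi>c])
  have one\<phi>: "\<phi> (\<pi> n x) = \<one>\<^bsub>G\<^esub>" if "x \<in> frags (T n)" for x
    using P.cochain_pullback_one[OF \<phi>c G.group_axioms that] .
  show ?thesis
  proof (cases n)
    \<comment> \<open>In degree 0 the unit is the one coboundary, so \<phi> itself is trivial on
      \<open>W 0\<close>.\<close>
    case 0
    have "\<phi> (\<pi> 0 x) = \<one>\<^bsub>G\<^esub>" if "x \<in> frags (W 0)" for x
      using cob pullback_apply[OF that, of \<phi>] P'.\<pi>_carrier[OF that] 0
      by (simp add: coboundaries_def cochains_def one_hom_group)
    then have "\<phi> (\<pi> 0 x) = \<one>\<^bsub>G\<^esub>" if "x \<in> frags (U 0)" for x
      using cocycle_mod_S_0[OF hom\<phi>[unfolded 0] one_on_S[OF hom\<phi>[unfolded 0] one\<phi>[unfolded 0]] 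
          \<phi>d[unfolded 0] that] by blast
    moreover have "\<one>\<^bsub>cochains K G 0\<^esub> \<in> carrier (cochains K G 0)"
      using P.comm_group_cochains[OF comm_G] by (simp add: comm_group_def group_def)
    ultimately have "\<phi> = \<one>\<^bsub>cochains K G 0\<^esub>"
      using \<phi>c 0 by (intro P.cochain_ext[of _ G 0])
        (auto simp: P.\<pi>_carrier cochains_def one_hom_group)
    then show ?thesis
      using 0 by (simp add: coboundaries_def)
  next
    case (Suc m)
    then obtain \<eta> where \<eta>: "\<eta> \<in> carrier (cochains K' G m)" "pullback n \<phi> = coboundary K' m \<eta>"
      using cob by (auto simp: coboundaries_def)
    obtain \<eta>0 where \<eta>0: "\<eta>0 \<in> hom (free_Abelian_group (U m)) G"
        "\<And>x. x \<in> frags (W m) \<Longrightarrow> \<eta>0 x = \<eta> (\<pi>' m x)" "\<And>x. x \<in> frags (T m) \<Longrightarrow> \<eta>0 x = \<one>\<^bsub>G\<^esub>"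
      using extend_by_one[OF \<eta>(1)] by blast
    have car\<eta>: "\<eta>0 x \<in> carrier G" if "x \<in> frags (U m)" for x
      using hom_in_carrier[OF \<eta>0(1)] that by simp
    let ?\<kappa> = "\<lambda>x. \<phi> (\<pi> (Suc m) x) \<otimes>\<^bsub>G\<^esub> inv\<^bsub>G\<^esub> \<eta>0 (d m x)"
    have hom\<kappa>: "?\<kappa> \<in> hom (free_Abelian_group (U (Suc m))) G"
      using hom\<phi> Suc hom_d[OF \<eta>0(1)] by (intro hom_mult_inv) simp_all
    have T: "?\<kappa> x = \<one>\<^bsub>G\<^esub>" if "x \<in> frags (T (Suc m))" for x
      using that one\<phi> Suc P.d_T \<eta>0 by simp
    have W: "?\<kappa> x = \<one>\<^bsub>G\<^esub>" if "x \<in> frags (W (Suc m))" for x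
    proof -
      have "\<phi> (\<pi> (Suc m) x) = \<eta>0 (d m x)"
        using \<eta>(2) Suc that pullback_apply[OF that, of \<phi>] by (simp add: P'.coboundary_apply \<eta>0 P'.d_U)
      then show ?thesis
        using car\<eta>[OF P.d_U[OF frags_mono[OF that W_sub]]] by simp
    qed
    have dd: "?\<kappa> (d (Suc m) x) = \<one>\<^bsub>G\<^esub>" if "x \<in> frags (U (Suc (Suc m)))" for x
      using that \<phi>d Suc \<eta>0(3)[of 0] by (simp add: P.d_d)
    obtain \<psi> where \<psi>: "\<psi> \<in> hom (free_Abelian_group (U m)) G"
        "\<And>x. x \<in> frags (S m) \<Longrightarrow> \<psi> x = \<one>\<^bsub>G\<^esub>" "\<And>x. x \<in> frags (U (Suc m)) \<Longrightarrow> \<psi> (d m x) = ?\<kappa> x"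
      using cocycle_mod_S_Suc[OF hom\<kappa> one_on_S[OF hom\<kappa> T W] dd] by blast
    have hom\<zeta>: "(\<lambda>x. \<psi> x \<otimes>\<^bsub>G\<^esub> \<eta>0 x) \<in> hom (free_Abelian_group (U m)) G"
      using \<psi>(1) \<eta>0(1) by (auto simp: hom_def Pi_iff G.m_ac)
    have "\<psi> x \<otimes>\<^bsub>G\<^esub> \<eta>0 x = \<one>\<^bsub>G\<^esub>" if "x \<in> frags (T m)" for x
      using \<psi>(2)[OF frags_mono[OF that]] \<eta>0(3)[OF that] by auto
    then obtain \<zeta> where \<zeta>: "\<zeta> \<in> carrier (cochains K G m)"
        "\<And>x. x \<in> frags (U m) \<Longrightarrow> \<zeta> (\<pi> m x) = \<psi> x \<otimes>\<^bsub>G\<^esub> \<eta>0 x"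
      using P.cochain_descend[OF hom\<zeta> G.group_axioms] by blast
    have car\<phi>: "\<phi> (\<pi> (Suc m) x) \<in> carrier G" if "x \<in> frags (U (Suc m))" for x
      using hom_in_carrier[OF hom\<phi>, of x] Suc that by simp
    have "coboundary K m \<zeta> = \<phi>"
      using \<zeta>(1) \<phi>c Suc car\<eta> car\<phi>
      by (intro P.cochain_ext[of _ G "Suc m"] hom_in_carrier[OF P.coboundary_hom])
         (auto simp: P.coboundary_apply P.d_U \<zeta> \<psi>(3) G.m_assoc)
    then show ?thesis
      using Suc \<zeta>(1) by (auto simp: coboundaries_def)
  qed
qed

theorem cohomology_map_iso: "cohomology_map K K' f G n \<in> iso (cohomology K G n) (cohomology K' G n)"
proof -
  let ?H = "(cochains K G n)\<lparr>carrier := cocycles K G n\<rparr>"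
  let ?H' = "(cochains K' G n)\<lparr>carrier := cocycles K' G n\<rparr>"
  have hom: "pullback n \<in> hom ?H ?H'"
    using subgroup.subset[OF P.subgroup_cocycles[OF comm_G], of n]
    by (intro homI) (auto simp: pullback_cocycle hom_mult[OF pullback_hom] subset_iff)
  have "coset_map ?H' (coboundaries K' G n) (pullback n)
      \<in> iso (?H Mod coboundaries K G n) (?H' Mod coboundaries K' G n)"
  proof (rule group_hom_coset_map_iso[OF P.comm_group_cocycles[OF comm_G]
        P'.comm_group_cocycles[OF comm_G] hom P.subgroup_coboundaries_cocycles[OF comm_G]
        P'.subgroup_coboundaries_cocycles[OF comm_G]])
    show "pullback n ` coboundaries K G n \<subseteq> coboundaries K' G n"
      using pullback_coboundary by auto
    show "\<phi> \<in> coboundaries K G n" if "\<phi> \<in> carrier ?H" "pullback n \<phi> \<in> coboundaries K' G n" for \<phi>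
      using coboundary_lift that by simp
    show "\<exists>\<phi>\<in>carrier ?H. \<exists>b\<in>coboundaries K' G n. \<psi> = b \<otimes>\<^bsub>?H'\<^esub> pullback n \<phi>"
      if \<psi>: "\<psi> \<in> carrier ?H'" for \<psi>
    proof -
      interpret H': group ?H'
        using P'.comm_group_cocycles[OF comm_G] by (rule comm_group.axioms(2))
      obtain \<phi> where "\<phi> \<in> cocycles K G n" "pullback n \<phi> = \<psi>"
        using cocycle_lift \<psi> by auto
      moreover have "\<one>\<^bsub>?H'\<^esub> \<in> coboundaries K' G n"
        by (rule subgroup.one_closed[OF P'.subgroup_coboundaries_cocycles[OF comm_G]])
      moreover have "\<psi> = \<one>\<^bsub>?H'\<^esub> \<otimes>\<^bsub>?H'\<^esub> \<psi>"
        using H'.l_one[OF \<psi>] by (rule sym)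
      ultimately show ?thesis
        by auto
    qed
  qed
  \<comment> \<open>\<open>coset_map\<close> refers to the multiplication alone, so shrinking the
    carrier to the cocycles does not alter it.\<close>
  moreover have "coset_map ?H' (coboundaries K' G n) (pullback n) = cohomology_map K K' f G n"
    by (simp add: cohomology_map_def coset_map_def fun_eq_iff set_mult_def pullback_def)
  ultimately show ?thesis
    by (simp add: cohomology_def)
qed

end

text \<open>The bijection from \<open>(i, j)\<close> with \<open>i \<le> j\<close> to
  \<open>(Suc j, i)\<close> reverses the sign and preserves the term. Stated for an arbitrary
  \<open>F\<close>, it serves the double faces of simplices and of cubes alike.\<close>

lemma alternating_double_sum:
  fixes F :: "nat \<Rightarrow> nat \<Rightarrow> 'b \<Rightarrow>\<^sub>0 int"
  assumes "\<And>i j. i \<le> j \<Longrightarrow> j \<le> n \<Longrightarrow> F i j = F (Suc j) i"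
  shows "(\<Sum>i\<le>Suc n. \<Sum>j\<le>n. frag_cmul ((-1) ^ (i + j)) (F i j)) = 0"
proof -
  let ?g = "\<lambda>(i, j). frag_cmul ((-1) ^ (i + j)) (F i j)"
  let ?P = "{(i, j). i \<le> j \<and> j \<le> n}" and ?Q = "{(i, j). j < i \<and> i \<le> Suc n}"
  have un: "{..Suc n} \<times> {..n} = ?P \<union> ?Q"
    by auto
  have fin: "finite ?P" "finite ?Q"
    by (rule finite_subset[of _ "{..Suc n} \<times> {..Suc n}"]; auto)+
  have sign: "frag_cmul (- ((-1) ^ (i + j - Suc 0))) c = frag_cmul ((-1) ^ (i + j)) c" if "j < i"
    for i j and c :: "'b \<Rightarrow>\<^sub>0 int"
    using that by (cases i) auto
  have "sum ?g ?Q = (\<Sum>p\<in>?P. - ?g p)"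
    by (rule sum.reindex_bij_witness[of _ "\<lambda>(i, j). (Suc j, i)" "\<lambda>(i, j). (j, i - 1)"])
       (auto simp: assms add.commute sign)
  moreover have "sum ?g ({..Suc n} \<times> {..n}) = sum ?g ?P + sum ?g ?Q"
    unfolding un by (rule sum.union_disjoint[OF fin]) auto
  ultimately show ?thesis
    by (simp add: sum.cartesian_product sum_negf)
qed


section \<open>Maps of closure spaces\<close>

lemma cls_mono:
  assumes "closure_space X" "S \<subseteq> T" "T \<subseteq> pts X"
  shows "cls X S \<subseteq> cls X T"
proof -
  have "cls X (S \<union> T) = cls X S \<union> cls X T"
    using assms by (auto simp: closure_space_def)
  then show ?thesis
    using assms(2) by (auto simp: Un_absorb1)
qed

lemma cls_extensive: "closure_space X \<Longrightarrow> S \<subseteq> pts X \<Longrightarrow> S \<subseteq> cls X S"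
  by (simp add: closure_space_def)

lemma cnbhd_self: "closure_space X \<Longrightarrow> cnbhd X x V \<Longrightarrow> x \<in> V"
  using cls_extensive[of X "pts X - V"] by (auto simp: cnbhd_def cinterior_def)

lemma cmaps_compose:
  assumes "f \<in> cmaps K L" "g \<in> cmaps L X" "\<And>S. S \<subseteq> pts K \<Longrightarrow> cls K S \<subseteq> pts K"
  shows "(\<lambda>x\<in>pts K. g (f x)) \<in> cmaps K X"
  unfolding cmaps_def
proof (intro CollectI conjI allI impI)
  show "(\<lambda>x\<in>pts K. g (f x)) \<in> pts K \<rightarrow>\<^sub>E pts X"
    using assms by (auto simp: cmaps_def)
  fix S assume S: "S \<subseteq> pts K"
  have fS: "f ` S \<subseteq> pts L"
    using assms(1) S by (auto simp: cmaps_def)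
  have "(\<lambda>x\<in>pts K. g (f x)) ` cls K S = g ` f ` cls K S"
    using assms(3)[OF S] by (auto simp: image_image)
  also have "\<dots> \<subseteq> g ` cls L (f ` S)"
    using assms(1) S by (intro image_mono) (auto simp: cmaps_def)
  also have "\<dots> \<subseteq> cls X (g ` f ` S)"
    using assms(2) fS by (auto simp: cmaps_def)
  also have "g ` f ` S = (\<lambda>x\<in>pts K. g (f x)) ` S"
    using S by (auto simp: image_image)
  finally show "(\<lambda>x\<in>pts K. g (f x)) ` cls K S \<subseteq> cls X ((\<lambda>x\<in>pts K. g (f x)) ` S)" .
qed

lemma cmaps_subcspace:
  assumes "A \<subseteq> pts X" "\<And>S. S \<subseteq> pts K \<Longrightarrow> cls K S \<subseteq> pts K"
  shows "cmaps K (subcspace X A) = {f \<in> cmaps K X. f ` pts K \<subseteq> A}"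
proof (intro Set.set_eqI iffI)
  fix f assume f: "f \<in> cmaps K (subcspace X A)"
  then have fA: "f ` pts K \<subseteq> A"
    by (auto simp: cmaps_def subcspace_def)
  moreover have "f \<in> cmaps K X"
    using f assms(1) by (auto simp: cmaps_def subcspace_def PiE_iff)
  ultimately show "f \<in> {f \<in> cmaps K X. f ` pts K \<subseteq> A}"
    by simp
next
  fix f assume "f \<in> {f \<in> cmaps K X. f ` pts K \<subseteq> A}"
  then have f: "f \<in> cmaps K X" "f ` pts K \<subseteq> A"
    by auto
  have "f ` cls K S \<subseteq> cls X (f ` S) \<inter> A" if "S \<subseteq> pts K" for S
    using f assms(2)[OF that] that by (auto simp: cmaps_def)
  then show "f \<in> cmaps K (subcspace X A)"
    using f by (auto simp: cmaps_def subcspace_def PiE_iff)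
qed

text \<open>Equals the set of maps into the subspace by \<open>cmaps_subcspace\<close>, but keeps
  all generators inside one basis, where unions and intersections make sense.\<close>

definition maps_in :: "'p cspace \<Rightarrow> 'a cspace \<Rightarrow> 'a set \<Rightarrow> ('p \<Rightarrow> 'a) set" where
  "maps_in K X A = {f \<in> cmaps K X. f ` pts K \<subseteq> A}"

lemma maps_in_sub: "maps_in K X A \<subseteq> cmaps K X"
  by (auto simp: maps_in_def)

lemma maps_in_pts: "maps_in K X (pts X) = cmaps K X"
  by (auto simp: maps_in_def cmaps_def)

text \<open>The only neighbourhood of such a point \<open>p\<close> is the whole space.\<close>

lemma interior_cover_generic_point:
  assumes X: "closure_space X" and cov: "interior_cover X {A, B}" and p: "p \<in> pts K"
    and generic: "\<And>q. q \<in> pts K \<Longrightarrow> p \<in> cls K {q}" and f: "f \<in> cmaps K X"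
  shows "f ` pts K \<subseteq> A \<or> f ` pts K \<subseteq> B"
proof -
  have "f ` pts K \<subseteq> V" if "f p \<in> cinterior X V" for V
  proof (rule ccontr)
    assume "\<not> f ` pts K \<subseteq> V"
    then obtain q where q: "q \<in> pts K" "f q \<notin> V"
      by blast
    have "f p \<in> cls X (f ` {q})"
      using f generic[OF q(1)] q(1) unfolding cmaps_def by blast
    moreover have "f ` {q} \<subseteq> pts X - V"
      using f q by (auto simp: cmaps_def)
    ultimately have "f p \<in> cls X (pts X - V)"
      using cls_mono[OF X, of "f ` {q}" "pts X - V"] by blast
    then show False
      using that by (simp add: cinterior_def)
  qed
  moreover have "f p \<in> cinterior X A \<union> cinterior X B"
    using cov f p by (auto simp: interior_cover_def cmaps_def)
  ultimately show ?thesis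
    by blast
qed

section \<open>Two criteria for acyclicity modulo \<open>S\<close>\<close>

lemma acyclic_mod_trivial:
  assumes "\<And>n. U n \<subseteq> S n" "\<And>n. d n 0 = 0"
  shows "acyclic_mod U S d"
  unfolding acyclic_mod_def using assms(2) frags_mono[OF _ assms(1)]
  by (intro allI ballI impI bexI[of _ 0]) auto

text \<open>
  The subdivision \<open>sd\<close> is not required to be a chain map: that \<open>sd z\<close> is a relative cycle follows
  from the homotopy identity.
\<close>

lemma acyclic_mod_subdivision:
  fixes U S :: "nat \<Rightarrow> 'b set" and sd h :: "nat \<Rightarrow> ('b \<Rightarrow>\<^sub>0 int) \<Rightarrow> ('b \<Rightarrow>\<^sub>0 int)"
  assumes S_sub: "\<And>n. S n \<subseteq> U n"
    and d_diff: "\<And>n a b. d n (a - b) = d n a - d n b"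
    and d_U: "\<And>n x. x \<in> frags (U (Suc n)) \<Longrightarrow> d n x \<in> frags (U n)"
    and d_S: "\<And>n x. x \<in> frags (S (Suc n)) \<Longrightarrow> d n x \<in> frags (S n)"
    and d_d: "\<And>n x. x \<in> frags (U (Suc (Suc n))) \<Longrightarrow> d n (d (Suc n) x) = 0"
    and sd_diff: "\<And>n a b. sd n (a - b) = sd n a - sd n b"
    and sd_U: "\<And>n x. x \<in> frags (U n) \<Longrightarrow> sd n x \<in> frags (U n)"
    and h_U: "\<And>n x. x \<in> frags (U n) \<Longrightarrow> h n x \<in> frags (U (Suc n))"
    and h_S: "\<And>n x. x \<in> frags (S n) \<Longrightarrow> h n x \<in> frags (S (Suc n))"
    and homotopy_0: "\<And>x. x \<in> frags (U 0) \<Longrightarrow> d 0 (h 0 x) - (sd 0 x - x) \<in> frags (S 0)"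
    and homotopy: "\<And>n x. x \<in> frags (U (Suc n)) \<Longrightarrow>
        d (Suc n) (h (Suc n) x) + h n (d n x) - (sd (Suc n) x - x) \<in> frags (S (Suc n))"
    and small: "\<And>n u. u \<in> U n \<Longrightarrow> \<exists>N. \<forall>k\<ge>N. (sd n ^^ k) (frag_of u) \<in> frags (S n)"
  shows "acyclic_mod U S d"
proof -
  \<comment> \<open>Smallness is asked for all large \<open>k\<close>, so two chains have a common
    \<open>k\<close> at which both are small; \<open>sd\<close> itself is not assumed to preserve
    \<open>S\<close>.\<close>
  have small': "\<exists>N. \<forall>k\<ge>N. (sd n ^^ k) z \<in> frags (S n)" if "z \<in> frags (U n)" for n z
    using that
  proof (induction rule: frags_induct)
    case zero
    have "sd n 0 = 0"
      using sd_diff[of n 0 0] by simp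
    then have "(sd n ^^ k) 0 = 0" for k
      by (induction k) auto
    then show ?case
      by simp
  next
    case (one u)
    then show ?case
      using small by blast
  next
    case (diff a b)
    then obtain N M where "\<forall>k\<ge>N. (sd n ^^ k) a \<in> frags (S n)" "\<forall>k\<ge>M. (sd n ^^ k) b \<in> frags (S n)"
      by blast
    moreover have "(sd n ^^ k) (a - b) = (sd n ^^ k) a - (sd n ^^ k) b" for k
      by (induction k) (auto simp: sd_diff)
    ultimately show ?case
      by (intro exI[of _ "max N M"]) (auto intro: frags_diff)
  qed
  have d_0: "d n 0 = 0" for n
    using d_diff[of n 0 0] by simp
  have d_add: "d n (a + b) = d n a + d n b" for n a b
  proof -
    have "d n (a - (0 - b)) = d n a - (d n 0 - d n b)"
      by (simp only: d_diff)
    then show ?thesis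
      by (simp add: d_0)
  qed
  \<comment> \<open>Induction on the number \<open>k\<close> of subdivisions that make
    \<open>z\<close> small: a filling \<open>w\<close> of \<open>sd n z\<close> is corrected by
    \<open>h n z\<close>, which bridges \<open>z\<close> and \<open>sd n z\<close> modulo
    \<open>S\<close>.\<close>
  have main: "\<exists>w\<in>frags (U (Suc n)). z - d n w \<in> frags (S n)"
    if "z \<in> frags (U n)" "\<forall>m. n = Suc m \<longrightarrow> d m z \<in> frags (S m)" "(sd n ^^ k) z \<in> frags (S n)" for n z k
    using that
  proof (induction k arbitrary: z)
    case 0
    then show ?case
      by (intro bexI[of _ 0]) (auto simp: d_0)
  next
    case (Suc k)
    have s: "d n (h n z) - (sd n z - z) \<in> frags (S n)"
    proof (cases n)
      case 0
      then show ?thesis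
        using homotopy_0 Suc.prems by simp
    next
      case (Suc m)
      have "d (Suc m) (h (Suc m) z) + h m (d m z) - (sd (Suc m) z - z) - h m (d m z) \<in> frags (S (Suc m))"
        using Suc.prems Suc by (intro frags_diff[OF homotopy h_S]) auto
      then show ?thesis
        using Suc by (simp add: algebra_simps)
    qed
    have "d m (sd n z) \<in> frags (S m)" if m: "n = Suc m" for m
    proof -
      have "d m (d (Suc m) (h (Suc m) z)) = 0"
        using h_U[of z n] m Suc.prems by (intro d_d) auto
      moreover have "d m z - d m (d n (h n z) - (sd n z - z)) \<in> frags (S m)"
        using Suc.prems(2) m d_S s by (intro frags_diff) auto
      ultimately show ?thesis
        using m by (simp add: d_diff)
    qed
    moreover have "(sd n ^^ k) (sd n z) \<in> frags (S n)"
      using Suc.prems(3) by (simp add: funpow_swap1)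
    ultimately obtain w where w: "w \<in> frags (U (Suc n))" "sd n z - d n w \<in> frags (S n)"
      using Suc.IH[of "sd n z"] sd_U Suc.prems(1) by blast
    have "sd n z - d n w + (d n (h n z) - (sd n z - z)) \<in> frags (S n)"
      using w s by (intro frags_add)
    then have "z - d n (w - h n z) \<in> frags (S n)"
      by (simp add: d_diff algebra_simps)
    moreover have "w - h n z \<in> frags (U (Suc n))"
      using w(1) h_U[OF Suc.prems(1)] by (rule frags_diff)
    ultimately show ?case
      by blast
  qed
  show ?thesis
    unfolding acyclic_mod_def using main small' by blast
qed


section \<open>Excision for singular simplices\<close>

locale simplex_family =
  fixes \<Delta> :: "'p simplices"
  assumes cls_sub: "S \<subseteq> pts (simplex \<Delta> n) \<Longrightarrow> cls (simplex \<Delta> n) S \<subseteq> pts (simplex \<Delta> n)"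
    and face_cmaps: "i \<le> Suc n \<Longrightarrow>
        restrict (face \<Delta> i) (pts (simplex \<Delta> n)) \<in> cmaps (simplex \<Delta> n) (simplex \<Delta> (Suc n))"
    and face_face: "i \<le> j \<Longrightarrow> face \<Delta> (Suc j) (face \<Delta> i x) = face \<Delta> i (face \<Delta> j x)"
begin

definition sface :: "nat \<Rightarrow> nat \<Rightarrow> ('p \<Rightarrow> 'a) \<Rightarrow> ('p \<Rightarrow> 'a)" where
  "sface n i \<sigma> = (\<lambda>x\<in>pts (simplex \<Delta> n). \<sigma> (face \<Delta> i x))"

lemma simplicial_bd_of:
  "simplicial_bd \<Delta> n (frag_of \<sigma>) = (\<Sum>i\<le>Suc n. frag_cmul ((-1) ^ i) (frag_of (sface n i \<sigma>)))"
  by (simp add: simplicial_bd_def sface_def atLeast0AtMost)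

lemma simplicial_bd_diff: "simplicial_bd \<Delta> n (a - b) = simplicial_bd \<Delta> n a - simplicial_bd \<Delta> n b"
  by (simp add: simplicial_bd_def frag_extend_diff)

lemma simplicial_bd_0: "simplicial_bd \<Delta> n 0 = 0"
  by (simp add: simplicial_bd_def)

lemma face_pts:
  "i \<le> Suc n \<Longrightarrow> x \<in> pts (simplex \<Delta> n) \<Longrightarrow> face \<Delta> i x \<in> pts (simplex \<Delta> (Suc n))"
  using face_cmaps[of i n] by (auto simp: cmaps_def PiE_iff)

lemma sface_maps_in:
  assumes "i \<le> Suc n" "\<sigma> \<in> maps_in (simplex \<Delta> (Suc n)) X A"
  shows "sface n i \<sigma> \<in> maps_in (simplex \<Delta> n) X A"
proof -
  have "sface n i \<sigma> = (\<lambda>x\<in>pts (simplex \<Delta> n). \<sigma> (restrict (face \<Delta> i) (pts (simplex \<Delta> n)) x))"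
    by (auto simp: sface_def)
  then have "sface n i \<sigma> \<in> cmaps (simplex \<Delta> n) X"
    using cmaps_compose[OF face_cmaps[OF assms(1)] _ cls_sub] assms(2) by (auto simp: maps_in_def)
  then show ?thesis
    using assms face_pts by (auto simp: maps_in_def sface_def)
qed

lemma simplicial_bd_maps_in:
  assumes "c \<in> frags (maps_in (simplex \<Delta> (Suc n)) X A)"
  shows "simplicial_bd \<Delta> n c \<in> frags (maps_in (simplex \<Delta> n) X A)"
  unfolding simplicial_bd_def sface_def[symmetric]
  by (intro frags_extend[OF assms] frags_sum frags_cmul) (simp add: sface_maps_in)

lemma simplicial_bd_bd: "simplicial_bd \<Delta> n (simplicial_bd \<Delta> (Suc n) c) = 0"
proof -
  have "c \<in> frags UNIV"
    by (simp add: frags_def)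
  then show ?thesis
  proof (induction rule: frags_induct)
    case (one \<sigma>)
    have "sface n j (sface (Suc n) i \<sigma>) = sface n i (sface (Suc n) (Suc j) \<sigma>)" if "i \<le> j" "j \<le> Suc n" for i j
      using that face_pts[of _ n] by (auto simp: sface_def fun_eq_iff face_face)
    then have "(\<Sum>i\<le>Suc (Suc n). \<Sum>j\<le>Suc n. frag_cmul ((-1) ^ (i + j))
        (frag_of (sface n j (sface (Suc n) i \<sigma>)))) = 0"
      by (intro alternating_double_sum) auto
    moreover have "simplicial_bd \<Delta> n (simplicial_bd \<Delta> (Suc n) (frag_of \<sigma>))
      = (\<Sum>i\<le>Suc (Suc n). frag_cmul ((-1) ^ i) (simplicial_bd \<Delta> n (frag_of (sface (Suc n) i \<sigma>))))"
      unfolding simplicial_bd_of[of "Suc n"] by (simp add: simplicial_bd_def frag_extend_sum frag_extend_cmul del: sum.atMost_Suc)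
    ultimately show ?case
      by (simp add: simplicial_bd_of frag_cmul_sum power_add del: sum.atMost_Suc)
  qed (auto simp: simplicial_bd_diff simplicial_bd_0)
qed

lemma presentation_simplicial_cplx:
  "presentation (simplicial_cplx \<Delta> X) (\<lambda>n. cmaps (simplex \<Delta> n) X) (\<lambda>n. {}) (simplicial_bd \<Delta>) (\<lambda>n x. x)"
  using simplicial_bd_maps_in[of _ _ X "pts X"]
  by (intro presentation.intro)
     (auto simp: simplicial_cplx_def simplicial_bd_diff simplicial_bd_0 simplicial_bd_bd maps_in_pts
        abelian_free_Abelian_group hom_def)

lemma presentation_simplicial_rel_cplx:
  assumes "A \<subseteq> pts X"
  shows "presentation (simplicial_rel_cplx \<Delta> X A) (\<lambda>n. cmaps (simplex \<Delta> n) X)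
    (\<lambda>n. maps_in (simplex \<Delta> n) X A) (simplicial_bd \<Delta>)
    (\<lambda>n x. frags (maps_in (simplex \<Delta> n) X A) #>\<^bsub>free_Abelian_group (cmaps (simplex \<Delta> n) X)\<^esub> x)"
proof -
  have N: "carrier (chains (simplicial_cplx \<Delta> (subcspace X A)) n) = frags (maps_in (simplex \<Delta> n) X A)" for n
    using cmaps_subcspace[OF assms cls_sub] by (simp add: simplicial_cplx_def maps_in_def)
  show ?thesis
    using presentation_quotient[OF presentation_simplicial_cplx[of X],
        of "\<lambda>n. maps_in (simplex \<Delta> n) X A" "\<lambda>n. frags (maps_in (simplex \<Delta> n) X A)",
        OF maps_in_sub simplicial_bd_maps_in]
    by (simp add: simplicial_rel_cplx_def N) (simp add: simplicial_cplx_def)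
qed

lemma simplicial_excision:
  assumes A: "A \<subseteq> pts X" and B: "B \<subseteq> pts X" and G: "comm_group G"
    and acyclic: "acyclic_mod (\<lambda>n. cmaps (simplex \<Delta> n) X)
      (\<lambda>n. maps_in (simplex \<Delta> n) X A \<union> maps_in (simplex \<Delta> n) X B) (simplicial_bd \<Delta>)"
  shows "simplicial_incl_iso \<Delta> n B (A \<inter> B) X A G"
proof -
  let ?m = "\<lambda>n. maps_in (simplex \<Delta> n) X"
  have sub: "cmaps (simplex \<Delta> n) (subcspace X V) = ?m n V" if "V \<subseteq> pts X" for V n
    using cmaps_subcspace[OF that cls_sub] by (simp add: maps_in_def)
  note W = sub[OF B]
  have AB: "maps_in (simplex \<Delta> n) (subcspace X B) (A \<inter> B) = ?m n A \<inter> ?m n B" for n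
    using W[of n] by (auto simp: maps_in_def)
  have P': "presentation (simplicial_rel_cplx \<Delta> (subcspace X B) (A \<inter> B)) (\<lambda>n. ?m n B)
    (\<lambda>n. ?m n A \<inter> ?m n B) (simplicial_bd \<Delta>)
    (\<lambda>n x. frags (?m n A \<inter> ?m n B) #>\<^bsub>free_Abelian_group (?m n B)\<^esub> x)"
    using presentation_simplicial_rel_cplx[of "A \<inter> B" "subcspace X B"]
    by (simp add: W AB) (simp add: subcspace_def)
  have "excision_pair (simplicial_rel_cplx \<Delta> X A) (\<lambda>n. cmaps (simplex \<Delta> n) X) (\<lambda>n. ?m n A)
    (simplicial_bd \<Delta>) (\<lambda>n x. frags (?m n A) #>\<^bsub>free_Abelian_group (cmaps (simplex \<Delta> n) X)\<^esub> x)
    (simplicial_rel_cplx \<Delta> (subcspace X B) (A \<inter> B)) (\<lambda>n. ?m n B)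
    (\<lambda>n x. frags (?m n A \<inter> ?m n B) #>\<^bsub>free_Abelian_group (?m n B)\<^esub> x)
    (simplicial_rel_incl \<Delta> X A) G"
  proof (rule excision_pair.intro[OF presentation_simplicial_rel_cplx[OF A] P' excision_pair_axioms.intro])
    show "?m n B \<subseteq> cmaps (simplex \<Delta> n) X" for n
      by (rule maps_in_sub)
    show "acyclic_mod (\<lambda>n. cmaps (simplex \<Delta> n) X) (\<lambda>n. ?m n A \<union> ?m n B) (simplicial_bd \<Delta>)"
      by (rule acyclic)
    show "simplicial_rel_incl \<Delta> X A n (frags (?m n A \<inter> ?m n B) #>\<^bsub>free_Abelian_group (?m n B)\<^esub> x)
        = frags (?m n A) #>\<^bsub>free_Abelian_group (cmaps (simplex \<Delta> n) X)\<^esub> x"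
      if x: "x \<in> frags (?m n B)" for n x
    proof -
      have id: "id \<in> hom (free_Abelian_group (?m n B)) (free_Abelian_group (cmaps (simplex \<Delta> n) X))"
        using frags_mono[OF _ maps_in_sub] by (intro homI) auto
      then show ?thesis
        using coset_map_r_coset[OF id, of "frags (?m n A \<inter> ?m n B)" "frags (?m n A)" x] x
          subsetI[OF frags_mono[of _ "?m n A \<inter> ?m n B" "?m n A"]]
        by (simp add: simplicial_rel_incl_def simplicial_cplx_def subgroup_frags maps_in_sub sub[OF A]
             image_subset_iff)
    qed
  qed (rule G)
  then show ?thesis
    unfolding simplicial_incl_iso_def simplicial_cohomology_def
    by (rule excision_pair.cohomology_map_iso)
qed

end

lemma interior_cover_sub: "interior_cover X {A, B} \<Longrightarrow> A \<subseteq> pts X \<and> B \<subseteq> pts X"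
  by (auto simp: interior_cover_def)

lemma (in simplex_family) simplicial_excision_generic:
  assumes X: "closure_space X" and G: "comm_group G" and cov: "interior_cover X {A, B}"
    and generic: "\<And>n. \<exists>p\<in>pts (simplex \<Delta> n). \<forall>q\<in>pts (simplex \<Delta> n). p \<in> cls (simplex \<Delta> n) {q}"
  shows "simplicial_incl_iso \<Delta> n B (A \<inter> B) X A G"
proof (rule simplicial_excision[OF _ _ G])
  show "acyclic_mod (\<lambda>n. cmaps (simplex \<Delta> n) X)
      (\<lambda>n. maps_in (simplex \<Delta> n) X A \<union> maps_in (simplex \<Delta> n) X B) (simplicial_bd \<Delta>)"
  proof (rule acyclic_mod_trivial)
    fix n
    obtain p where p: "p \<in> pts (simplex \<Delta> n)" "\<And>q. q \<in> pts (simplex \<Delta> n) \<Longrightarrow> p \<in> cls (simplex \<Delta> n) {q}"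
      using generic by blast
    show "cmaps (simplex \<Delta> n) X \<subseteq> maps_in (simplex \<Delta> n) X A \<union> maps_in (simplex \<Delta> n) X B"
      using interior_cover_generic_point[OF X cov p] by (auto simp: maps_in_def)
  qed (rule simplicial_bd_0)
qed (use interior_cover_sub[OF cov] in auto)

lemma simplex_family_J1: "simplex_family simp_J1"
  by unfold_locales (auto simp: simp_J1_def indiscrete_cspace_def cmaps_def)

lemma simplicial_excision_J1:
  assumes "closure_space X" "comm_group G" "interior_cover X {A, B}"
  shows "simplicial_incl_iso simp_J1 n B (A \<inter> B) X A G"
  by (rule simplex_family.simplicial_excision_generic[OF simplex_family_J1 assms])
     (auto simp: simp_J1_def indiscrete_cspace_def)

text \<open>Face inclusions are increasing, hence continuous for the closure by upper sets.\<close>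

lemma simplex_family_Jplus: "simplex_family simp_Jplus"
proof
  fix i n :: nat assume "i \<le> Suc n"
  then show "restrict (face simp_Jplus i) (pts (simplex simp_Jplus n))
      \<in> cmaps (simplex simp_Jplus n) (simplex simp_Jplus (Suc n))"
    by (fastforce simp: simp_Jplus_def upset_cspace_def cmaps_def subset_iff)
qed (auto simp: simp_Jplus_def upset_cspace_def)

text \<open>The last vertex is above every other one and so lies in the closure of each of them; it
  is the generic point.\<close>

lemma simplicial_excision_Jplus:
  assumes "closure_space X" "comm_group G" "interior_cover X {A, B}"
  shows "simplicial_incl_iso simp_Jplus n B (A \<inter> B) X A G"
  by (rule simplex_family.simplicial_excision_generic[OF simplex_family_Jplus assms])
     (auto simp: simp_Jplus_def upset_cspace_def)


section \<open>Barycentric subdivision\<close>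

abbreviation std_top :: "nat \<Rightarrow> (nat \<Rightarrow> real) topology" where
  "std_top n \<equiv> subtopology (powertop_real UNIV) (standard_simplex n)"

abbreviation std_id :: "nat \<Rightarrow> (nat \<Rightarrow> real) \<Rightarrow> (nat \<Rightarrow> real)" where
  "std_id n \<equiv> restrict id (standard_simplex n)"

lemma simplex_I: "simplex simp_I n = top_cspace (std_top n)"
  by (simp add: simp_I_def)

lemma pts_simplex_I: "pts (simplex simp_I n) = standard_simplex n"
  by (simp add: simplex_I top_cspace_def)

lemma cls_simplex_I_sub: "cls (simplex simp_I n) S \<subseteq> pts (simplex simp_I n)"
  by (simp add: simplex_I top_cspace_def closure_of_subset_topspace del: topspace_subtopology)

lemma continuous_map_cmaps:
  assumes "continuous_map S T f"
  shows "restrict f (topspace S) \<in> cmaps (top_cspace S) (top_cspace T)"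
  unfolding cmaps_def
proof (intro CollectI conjI allI impI)
  show "restrict f (topspace S) \<in> pts (top_cspace S) \<rightarrow>\<^sub>E pts (top_cspace T)"
    using continuous_map_image_subset_topspace[OF assms] by (auto simp: top_cspace_def)
  fix C assume C: "C \<subseteq> pts (top_cspace S)"
  have "restrict f (topspace S) ` (S closure_of C) = f ` (S closure_of C)"
    using closure_of_subset_topspace[of S C] by auto
  also have "\<dots> \<subseteq> T closure_of (f ` C)"
    by (rule continuous_map_image_closure_subset[OF assms])
  also have "f ` C = restrict f (topspace S) ` C"
    using C by (auto simp: top_cspace_def)
  finally show "restrict f (topspace S) ` cls (top_cspace S) C \<subseteq> cls (top_cspace T) (restrict f (topspace S) ` C)"
    by (simp add: top_cspace_def)
qed

lemma singular_simplex_cmaps: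
  assumes "singular_simplex p (std_top n) g"
  shows "g \<in> cmaps (simplex simp_I p) (simplex simp_I n)"
proof -
  have "restrict g (standard_simplex p) = g"
    using assms by (auto simp: singular_simplex_def extensional_restrict)
  then show ?thesis
    using continuous_map_cmaps[of "std_top p" "std_top n" g] assms
    by (simp add: singular_simplex_def simplex_I)
qed

lemma simplex_family_I: "simplex_family simp_I"
proof
  show "cls (simplex simp_I n) S \<subseteq> pts (simplex simp_I n)" for S n
    by (rule cls_simplex_I_sub)
  show "restrict (face simp_I i) (pts (simplex simp_I n)) \<in> cmaps (simplex simp_I n) (simplex simp_I (Suc n))"
    if "i \<le> Suc n" for i n
  proof -
    have "singular_simplex (Suc n) (std_top (Suc n)) (std_id (Suc n))"
      by (simp add: singular_simplex_def continuous_map_eq[of _ _ id])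
    then have "singular_simplex n (std_top (Suc n)) (singular_face (Suc n) i (std_id (Suc n)))"
      using singular_simplex_singular_face[of "Suc n" _ _ i] that
      by (simp del: singular_face_restrict)
    moreover have "singular_face (Suc n) i (std_id (Suc n)) = restrict (simplical_face i) (standard_simplex n)"
      using that simplical_face_in_standard_simplex[of "Suc n" i]
      by (intro ext) (simp add: singular_face_def del: singular_face_restrict)
    ultimately show ?thesis
      using singular_simplex_cmaps[of n "Suc n"] by (simp add: pts_simplex_I) (simp add: simp_I_def)
  qed
  show "face simp_I (Suc j) (face simp_I i x) = face simp_I i (face simp_I j x)" if "i \<le> j" for i j x
    using that by (auto simp: simp_I_def simplical_face_def fun_eq_iff)
qed

interpretation simp_I: simplex_family simp_I
  by (rule simplex_family_I)

text \<open>Gives access to the subdivision operators of HOL-Homology, which act on arbitrary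
  functions. The shift arises since \<open>chain_boundary\<close> is indexed by the dimension of its
  argument and \<open>simplicial_bd\<close> by that of its result.\<close>

lemma simplicial_bd_I: "simplicial_bd simp_I n = chain_boundary (Suc n)"
  by (simp add: simplicial_bd_def chain_boundary_def fun_eq_iff pts_simplex_I atLeast0AtMost
       singular_face_def o_def simp_I_def[THEN arg_cong, of face] del: sum.atMost_Suc)

section \<open>Pushing chains of the model simplex forward to a closure space\<close>

lemma singular_chain_std_id: "singular_chain n (std_top n) (frag_of (std_id n))"
  by (simp add: simplicial_imp_singular_chain)

text \<open>Takes the place of \<open>singular_chain\<close> for the target, which would presuppose
  a topology: the simplices of \<open>c\<close> are continuous between topological simplices, and
  composing them with \<sigma> is continuous for closures.\<close>

lemma chain_map_maps_in:
  assumes \<sigma>: "\<sigma> \<in> cmaps (simplex simp_I n) X" and c: "singular_chain p (std_top n) c"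
    and A: "\<And>g x. g \<in> Poly_Mapping.keys c \<Longrightarrow> x \<in> standard_simplex p \<Longrightarrow> \<sigma> (g x) \<in> A"
  shows "chain_map p \<sigma> c \<in> frags (maps_in (simplex simp_I p) X A)"
  unfolding chain_map_def
proof (rule frags_extend)
  show "c \<in> frags (Poly_Mapping.keys c)"
    by (simp add: frags_def)
  fix g assume g: "g \<in> Poly_Mapping.keys c"
  then have "g \<in> cmaps (simplex simp_I p) (simplex simp_I n)"
    using c by (intro singular_simplex_cmaps) (auto simp: singular_chain_def)
  then have "simplex_map p \<sigma> g \<in> cmaps (simplex simp_I p) X"
    using cmaps_compose[OF _ \<sigma> cls_simplex_I_sub, of g p]
    by (simp add: simplex_map_def pts_simplex_I o_def)
  then have "simplex_map p \<sigma> g \<in> maps_in (simplex simp_I p) X A"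
    using A[OF g] by (auto simp: maps_in_def simplex_map_def pts_simplex_I)
  then show "(frag_of \<circ> simplex_map p \<sigma>) g \<in> frags (maps_in (simplex simp_I p) X A)"
    by simp
qed

lemma chain_map_maps_in':
  assumes \<sigma>: "\<sigma> \<in> maps_in (simplex simp_I n) X A" and c: "singular_chain p (std_top n) c"
  shows "chain_map p \<sigma> c \<in> frags (maps_in (simplex simp_I p) X A)"
proof (rule chain_map_maps_in[OF _ c])
  show "\<sigma> \<in> cmaps (simplex simp_I n) X"
    using \<sigma> maps_in_sub by auto
  fix g x assume g: "g \<in> Poly_Mapping.keys c" and x: "x \<in> standard_simplex p"
  have "g \<in> cmaps (simplex simp_I p) (simplex simp_I n)"
    using c g by (intro singular_simplex_cmaps) (auto simp: singular_chain_def)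
  then have "g x \<in> standard_simplex n"
    using x by (auto simp: cmaps_def pts_simplex_I)
  then show "\<sigma> (g x) \<in> A"
    using \<sigma> by (auto simp: maps_in_def pts_simplex_I)
qed

text \<open>The operator \<open>subd\<close> cones off affine simplices and so has no meaning in
  \<open>X\<close>; it is applied to the identity of the model simplex and the result is pushed
  forward along \<sigma>.\<close>

definition sing_htpy :: "nat \<Rightarrow> (((nat \<Rightarrow> real) \<Rightarrow> 'a) \<Rightarrow>\<^sub>0 int) \<Rightarrow> (((nat \<Rightarrow> real) \<Rightarrow> 'a) \<Rightarrow>\<^sub>0 int)" where
  "sing_htpy n = frag_extend (\<lambda>\<sigma>. chain_map (Suc n) \<sigma> (subd n (frag_of (std_id n))))"

lemma sing_htpy_diff: "sing_htpy n (a - b) = sing_htpy n a - sing_htpy n b"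
  by (simp add: sing_htpy_def frag_extend_diff)

lemma singular_chain_subd_id: "singular_chain (Suc n) (std_top n) (subd n (frag_of (std_id n)))"
  by (simp add: chain_homotopic_simplicial_subdivision2 simplicial_imp_singular_chain)

lemma singular_chain_subdivision_id:
  "singular_chain n (std_top n) (simplicial_subdivision n (frag_of (std_id n)))"
  by (simp add: simplicial_chain_simplicial_subdivision simplicial_imp_singular_chain)

text \<open>Each face of the identity simplex is affine, and \<open>subd\<close> is natural for
  affine maps. So \<open>subd\<close> of the face is the model chain one dimension lower, pushed
  along the face inclusion, and \<sigma> after that inclusion is a face of \<sigma>.\<close>

lemma chain_map_subd_boundary:
  "chain_map (Suc m) \<sigma> (subd m (chain_boundary (Suc m) (frag_of (std_id (Suc m)))))
     = sing_htpy m (chain_boundary (Suc m) (frag_of \<sigma>))"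
proof -
  let ?c = "subd m (frag_of (std_id m))"
  let ?\<phi> = "\<lambda>k. singular_face (Suc m) k (std_id (Suc m))"
  have face: "chain_map (Suc m) \<sigma> (subd m (frag_of (?\<phi> k))) = chain_map (Suc m) (singular_face (Suc m) k \<sigma>) ?c"
    if "k \<le> Suc m" for k
  proof -
    have \<phi>: "simplicial_simplex m (standard_simplex (Suc m)) (?\<phi> k)"
      using simplicial_simplex_singular_face[of "Suc m" _ _ k] that
      by (simp del: singular_face_restrict)
    have "simplex_map m (?\<phi> k) (std_id m) = ?\<phi> k"
      by (auto simp: simplex_map_def singular_face_def)
    then have "subd m (frag_of (?\<phi> k)) = chain_map (Suc m) (?\<phi> k) ?c"
      using chain_homotopic_simplicial_subdivision1[OF _ \<phi>, of m "frag_of (std_id m)"] by simp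
    then have "chain_map (Suc m) \<sigma> (subd m (frag_of (?\<phi> k))) = chain_map (Suc m) (\<sigma> \<circ> ?\<phi> k) ?c"
      by (simp add: chain_map_compose)
    also have "\<dots> = chain_map (Suc m) (singular_face (Suc m) k \<sigma>) ?c"
      using that simplical_face_in_standard_simplex[of "Suc m" k]
      by (intro chain_map_eq[OF singular_chain_subd_id]) (auto simp: singular_face_def)
    finally show ?thesis .
  qed
  have "chain_map (Suc m) \<sigma> (subd m (chain_boundary (Suc m) (frag_of (std_id (Suc m)))))
      = (\<Sum>k\<le>Suc m. frag_cmul ((-1) ^ k) (chain_map (Suc m) \<sigma> (subd m (frag_of (?\<phi> k)))))"
    by (simp add: chain_boundary_of subd_power_sum o_def subd_power_uminus chain_map_sum
         del: sum.atMost_Suc singular_face_restrict)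
  also have "\<dots> = (\<Sum>k\<le>Suc m. frag_cmul ((-1) ^ k) (chain_map (Suc m) (singular_face (Suc m) k \<sigma>) ?c))"
    using face by (intro sum.cong) auto
  also have "\<dots> = sing_htpy m (chain_boundary (Suc m) (frag_of \<sigma>))"
    by (simp add: sing_htpy_def chain_boundary_of frag_extend_sum o_def frag_extend_cmul
         del: sum.atMost_Suc)
  finally show ?thesis .
qed

text \<open>The homotopy identity of the affine simplex \<open>std_id n\<close>, pushed forward
  along \<sigma>. For \<open>n = 0\<close> the truncated \<open>n - 1\<close> is harmless because
  \<open>subd 0\<close> is zero.\<close>

lemma sing_htpy_of:
  assumes "\<sigma> \<in> cmaps (simplex simp_I n) X"
  shows "chain_boundary (Suc n) (sing_htpy n (frag_of \<sigma>))
       + chain_map n \<sigma> (subd (n - 1) (chain_boundary n (frag_of (std_id n))))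
     = singular_subdivision n (frag_of \<sigma>) - frag_of \<sigma>"
proof -
  have "simplex_map n \<sigma> (std_id n) = \<sigma>"
    using assms by (auto simp: simplex_map_def cmaps_def pts_simplex_I fun_eq_iff PiE_iff extensional_def)
  moreover have "chain_boundary (Suc n) (sing_htpy n (frag_of \<sigma>))
      = chain_map n \<sigma> (chain_boundary (Suc n) (subd n (frag_of (std_id n))))"
    using chain_boundary_chain_map[OF singular_chain_subd_id] by (simp add: sing_htpy_def)
  ultimately show ?thesis
    by (simp add: chain_homotopic_simplicial_subdivision3[of n n] chain_map_diff singular_subdivision_def)
qed

lemma simplicial_excision_I:
  assumes X: "closure_space X" and G: "comm_group G" and cov: "interior_cover X {A, B}"
  shows "simplicial_incl_iso simp_I n B (A \<inter> B) X A G"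
proof (rule simp_I.simplicial_excision[OF _ _ G])
  let ?\<Delta> = "simplex simp_I"
  let ?U = "\<lambda>n. cmaps (?\<Delta> n) X"
  let ?S = "\<lambda>n. maps_in (?\<Delta> n) X A \<union> maps_in (?\<Delta> n) X B"
  have U: "?U n = maps_in (?\<Delta> n) X (pts X)" for n
    by (rule maps_in_pts[symmetric])
  have union: "frags (maps_in (?\<Delta> p) X C) \<subseteq> frags (?S p)" if "C = A \<or> C = B" for C p
    using that by (auto simp: frags_def)
  have bd_S: "simplicial_bd simp_I n x \<in> frags (?S n)" if "x \<in> frags (?S (Suc n))" for n x
    using that
  proof (rule frags_Un_split)
    fix a b assume "a \<in> frags (maps_in (?\<Delta> (Suc n)) X A)" "b \<in> frags (maps_in (?\<Delta> (Suc n)) X B)" "x = a + b"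
    then show ?thesis
      using union[of A n] union[of B n] simp_I.simplicial_bd_maps_in[of a n X A] simp_I.simplicial_bd_maps_in[of b n X B]
      by (auto simp: simplicial_bd_def frag_extend_add intro!: frags_add)
  qed
  have htpy_0: "sing_htpy 0 x = 0" for x :: "((nat \<Rightarrow> real) \<Rightarrow> 'a) \<Rightarrow>\<^sub>0 int"
    by (simp add: sing_htpy_def frag_extend_eq_0)
  have htpy: "singular_subdivision 0 x = x" if "x \<in> frags (?U 0)" for x
    using that
  proof (induction rule: frags_induct)
    case (one \<sigma>)
    then show ?case
      using sing_htpy_of[of \<sigma> 0 X] by (simp add: htpy_0)
  qed (auto simp: singular_subdivision_diff)
  have htpy_Suc: "chain_boundary (Suc (Suc m)) (sing_htpy (Suc m) x) + sing_htpy m (chain_boundary (Suc m) x)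
      - (singular_subdivision (Suc m) x - x) = 0"
    if "x \<in> frags (?U (Suc m))" for x m
    using that
  proof (induction rule: frags_induct)
    case (one \<sigma>)
    then show ?case
      using sing_htpy_of[of \<sigma> "Suc m" X] by (simp add: chain_map_subd_boundary)
  next
    case (diff a b)
    let ?E = "\<lambda>x. chain_boundary (Suc (Suc m)) (sing_htpy (Suc m) x)
      + sing_htpy m (chain_boundary (Suc m) x) - (singular_subdivision (Suc m) x - x)"
    have "?E (a - b) = ?E a - ?E b"
      by (simp add: sing_htpy_diff chain_boundary_diff singular_subdivision_diff algebra_simps)
    then show ?case
      using diff by simp
  qed (simp add: sing_htpy_def)
  show "acyclic_mod ?U ?S (simplicial_bd simp_I)"
  proof (rule acyclic_mod_subdivision[where sd = singular_subdivision and h = sing_htpy])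
    fix n and x :: "((nat \<Rightarrow> real) \<Rightarrow> 'a) \<Rightarrow>\<^sub>0 int"
    show "?S n \<subseteq> ?U n"
      using maps_in_sub by blast
    show "simplicial_bd simp_I n x \<in> frags (?U n)" if "x \<in> frags (?U (Suc n))"
      using that simp_I.simplicial_bd_maps_in unfolding U by blast
    show "simplicial_bd simp_I n x \<in> frags (?S n)" if "x \<in> frags (?S (Suc n))"
      using that by (rule bd_S)
    show "singular_subdivision n x \<in> frags (?U n)" if "x \<in> frags (?U n)"
      unfolding singular_subdivision_def using that unfolding U
      by (rule frags_extend) (rule chain_map_maps_in'[OF _ singular_chain_subdivision_id])
    show "sing_htpy n x \<in> frags (?U (Suc n))" if "x \<in> frags (?U n)"
      unfolding sing_htpy_def using that unfolding U
      by (rule frags_extend) (rule chain_map_maps_in'[OF _ singular_chain_subd_id])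
    show "sing_htpy n x \<in> frags (?S (Suc n))" if "x \<in> frags (?S n)"
      unfolding sing_htpy_def using that
    proof (rule frags_extend)
      fix \<sigma> assume "\<sigma> \<in> ?S n"
      then obtain C where C: "C = A \<or> C = B" "\<sigma> \<in> maps_in (?\<Delta> n) X C"
        by blast
      then show "chain_map (Suc n) \<sigma> (subd n (frag_of (std_id n))) \<in> frags (?S (Suc n))"
        using union[OF C(1)] chain_map_maps_in'[OF C(2) singular_chain_subd_id] by (rule_tac subsetD)
    qed
    show "\<exists>N. \<forall>k\<ge>N. (singular_subdivision n ^^ k) (frag_of \<sigma>) \<in> frags (?S n)"
      if \<sigma>: "\<sigma> \<in> ?U n" for \<sigma>
    proof -
      let ?T = "std_top n"
      \<comment> \<open>An open substitute for the preimage of \<open>V\<close>: the complement of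
        the closure of the bad points. It is contained in the preimage, and continuity of \<sigma>
        puts into it every point that \<sigma> sends to the interior of \<open>V\<close>.\<close>
      define O' where "O' V = standard_simplex n - ?T closure_of {x \<in> standard_simplex n. \<sigma> x \<notin> V}" for V
      have O'_open: "openin ?T (O' V)" for V
        using closedin_closure_of[of ?T "{x \<in> standard_simplex n. \<sigma> x \<notin> V}"]
        by (simp add: O'_def closedin_def)
      have O'_sub: "\<sigma> x \<in> V" if "x \<in> O' V" for x V
        using that closure_of_subset[of "{x \<in> standard_simplex n. \<sigma> x \<notin> V}" ?T] by (auto simp: O'_def)
      have O'_in: "x \<in> O' V" if "x \<in> standard_simplex n" "\<sigma> x \<in> cinterior X V" for x V
      proof (rule ccontr)
        let ?P = "{x \<in> standard_simplex n. \<sigma> x \<notin> V}"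
        assume "x \<notin> O' V"
        then have "x \<in> cls (?\<Delta> n) ?P"
          using that by (simp add: O'_def simplex_I top_cspace_def)
        moreover have "\<sigma> ` cls (?\<Delta> n) ?P \<subseteq> cls X (\<sigma> ` ?P)"
          using \<sigma> by (simp add: cmaps_def pts_simplex_I subset_eq[of ?P])
        ultimately have "\<sigma> x \<in> cls X (\<sigma> ` ?P)"
          by blast
        also have "\<dots> \<subseteq> cls X (pts X - V)"
          using \<sigma> by (intro cls_mono[OF X]) (auto simp: cmaps_def pts_simplex_I)
        finally show False
          using that by (simp add: cinterior_def)
      qed
      have cov': "\<sigma> x \<in> cinterior X A \<or> \<sigma> x \<in> cinterior X B" if "x \<in> standard_simplex n" for x
        using cov \<sigma> that by (auto simp: interior_cover_def cmaps_def pts_simplex_I)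
      have "topspace ?T \<subseteq> \<Union>{O' A, O' B}"
        using O'_in cov' by (simp add: subset_iff) blast
      moreover have "\<And>V. V \<in> {O' A, O' B} \<Longrightarrow> openin ?T V"
        using O'_open by auto
      \<comment> \<open>The theorem on small subdivisions is applied to the identity of the simplex,
        where there is a topology; \<open>nat\<close> below carries the result over to
        \<sigma>.\<close>
      ultimately obtain N where N: "\<And>k g. N \<le> k \<Longrightarrow> g \<in> Poly_Mapping.keys ((singular_subdivision n ^^ k) (frag_of (std_id n)))
          \<Longrightarrow> \<exists>V\<in>{O' A, O' B}. g \<in> standard_simplex n \<rightarrow> V"
        using sufficient_iterated_singular_subdivision_exists[OF _ _ singular_chain_std_id, of "{O' A, O' B}"]
        by metis
      have sing: "singular_chain n ?T ((singular_subdivision n ^^ k) (frag_of (std_id n)))" for k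
      proof (induction k)
        case 0
        show ?case
          by (simp only: funpow_0 singular_chain_std_id)
      qed (simp only: funpow.simps o_apply singular_chain_singular_subdivision)
      have "simplex_map n \<sigma> (std_id n) = \<sigma>"
        using \<sigma> by (auto simp: simplex_map_def cmaps_def pts_simplex_I fun_eq_iff PiE_iff extensional_def)
      then have nat: "(singular_subdivision n ^^ k) (frag_of \<sigma>)
          = chain_map n \<sigma> ((singular_subdivision n ^^ k) (frag_of (std_id n)))" for k
        by (induction k) (simp_all add: naturality_singular_subdivision[OF sing])
      have "(singular_subdivision n ^^ k) (frag_of \<sigma>) \<in> frags (?S n)" if k: "N \<le> k" for k
      proof -
        let ?c = "(singular_subdivision n ^^ k) (frag_of (std_id n))"
        have "frag_of (simplex_map n \<sigma> g) \<in> frags (?S n)" if g: "g \<in> Poly_Mapping.keys ?c" for g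
        proof -
          obtain V where V: "V = A \<or> V = B" "g \<in> standard_simplex n \<rightarrow> O' V"
            using N[OF k g] by blast
          have "chain_map n \<sigma> (frag_of g) \<in> frags (maps_in (?\<Delta> n) X V)"
            using sing[of k] g V(2) O'_sub
            by (intro chain_map_maps_in[OF \<sigma>]) (auto simp: singular_chain_def)
          then show ?thesis
            using V(1) by auto
        qed
        then show ?thesis
          unfolding nat chain_map_def
          by (intro frags_extend[of ?c "Poly_Mapping.keys ?c"]) (auto simp: frags_def[of "Poly_Mapping.keys ?c"])
      qed
      then show ?thesis
        by blast
    qed
  qed (use htpy htpy_0 htpy_Suc simp_I.simplicial_bd_diff simp_I.simplicial_bd_bd in
        \<open>simp_all add: singular_subdivision_diff simplicial_bd_I\<close>)
qed (use interior_cover_sub[OF cov] in auto)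

section \<open>Excision for singular cubes\<close>

lemma pts_cpower: "pts (cpower J n) = {1..n} \<rightarrow>\<^sub>E pts J"
  by (simp add: cpower_def)

lemma cls_cpower_sub: "cls (cpower J n) S \<subseteq> pts (cpower J n)"
  by (auto simp: cpower_def)

lemma cpower_update:
  "x \<in> pts (cpower J n) \<Longrightarrow> i \<in> {1..n} \<Longrightarrow> t \<in> pts J \<Longrightarrow> x(i := t) \<in> pts (cpower J n)"
  by (simp add: pts_cpower PiE_iff extensional_def)

lemma insert_coord_pts:
  "x \<in> pts (cpower J n) \<Longrightarrow> i \<in> {1..Suc n} \<Longrightarrow> t \<in> pts J \<Longrightarrow> insert_coord n i t x \<in> pts (cpower J (Suc n))"
proof -
  assume x: "x \<in> pts (cpower J n)" and i: "i \<in> {1..Suc n}" and t: "t \<in> pts J"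
  have "x k \<in> pts J" if "1 \<le> k" "k \<le> n" for k
    using x that by (auto simp: pts_cpower)
  then show ?thesis
    using i t by (auto simp: pts_cpower insert_coord_def)
qed

lemma insert_coord_insert_coord:
  assumes "1 \<le> i" "i \<le> j" "j \<le> Suc n"
  shows "insert_coord (Suc n) i s (insert_coord n j t x)
       = insert_coord (Suc n) (Suc j) t (insert_coord n i s x)"
  using assms by (auto simp: insert_coord_def fun_eq_iff restrict_def)

lemma insert_coord_cmaps:
  assumes J: "closure_space J" and i: "i \<in> {1..Suc n}" and t: "t \<in> pts J"
  shows "restrict (insert_coord n i t) (pts (cpower J n)) \<in> cmaps (cpower J n) (cpower J (Suc n))"
  unfolding cmaps_def
proof (intro CollectI conjI allI impI subsetI)
  show "restrict (insert_coord n i t) (pts (cpower J n)) \<in> pts (cpower J n) \<rightarrow>\<^sub>E pts (cpower J (Suc n))"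
    using insert_coord_pts i t by auto
  fix S y assume S: "S \<subseteq> pts (cpower J n)"
    and "y \<in> restrict (insert_coord n i t) (pts (cpower J n)) ` cls (cpower J n) S"
  then obtain x where x: "x \<in> cls (cpower J n) S" "x \<in> pts (cpower J n)" "y = insert_coord n i t x"
    using cls_cpower_sub by fastforce
  have "PiE {1..Suc n} V \<inter> restrict (insert_coord n i t) (pts (cpower J n)) ` S \<noteq> {}"
    if V: "\<forall>k\<in>{1..Suc n}. cnbhd J (y k) (V k)" for V
  proof -
    \<comment> \<open>The box \<open>V\<close> around \<open>y\<close> without its factor in
      direction \<open>i\<close>. Inserting \<open>t\<close> into a point of the smaller box lands
      in \<open>V\<close> again, since \<open>t\<close> belongs to its neighbourhood
      \<open>V i\<close>.\<close>
    let ?V = "\<lambda>k. V (if k < i then k else Suc k)"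
    have "cnbhd J (x k) (?V k)" if "k \<in> {1..n}" for k
      using V[rule_format, of "if k < i then k else Suc k"] that x(3) i by (auto simp: insert_coord_def split: if_splits)
    then have "PiE {1..n} ?V \<inter> S \<noteq> {}"
      using x(1) by (auto simp: cpower_def)
    then obtain s where s: "s \<in> PiE {1..n} ?V" "s \<in> S"
      by blast
    have "t \<in> V i"
      using V[rule_format, OF i] i x(3) cnbhd_self[OF J, of t "V i"] by (simp add: insert_coord_def)
    then have "insert_coord n i t s k \<in> V k" if "k \<in> {1..Suc n}" for k
    proof (cases k i rule: linorder_cases)
      case less
      then show ?thesis
        using that i PiE_mem[OF s(1), of k] by (simp add: insert_coord_def)
    next
      case greater
      then show ?thesis
        using that i PiE_mem[OF s(1), of "k - 1"] by (cases k) (simp_all add: insert_coord_def split: if_splits)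
    qed (use that in \<open>simp add: insert_coord_def\<close>)
    then have "insert_coord n i t s \<in> PiE {1..Suc n} V"
      by (auto simp: insert_coord_def PiE_iff)
    then show ?thesis
      using s(2) S by (auto intro!: image_eqI[of _ _ s])
  qed
  then show "y \<in> cls (cpower J (Suc n)) (restrict (insert_coord n i t) (pts (cpower J n)) ` S)"
    using insert_coord_pts[OF x(2) i t] x(3) by (simp add: cpower_def)
qed

locale interval =
  fixes J :: "real cspace"
  assumes J: "closure_space J" and zero_J: "0 \<in> pts J" and one_J: "1 \<in> pts J"
begin

lemma cube_face_maps_in:
  assumes "\<sigma> \<in> maps_in (cpower J (Suc n)) X A" "i \<in> {1..Suc n}" "t \<in> pts J"
  shows "cube_face J n i t \<sigma> \<in> maps_in (cpower J n) X A"
proof -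
  have "cube_face J n i t \<sigma>
      = (\<lambda>x\<in>pts (cpower J n). \<sigma> (restrict (insert_coord n i t) (pts (cpower J n)) x))"
    by (auto simp: cube_face_def)
  then have "cube_face J n i t \<sigma> \<in> cmaps (cpower J n) X"
    using cmaps_compose[OF insert_coord_cmaps[OF J assms(2,3)] _ cls_cpower_sub] assms(1)
    by (auto simp: maps_in_def)
  then show ?thesis
    using assms insert_coord_pts by (auto simp: maps_in_def cube_face_def)
qed

lemma cube_face_cube_face:
  assumes "1 \<le> i" "i \<le> j" "j \<le> Suc n" "s \<in> pts J" "t \<in> pts J"
  shows "cube_face J n j t (cube_face J (Suc n) i s \<sigma>) = cube_face J n i s (cube_face J (Suc n) (Suc j) t \<sigma>)"
  using assms insert_coord_pts
  by (auto simp: cube_face_def fun_eq_iff insert_coord_insert_coord)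

lemma cube_bd_of:
  "cube_bd J n (frag_of \<sigma>) = (\<Sum>i\<le>n. frag_cmul ((-1) ^ Suc i)
     (frag_of (cube_face J n (Suc i) 0 \<sigma>) - frag_of (cube_face J n (Suc i) 1 \<sigma>)))"
  by (simp only: cube_bd_def frag_extend_of One_nat_def sum.atLeast1_atMost_eq lessThan_Suc_atMost)

lemma cube_bd_diff: "cube_bd J n (a - b) = cube_bd J n a - cube_bd J n b"
  by (simp add: cube_bd_def frag_extend_diff)

lemma cube_bd_0: "cube_bd J n 0 = 0"
  by (simp add: cube_bd_def)

lemma cube_bd_cmul: "cube_bd J n (frag_cmul k a) = frag_cmul k (cube_bd J n a)"
  by (simp add: cube_bd_def frag_extend_cmul)

lemma cube_bd_sum: "finite I \<Longrightarrow> cube_bd J n (\<Sum>i\<in>I. f i) = (\<Sum>i\<in>I. cube_bd J n (f i))"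
  by (simp add: cube_bd_def frag_extend_sum)

lemma cube_bd_frags:
  assumes "c \<in> frags M"
    "\<And>\<sigma> i. \<sigma> \<in> M \<Longrightarrow> i \<in> {1..Suc n} \<Longrightarrow>
       frag_of (cube_face J n i 0 \<sigma>) - frag_of (cube_face J n i 1 \<sigma>) \<in> frags M'"
  shows "cube_bd J n c \<in> frags M'"
  unfolding cube_bd_def by (intro frags_extend[OF assms(1)] frags_sum frags_cmul assms(2))

lemma cube_bd_maps_in:
  "c \<in> frags (maps_in (cpower J (Suc n)) X A) \<Longrightarrow> cube_bd J n c \<in> frags (maps_in (cpower J n) X A)"
  using cube_face_maps_in[of _ n X A] zero_J one_J by (elim cube_bd_frags) (simp add: frags_diff)

lemma cube_bd_bd: "cube_bd J n (cube_bd J (Suc n) c) = 0"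
proof -
  have "c \<in> frags UNIV"
    by (simp add: frags_def)
  then show ?thesis
  proof (induction rule: frags_induct)
    case (one \<sigma>)
    let ?f = "\<lambda>i s j t. frag_of (cube_face J n (Suc j) t (cube_face J (Suc n) (Suc i) s \<sigma>))"
    \<comment> \<open>The four combinations of ends in two directions, collected into one term so
      that the cubical face identity gives the symmetry demanded by
      \<open>alternating_double_sum\<close>.\<close>
    let ?F = "\<lambda>i j. (?f i 0 j 0 - ?f i 0 j 1) - (?f i 1 j 0 - ?f i 1 j 1)"
    have "?F i j = ?F (Suc j) i" if "i \<le> j" "j \<le> n" for i j
      using that zero_J one_J by (simp add: cube_face_cube_face)
    then have "(\<Sum>i\<le>Suc n. \<Sum>j\<le>n. frag_cmul ((-1) ^ (i + j)) (?F i j)) = 0"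
      by (rule alternating_double_sum)
    moreover have "cube_bd J n (cube_bd J (Suc n) (frag_of \<sigma>))
        = (\<Sum>i\<le>Suc n. \<Sum>j\<le>n. frag_cmul ((-1) ^ (i + j)) (?F i j))"
      by (simp add: cube_bd_of cube_bd_sum cube_bd_cmul cube_bd_diff sum_subtractf[symmetric]
          frag_cmul_sum power_add frag_cmul_diff_right
          del: sum.atMost_Suc)
    ultimately show ?case
      by simp
  qed (auto simp: cube_bd_diff cube_bd_0)
qed

section \<open>Degenerate cubes and the presentation of the cubical complexes\<close>

definition degenerates :: "nat \<Rightarrow> 'a cspace \<Rightarrow> ((nat \<Rightarrow> real) \<Rightarrow> 'a) set" where
  "degenerates n X = {\<sigma> \<in> cubes J n X. degenerate_cube J n \<sigma>}"

lemma degenerates_sub: "degenerates n X \<subseteq> cubes J n X"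
  by (auto simp: degenerates_def)

lemma cubes_maps_in: "cubes J n X = maps_in (cpower J n) X (pts X)"
  by (auto simp: cubes_def maps_in_def cmaps_def)

text \<open>If \<sigma> ignores direction \<open>k\<close>, its two faces in that direction coincide
  and cancel, and every other face still ignores the direction that \<open>k\<close> becomes after
  the removal of \<open>i\<close>.\<close>

lemma cube_bd_degenerates:
  assumes "c \<in> frags (degenerates (Suc n) X)"
  shows "cube_bd J n c \<in> frags (degenerates n X)"
  using assms
proof (rule cube_bd_frags)
  fix \<sigma> i assume \<sigma>: "\<sigma> \<in> degenerates (Suc n) X" and i: "i \<in> {1..Suc n}"
  then obtain k where k: "k \<in> {1..Suc n}"
      "\<And>x t. x \<in> pts (cpower J (Suc n)) \<Longrightarrow> t \<in> pts J \<Longrightarrow> \<sigma> (x(k := t)) = \<sigma> x"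
    by (auto simp: degenerates_def degenerate_cube_def)
  show "frag_of (cube_face J n i 0 \<sigma>) - frag_of (cube_face J n i 1 \<sigma>) \<in> frags (degenerates n X)"
  proof (cases "i = k")
    case True
    have "insert_coord n k 1 x = (insert_coord n k 0 x)(k := 1)" for x
      using k(1) by (auto simp: insert_coord_def fun_eq_iff)
    then have "cube_face J n i 0 \<sigma> = cube_face J n i 1 \<sigma>"
      using k insert_coord_pts[OF _ k(1) zero_J] True one_J by (auto simp: cube_face_def)
    then show ?thesis
      by simp
  next
    case False
    let ?k = "if k < i then k else k - 1"
    have k': "?k \<in> {1..n}"
      using k(1) i False by auto
    have "cube_face J n i s \<sigma> \<in> degenerates n X" if s: "s \<in> pts J" for s
    proof -
      have ins: "insert_coord n i s (x(?k := t)) = (insert_coord n i s x)(k := t)" for x t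
        using k(1) i False by (auto simp: insert_coord_def fun_eq_iff)
      have "cube_face J n i s \<sigma> (x(?k := t)) = cube_face J n i s \<sigma> x"
        if x: "x \<in> pts (cpower J n)" and t: "t \<in> pts J" for x t
        using cpower_update[OF x k' t] x k(2)[OF insert_coord_pts[OF x i s] t]
        by (simp only: cube_face_def ins restrict_apply' if_True)
      then have "degenerate_cube J n (cube_face J n i s \<sigma>)"
        using k' unfolding degenerate_cube_def by blast
      then show ?thesis
        using \<sigma> cube_face_maps_in[OF _ i s, of \<sigma> X "pts X"] by (auto simp: degenerates_def cubes_maps_in)
    qed
    then show ?thesis
      using zero_J one_J by (intro frags_diff) auto
  qed
qed

definition nondeg_class :: "'a cspace \<Rightarrow> nat \<Rightarrow> (((nat \<Rightarrow> real) \<Rightarrow> 'a) \<Rightarrow>\<^sub>0 int) \<Rightarrow> (((nat \<Rightarrow> real) \<Rightarrow> 'a) \<Rightarrow>\<^sub>0 int) set"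
  where "nondeg_class X n x = frags (degenerates n X) #>\<^bsub>free_Abelian_group (cubes J n X)\<^esub> x"

definition rel_class ::
    "'a cspace \<Rightarrow> 'a set \<Rightarrow> nat \<Rightarrow> (((nat \<Rightarrow> real) \<Rightarrow> 'a) \<Rightarrow>\<^sub>0 int) \<Rightarrow> (((nat \<Rightarrow> real) \<Rightarrow> 'a) \<Rightarrow>\<^sub>0 int) set set"
  where "rel_class X A n x = cubical_subchains J X A n #>\<^bsub>chains (cubical_cplx J X) n\<^esub> nondeg_class X n x"

lemma degenerate_chains_eq: "degenerate_chains J X n = frags (degenerates n X)"
  using generate_frag_of[OF degenerates_sub] by (simp add: degenerate_chains_def degenerates_def cube_cplx_def)

lemma presentation_cube_cplx:
  "presentation (cube_cplx J X) (\<lambda>n. cubes J n X) (\<lambda>n. {}) (cube_bd J) (\<lambda>n x. x)"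
  using cube_bd_maps_in[of _ _ X "pts X"]
  by (intro presentation.intro)
     (auto simp: cube_cplx_def cube_bd_diff cube_bd_0 cube_bd_bd cubes_maps_in
        abelian_free_Abelian_group hom_def)

lemma presentation_cubical_cplx:
  "presentation (cubical_cplx J X) (\<lambda>n. cubes J n X) (\<lambda>n. degenerates n X) (cube_bd J) (nondeg_class X)"
  using presentation_quotient[OF presentation_cube_cplx[of X],
      of "\<lambda>n. degenerates n X" "\<lambda>n. frags (degenerates n X)", OF degenerates_sub cube_bd_degenerates]
  by (simp add: cubical_cplx_def degenerate_chains_eq[abs_def] nondeg_class_def[abs_def])
     (simp add: cube_cplx_def)

lemma cubes_subcspace: "A \<subseteq> pts X \<Longrightarrow> cubes J n (subcspace X A) = maps_in (cpower J n) X A"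
  using cmaps_subcspace[OF _ cls_cpower_sub, of A X] by (simp add: cubes_def maps_in_def)

lemma cubical_incl_nondeg_class:
  assumes "A \<subseteq> pts X" "x \<in> frags (maps_in (cpower J n) X A)"
  shows "cubical_incl J X n (nondeg_class (subcspace X A) n x) = nondeg_class X n x"
proof -
  have sub: "maps_in (cpower J n) X A \<subseteq> cubes J n X"
    unfolding cubes_def by (rule maps_in_sub)
  have id: "id \<in> hom (free_Abelian_group (maps_in (cpower J n) X A)) (free_Abelian_group (cubes J n X))"
    using frags_mono[OF _ sub] by (intro homI) auto
  have D: "degenerates n (subcspace X A) \<subseteq> degenerates n X"
    "degenerates n (subcspace X A) \<subseteq> maps_in (cpower J n) X A"
    using sub by (auto simp: degenerates_def cubes_subcspace[OF assms(1)])
  show ?thesis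
    using coset_map_r_coset[OF id, of "frags (degenerates n (subcspace X A))" "frags (degenerates n X)" x]
      assms(2) subsetI[OF frags_mono[OF _ D(1)]]
    by (simp add: cubical_incl_def nondeg_class_def degenerate_chains_eq cube_cplx_def
        cubes_subcspace[OF assms(1)] subgroup_frags D degenerates_sub)
qed

lemma cubical_subchains_eq:
  assumes "A \<subseteq> pts X"
  shows "cubical_subchains J X A n = nondeg_class X n ` frags (maps_in (cpower J n) X A)"
proof -
  interpret P: presentation "cubical_cplx J (subcspace X A)" "\<lambda>n. cubes J n (subcspace X A)"
    "\<lambda>n. degenerates n (subcspace X A)" "cube_bd J" "nondeg_class (subcspace X A)"
    by (rule presentation_cubical_cplx)
  show ?thesis
    using cubical_incl_nondeg_class[OF assms]
    by (force simp: cubical_subchains_def P.\<pi>_surj cubes_subcspace[OF assms])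
qed

lemma presentation_cubical_rel_cplx:
  assumes "A \<subseteq> pts X"
  shows "presentation (cubical_rel_cplx J X A) (\<lambda>n. cubes J n X)
    (\<lambda>n. degenerates n X \<union> maps_in (cpower J n) X A) (cube_bd J) (rel_class X A)"
  using presentation_quotient[OF presentation_cubical_cplx[of X],
      of "\<lambda>n. maps_in (cpower J n) X A" "cubical_subchains J X A",
      OF maps_in_sub[of "cpower J _" X A, folded cubes_def] cube_bd_maps_in cubical_subchains_eq[OF assms]]
  by (simp add: cubical_rel_cplx_def rel_class_def[abs_def])

lemma cubical_excision:
  assumes A: "A \<subseteq> pts X" and B: "B \<subseteq> pts X" and G: "comm_group G"
    and acyclic: "acyclic_mod (\<lambda>n. cubes J n X)
      (\<lambda>n. degenerates n X \<union> maps_in (cpower J n) X A \<union> maps_in (cpower J n) X B) (cube_bd J)"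
  shows "cubical_incl_iso J n B (A \<inter> B) X A G"
proof -
  let ?m = "\<lambda>n. maps_in (cpower J n) X"
  let ?Y = "subcspace X B"
  note W = cubes_subcspace[OF B]
  have AB: "A \<inter> B \<subseteq> pts ?Y"
    by (simp add: subcspace_def)
  have mAB: "maps_in (cpower J n) ?Y (A \<inter> B) = ?m n A \<inter> ?m n B" for n
    using W[of n] by (auto simp: maps_in_def cubes_def)
  have deg: "degenerates n ?Y = degenerates n X \<inter> ?m n B" for n
    using maps_in_sub[of "cpower J n" X B] by (auto simp: degenerates_def W) (auto simp: cubes_def)
  \<comment> \<open>Degeneracy does not refer to the target space, so the kernel for the pair
    \<open>(B, A \<inter> B)\<close> has the shape required by \<open>excision_pair\<close>.\<close>
  have T': "degenerates n ?Y \<union> maps_in (cpower J n) ?Y (A \<inter> B) = (degenerates n X \<union> ?m n A) \<inter> ?m n B" for n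
    unfolding mAB deg by blast
  have sub: "?m n B \<subseteq> cubes J n X" for n
    unfolding cubes_def by (rule maps_in_sub)
  have P': "presentation (cubical_rel_cplx J ?Y (A \<inter> B)) (\<lambda>n. ?m n B)
    (\<lambda>n. (degenerates n X \<union> ?m n A) \<inter> ?m n B) (cube_bd J) (rel_class ?Y (A \<inter> B))"
    using presentation_cubical_rel_cplx[OF AB] by (simp add: W T')
  have C': "presentation (cubical_cplx J ?Y) (\<lambda>n. ?m n B) (\<lambda>n. degenerates n ?Y) (cube_bd J) (nondeg_class ?Y)"
    using presentation_cubical_cplx[of ?Y] by (simp add: W)
  interpret C: presentation "cubical_cplx J X" "\<lambda>n. cubes J n X" "\<lambda>n. degenerates n X" "cube_bd J" "nondeg_class X"
    by (rule presentation_cubical_cplx)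
  interpret C': presentation "cubical_cplx J ?Y" "\<lambda>n. ?m n B" "\<lambda>n. degenerates n ?Y" "cube_bd J" "nondeg_class ?Y"
    by (rule C')
  have "excision_pair (cubical_rel_cplx J X A) (\<lambda>n. cubes J n X) (\<lambda>n. degenerates n X \<union> ?m n A)
    (cube_bd J) (rel_class X A) (cubical_rel_cplx J ?Y (A \<inter> B)) (\<lambda>n. ?m n B) (rel_class ?Y (A \<inter> B))
    (cubical_rel_incl J X A) G"
  proof (rule excision_pair.intro[OF presentation_cubical_rel_cplx[OF A] P' excision_pair_axioms.intro])
    show "?m n B \<subseteq> cubes J n X" for n
      by (rule sub)
    show "acyclic_mod (\<lambda>n. cubes J n X) (\<lambda>n. degenerates n X \<union> ?m n A \<union> ?m n B) (cube_bd J)"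
      by (rule acyclic)
    show "cubical_rel_incl J X A n (rel_class ?Y (A \<inter> B) n x) = rel_class X A n x"
      if x: "x \<in> frags (?m n B)" for n x
    proof -
      have incl: "cubical_incl J X n (nondeg_class ?Y n x) = nondeg_class X n x" if "x \<in> frags (?m n B)" for x
        using cubical_incl_nondeg_class[OF B that] .
      have hom: "cubical_incl J X n \<in> hom (chains (cubical_cplx J ?Y) n) (chains (cubical_cplx J X) n)"
        by (rule presentation_map_hom[OF C.presentation_axioms C' sub incl])
      have N': "subgroup (cubical_subchains J ?Y (A \<inter> B) n) (chains (cubical_cplx J ?Y) n)"
        unfolding cubical_subchains_eq[OF AB] mAB by (rule C'.subgroup_image) simp
      have N: "subgroup (cubical_subchains J X A n) (chains (cubical_cplx J X) n)"
        unfolding cubical_subchains_eq[OF A] by (rule C.subgroup_image) (simp add: cubes_def maps_in_sub)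
      have img: "cubical_incl J X n ` cubical_subchains J ?Y (A \<inter> B) n \<subseteq> cubical_subchains J X A n"
        unfolding cubical_subchains_eq[OF AB] cubical_subchains_eq[OF A] mAB
        using incl by (auto simp: frags_Int)
      show ?thesis
        unfolding cubical_rel_incl_def rel_class_def
        using coset_map_r_coset[OF hom C'.group_chains C.group_chains N' N img C'.\<pi>_carrier[OF x]]
        by (simp add: incl[OF x])
    qed
  qed (rule G)
  then show ?thesis
    unfolding cubical_incl_iso_def cubical_cohomology_def
    by (rule excision_pair.cohomology_map_iso)
qed

text \<open>The vertex with all coordinates 1 has the whole cube as its only neighbourhood. For
  \<open>int_Jplus\<close> the choice of 1 matters: it lies in the closure of 0, whereas 0 has the
  neighbourhood {0}.\<close>

lemma cubical_excision_generic:
  assumes X: "closure_space X" and G: "comm_group G" and cov: "interior_cover X {A, B}"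
    and generic: "\<And>V. cnbhd J 1 V \<Longrightarrow> V = pts J"
  shows "cubical_incl_iso J n B (A \<inter> B) X A G"
proof (rule cubical_excision[OF _ _ G])
  show "acyclic_mod (\<lambda>n. cubes J n X)
      (\<lambda>n. degenerates n X \<union> maps_in (cpower J n) X A \<union> maps_in (cpower J n) X B) (cube_bd J)"
  proof (rule acyclic_mod_trivial)
    fix n :: nat
    let ?p = "\<lambda>i\<in>{1..n}. 1 :: real"
    have "?p \<in> pts (cpower J n)"
      using one_J by (auto simp: pts_cpower)
    moreover have "?p \<in> cls (cpower J n) {q}" if q: "q \<in> pts (cpower J n)" for q
    proof -
      have "q \<in> PiE {1..n} V" if V: "\<forall>i\<in>{1..n}. cnbhd J (?p i) (V i)" for V
      proof -
        have "V i = pts J" if "i \<in> {1..n}" for i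
          using V that by (intro generic) auto
        then show ?thesis
          using q by (simp add: pts_cpower PiE_iff)
      qed
      then show ?thesis
        using one_J by (auto simp: cpower_def)
    qed
    ultimately have "cubes J n X \<subseteq> maps_in (cpower J n) X A \<union> maps_in (cpower J n) X B"
      using interior_cover_generic_point[OF X cov, of ?p "cpower J n"] by (auto simp: maps_in_def cubes_def)
    then show "cubes J n X \<subseteq> degenerates n X \<union> maps_in (cpower J n) X A \<union> maps_in (cpower J n) X B"
      by blast
  qed (rule cube_bd_0)
qed (use interior_cover_sub[OF cov] in auto)

end

lemma interval_J1: "interval int_J1"
  by unfold_locales (auto simp: int_J1_def indiscrete_cspace_def closure_space_def)

lemma interval_Jplus: "interval int_Jplus"
  by unfold_locales (auto simp: int_Jplus_def upset_cspace_def closure_space_def)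

lemma cubical_excision_J1:
  assumes "closure_space X" "comm_group G" "interior_cover X {A, B}"
  shows "cubical_incl_iso int_J1 n B (A \<inter> B) X A G"
  by (rule interval.cubical_excision_generic[OF interval_J1 assms])
     (auto simp: cnbhd_def cinterior_def int_J1_def indiscrete_cspace_def split: if_splits)

lemma cubical_excision_Jplus:
  assumes "closure_space X" "comm_group G" "interior_cover X {A, B}"
  shows "cubical_incl_iso int_Jplus n B (A \<inter> B) X A G"
  by (rule interval.cubical_excision_generic[OF interval_Jplus assms])
     (auto simp: cnbhd_def cinterior_def int_Jplus_def upset_cspace_def split: if_splits,
      metis DiffI insertI1 zero_le_one)

section \<open>The unit interval\<close>

lemma pts_int_I: "pts int_I = {0..1}"
  by (simp add: int_I_def top_cspace_def)

lemma cls_int_I: "S \<subseteq> {0..1} \<Longrightarrow> cls int_I S = {0..1} \<inter> closure S"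
  by (simp add: int_I_def top_cspace_def closure_of_subtopology Int_absorb1)

lemma interval_I: "interval int_I"
proof
  have "S \<subseteq> cls int_I S \<and> cls int_I S \<subseteq> {0..1}" if "S \<subseteq> {0..1}" for S
    using that closure_subset[of S] by (auto simp: cls_int_I)
  moreover have "cls int_I (S \<union> T) = cls int_I S \<union> cls int_I T" if "S \<subseteq> {0..1}" "T \<subseteq> {0..1}" for S T
    using that by (auto simp: cls_int_I closure_Un)
  moreover have "cls int_I {} = {}"
    by (simp add: cls_int_I)
  ultimately show "closure_space int_I"
    unfolding closure_space_def pts_int_I by blast
qed (auto simp: pts_int_I)

interpretation I: interval int_I
  by (rule interval_I)

lemma cnbhd_int_I:
  "cnbhd int_I x V \<longleftrightarrow> V \<subseteq> {0..1} \<and> x \<in> {0..1} \<and> (\<exists>e>0. \<forall>y\<in>{0..1}. \<bar>y - x\<bar> < e \<longrightarrow> y \<in> V)"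
proof -
  have "cls int_I ({0..1} - V) = {0..1} \<inter> closure ({0..1} - V)"
    by (rule cls_int_I) auto
  then show ?thesis
    unfolding cnbhd_def cinterior_def pts_int_I
    by (auto simp: closure_approachable dist_real_def)
qed

abbreviation cube :: "nat \<Rightarrow> (nat \<Rightarrow> real) set" where
  "cube n \<equiv> pts (cpower int_I n)"

lemma cube_iff: "x \<in> cube n \<longleftrightarrow> (\<forall>i\<in>{1..n}. 0 \<le> x i \<and> x i \<le> 1) \<and> (\<forall>i. i \<notin> {1..n} \<longrightarrow> x i = undefined)"
  by (auto simp: pts_cpower pts_int_I PiE_iff extensional_def)

text \<open>There are finitely many coordinates, so one radius serves for a whole box of
  neighbourhoods. Later continuity arguments on the cube rest on this description by the maximum
  metric.\<close>

lemma cls_cube_iff: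
  assumes "S \<subseteq> cube n" "x \<in> cube n"
  shows "x \<in> cls (cpower int_I n) S \<longleftrightarrow> (\<forall>e>0. \<exists>s\<in>S. \<forall>i\<in>{1..n}. \<bar>s i - x i\<bar> < e)"
proof
  assume x: "x \<in> cls (cpower int_I n) S"
  show "\<forall>e>0. \<exists>s\<in>S. \<forall>i\<in>{1..n}. \<bar>s i - x i\<bar> < e"
  proof (intro allI impI)
    fix e :: real assume e: "e > 0"
    let ?U = "\<lambda>i. {t \<in> {0..1}. \<bar>t - x i\<bar> < e}"
    have "cnbhd int_I (x i) (?U i)" if "i \<in> {1..n}" for i
      using that assms(2) e by (auto simp: cnbhd_int_I cube_iff)
    then have "PiE {1..n} ?U \<inter> S \<noteq> {}"
      using x unfolding cpower_def by auto
    then show "\<exists>s\<in>S. \<forall>i\<in>{1..n}. \<bar>s i - x i\<bar> < e"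
      by (auto simp: PiE_iff)
  qed
next
  assume *: "\<forall>e>0. \<exists>s\<in>S. \<forall>i\<in>{1..n}. \<bar>s i - x i\<bar> < e"
  have "PiE {1..n} U \<inter> S \<noteq> {}" if "\<forall>i\<in>{1..n}. cnbhd int_I (x i) (U i)" for U
  proof -
    from that have "\<forall>i\<in>{1..n}. \<exists>e>0. \<forall>y\<in>{0..1}. \<bar>y - x i\<bar> < e \<longrightarrow> y \<in> U i"
      by (simp add: cnbhd_int_I)
    then obtain e where e: "\<And>i. i \<in> {1..n} \<Longrightarrow> e i > 0"
        "\<And>i y. i \<in> {1..n} \<Longrightarrow> y \<in> {0..1} \<Longrightarrow> \<bar>y - x i\<bar> < e i \<Longrightarrow> y \<in> U i"
      by metis
    \<comment> \<open>The extra 1 keeps the minimum defined when \<open>n = 0\<close>.\<close>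
    let ?E = "Min (insert 1 (e ` {1..n}))"
    have "?E > 0"
      using e(1) by (subst Min_gr_iff) auto
    then obtain s where s: "s \<in> S" "\<And>i. i \<in> {1..n} \<Longrightarrow> \<bar>s i - x i\<bar> < ?E"
      using * by blast
    have "?E \<le> e i" if "i \<in> {1..n}" for i
      using that by (intro Min_le) auto
    then have "s i \<in> U i" if "i \<in> {1..n}" for i
      using e(2)[OF that, of "s i"] s that assms(1) by (force simp: cube_iff)
    moreover have "s \<in> extensional {1..n}"
      using s(1) assms(1) unfolding pts_cpower PiE_def by blast
    ultimately show ?thesis
      using s(1) unfolding PiE_iff disjoint_iff by blast
  qed
  then show "x \<in> cls (cpower int_I n) S"
    using assms(2) by (simp add: cpower_def)
qed

text \<open>One further subsequence is taken for each coordinate, starting from the sequential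
  compactness of the interval.\<close>

lemma convergent_subsequence:
  fixes X :: "nat \<Rightarrow> nat \<Rightarrow> real"
  assumes "\<And>N i. i \<in> {1..n} \<Longrightarrow> X N i \<in> {0..1}"
  shows "\<exists>r l. strict_mono (r :: nat \<Rightarrow> nat) \<and> (\<forall>i\<in>{1..n}. (\<lambda>N. X (r N) i) \<longlonglongrightarrow> l i)"
  using assms
proof (induction n)
  case 0
  show ?case
    by (intro exI[of _ id] exI[of _ undefined]) (auto simp: strict_mono_def)
next
  case (Suc n)
  then obtain r l where r: "strict_mono r" "\<And>i. i \<in> {1..n} \<Longrightarrow> (\<lambda>N. X (r N) i) \<longlonglongrightarrow> l i"
    by (metis atLeastAtMost_iff le_SucI)
  have "\<forall>N. X (r N) (Suc n) \<in> {0..1}"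
    using Suc.prems by simp
  then obtain t r' where r': "strict_mono r'" "((\<lambda>N. X (r N) (Suc n)) \<circ> r') \<longlonglongrightarrow> t"
    using compact_imp_seq_compact[OF compact_Icc, of "0::real" 1] unfolding seq_compact_def by metis
  have "(\<lambda>N. X ((r \<circ> r') N) i) \<longlonglongrightarrow> (l(Suc n := t)) i" if "i \<in> {1..Suc n}" for i
  proof (cases "i = Suc n")
    case True
    then show ?thesis
      using r'(2) by (simp add: o_def)
  next
    case False
    then show ?thesis
      using LIMSEQ_subseq_LIMSEQ[OF r(2) r'(1), of i] that by (simp add: o_def)
  qed
  then show ?case
    using strict_mono_o[OF r(1) r'(1)] by blast
qed

text \<open>Otherwise \<open>l\<close> is in the closure of the points that \<sigma> sends outside
  \<open>V\<close>, and continuity puts \<open>\<sigma> l\<close> into the closure of the complement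
  of \<open>V\<close>.\<close>

lemma cube_nbhd_preimage:
  assumes X: "closure_space X" and \<sigma>: "\<sigma> \<in> cubes int_I n X" and l: "l \<in> cube n"
    and V: "\<sigma> l \<in> cinterior X V"
  obtains e where "e > 0" "\<And>y. y \<in> cube n \<Longrightarrow> (\<And>i. i \<in> {1..n} \<Longrightarrow> \<bar>y i - l i\<bar> < e) \<Longrightarrow> \<sigma> y \<in> V"
proof -
  let ?P = "{y \<in> cube n. \<sigma> y \<notin> V}"
  have "l \<notin> cls (cpower int_I n) ?P"
  proof
    assume "l \<in> cls (cpower int_I n) ?P"
    moreover have "\<sigma> ` cls (cpower int_I n) ?P \<subseteq> cls X (\<sigma> ` ?P)"
      using \<sigma> by (simp add: cubes_def cmaps_def subset_eq[of ?P])
    moreover have "cls X (\<sigma> ` ?P) \<subseteq> cls X (pts X - V)"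
      using \<sigma> by (intro cls_mono[OF X]) (auto simp: cubes_def cmaps_def)
    ultimately show False
      using V by (auto simp: cinterior_def)
  qed
  then obtain e where "e > 0" "\<not> (\<exists>s\<in>?P. \<forall>i\<in>{1..n}. \<bar>s i - l i\<bar> < e)"
    using cls_cube_iff[of ?P n l] l by auto
  then show ?thesis
    by (intro that[of e]) auto
qed

text \<open>The preimages of \<open>A\<close> and \<open>B\<close> are not open in general, so a
  neighbourhood of a single point has to suffice: ever smaller bad sets accumulate at some
  \<open>l\<close>, and a neighbourhood of \<open>l\<close> that goes into \<open>A\<close> or
  \<open>B\<close> swallows one of them.\<close>

lemma cube_Lebesgue_number:
  assumes X: "closure_space X" and cov: "interior_cover X {A, B}" and \<sigma>: "\<sigma> \<in> cubes int_I n X"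
  shows "\<exists>\<delta>>0. \<forall>Q. Q \<subseteq> cube n \<longrightarrow> (\<forall>x\<in>Q. \<forall>y\<in>Q. \<forall>i\<in>{1..n}. \<bar>x i - y i\<bar> < \<delta>)
       \<longrightarrow> \<sigma> ` Q \<subseteq> A \<or> \<sigma> ` Q \<subseteq> B"
proof (rule ccontr)
  assume neg: "\<not> ?thesis"
  define D where "D \<delta> Q \<longleftrightarrow> (\<forall>x\<in>Q. \<forall>y\<in>Q. \<forall>i\<in>{1..n}. \<bar>x i - y i\<bar> < \<delta>)"
    for \<delta> :: real and Q :: "(nat \<Rightarrow> real) set"
  have "\<exists>Q. Q \<subseteq> cube n \<and> D (1 / real (Suc N)) Q \<and> \<not> \<sigma> ` Q \<subseteq> A \<and> \<not> \<sigma> ` Q \<subseteq> B" for N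
    using neg[folded D_def] by (auto dest: spec[of _ "1 / real (Suc N)"])
  then obtain Q where Q': "\<And>N. Q N \<subseteq> cube n \<and> D (1 / real (Suc N)) (Q N) \<and>
      \<not> \<sigma> ` Q N \<subseteq> A \<and> \<not> \<sigma> ` Q N \<subseteq> B"
    by metis
  then have Q: "\<And>N. Q N \<subseteq> cube n" "\<And>N. \<not> \<sigma> ` Q N \<subseteq> A" "\<And>N. \<not> \<sigma> ` Q N \<subseteq> B"
    by simp_all
  have Q_small: "\<bar>x i - y i\<bar> < 1 / real (Suc N)" if "x \<in> Q N" "y \<in> Q N" "i \<in> {1..n}" for N x y i
    using Q'[of N] that unfolding D_def by blast
  have "\<exists>x. x \<in> Q N" for N
    using Q(2)[of N] by auto
  then obtain x where x: "\<And>N. x N \<in> Q N"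
    by metis
  then have x01: "x N i \<in> {0..1}" if "i \<in> {1..n}" for N i
    using subsetD[OF Q(1) x, of N] that by (simp add: cube_iff)
  obtain r l where r: "strict_mono r" "\<And>i. i \<in> {1..n} \<Longrightarrow> (\<lambda>N. x (r N) i) \<longlonglongrightarrow> l i"
    using convergent_subsequence[of n x] x01 by metis
  let ?l = "\<lambda>i\<in>{1..n}. l i"
  have "l i \<in> {0..1}" if "i \<in> {1..n}" for i
    using closed_sequentially[OF closed_atLeastAtMost _ r(2)[OF that], of 0 1] x01 that by simp
  then have l: "?l \<in> cube n"
    by (auto simp: cube_iff)
  then have "\<sigma> ?l \<in> cinterior X A \<union> cinterior X B"
    using cov \<sigma> by (auto simp: interior_cover_def cubes_def cmaps_def)
  then obtain V where V: "V = A \<or> V = B" "\<sigma> ?l \<in> cinterior X V"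
    by blast
  obtain e where e: "e > 0"
      "\<And>y. y \<in> cube n \<Longrightarrow> (\<And>i. i \<in> {1..n} \<Longrightarrow> \<bar>y i - ?l i\<bar> < e) \<Longrightarrow> \<sigma> y \<in> V"
    using cube_nbhd_preimage[OF X \<sigma> l V(2)] by blast
  have "eventually (\<lambda>N. \<forall>i\<in>{1..n}. \<bar>x (r N) i - l i\<bar> < e / 2) sequentially"
    using tendstoD[OF r(2), of _ "e / 2"] e(1) unfolding dist_real_def
    by (intro eventually_ball_finite ballI) simp_all
  moreover have "eventually (\<lambda>N. 1 / real (Suc N) < e / 2) sequentially"
    using e(1) LIMSEQ_inverse_real_of_nat[THEN tendstoD, of "e / 2"] by (simp add: dist_real_def inverse_eq_divide)
  ultimately have "eventually (\<lambda>N. (\<forall>i\<in>{1..n}. \<bar>x (r N) i - l i\<bar> < e / 2) \<and> 1 / real (Suc N) < e / 2) sequentially"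
    by (rule eventually_conj)
  then obtain N where N: "\<And>i. i \<in> {1..n} \<Longrightarrow> \<bar>x (r N) i - l i\<bar> < e / 2" "1 / real (Suc N) < e / 2"
    using eventually_happens'[OF sequentially_bot] by blast
  \<comment> \<open>A strictly increasing \<open>r\<close> satisfies \<open>N \<le> r N\<close>, so
    half of \<open>e\<close> is left for the size of \<open>Q (r N)\<close> and half for the
    distance to the limit.\<close>
  have "1 / real (Suc (r N)) \<le> 1 / real (Suc N)"
    using seq_suble[OF r(1), of N] by (intro divide_left_mono) auto
  then have rN: "1 / real (Suc (r N)) < e / 2"
    using N(2) by linarith
  have "\<sigma> y \<in> V" if y: "y \<in> Q (r N)" for y
  proof (rule e(2))
    show "y \<in> cube n"
      using y Q(1) by blast
    show "\<bar>y i - ?l i\<bar> < e" if i: "i \<in> {1..n}" for i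
    proof -
      have "\<bar>y i - x (r N) i\<bar> < e / 2" "\<bar>x (r N) i - l i\<bar> < e / 2"
        using Q_small[OF y x i] rN N(1)[OF i] by linarith+
      then have "\<bar>y i - l i\<bar> < e"
        by linarith
      then show ?thesis
        using i by simp
    qed
  qed
  then show False
    using V(1) Q(2,3)[of "r N"] by blast
qed

section \<open>Words of maps of the interval\<close>

text \<open>
  A word denotes the product of the maps denoted by its letters, each of which maps a cube of
  dimension 0, 1 or 2 to the interval. Its boundary is governed by the Leibniz rule, so that the
  chain homotopy between the identity and the subdivision of the \<open>n\<close>-cube can be built letter by
  letter from \<open>Sq\<close>, a square whose faces are the two halves of the interval (\<open>Lo\<close>, \<open>Hi\<close>), the
  whole interval, and a constant.
\<close>

datatype letter = Lid | Lo | Hi | Sq | Deg | Cst real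

fun ldim :: "letter \<Rightarrow> nat" where
  "ldim Sq = 2"
| "ldim (Cst c) = 0"
| "ldim _ = 1"

text \<open>The value at \<open>Sq\<close> is the straight-line homotopy in \<open>t\<close> from
  the identity of \<open>s\<close> to the upper half \<open>(1 + s) / 2\<close>. Its ends in the
  other direction are the lower half \<open>t / 2\<close> at \<open>s = 0\<close> and the constant 1
  at \<open>s = 1\<close>.\<close>

fun lval :: "letter \<Rightarrow> real \<Rightarrow> real \<Rightarrow> real" where
  "lval Lid t s = t"
| "lval Lo t s = t / 2"
| "lval Hi t s = (1 + t) / 2"
| "lval Sq t s = s + t / 2 * (1 - s)"
| "lval Deg t s = 1"
| "lval (Cst c) t s = c"

fun lface :: "letter \<Rightarrow> nat \<Rightarrow> real \<Rightarrow> letter" where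
  "lface Lid i e = Cst e"
| "lface Lo i e = Cst (e / 2)"
| "lface Hi i e = Cst ((1 + e) / 2)"
| "lface Sq i e = (if i = 1 then if e = 0 then Lid else Hi else if e = 0 then Lo else Deg)"
| "lface Deg i e = Cst 1"
| "lface (Cst c) i e = Cst c"

type_synonym word = "letter list"

fun wdim :: "word \<Rightarrow> nat" where
  "wdim [] = 0"
| "wdim (l # w) = ldim l + wdim w"

fun wface :: "word \<Rightarrow> nat \<Rightarrow> real \<Rightarrow> word" where
  "wface [] i e = []"
| "wface (l # w) i e = (if i \<le> ldim l then lface l i e # w else l # wface w (i - ldim l) e)"

text \<open>The leading letter reads the first variables and the rest of the word reads those after
  them. Coordinates beyond the word are \<open>undefined\<close> because points of cubes are
  extensional.\<close>

fun ev :: "word \<Rightarrow> (nat \<Rightarrow> real) \<Rightarrow> nat \<Rightarrow> real" where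
  "ev [] x j = undefined"
| "ev (l # w) x j =
     (if j = 0 then undefined else if j = 1 then lval l (x 1) (x 2)
      else ev w (\<lambda>i. x (i + ldim l)) (j - 1))"

definition admissible :: "word \<Rightarrow> bool" where
  "admissible w \<longleftrightarrow> (\<forall>c. Cst c \<in> set w \<longrightarrow> 0 \<le> c \<and> c \<le> 1)"

lemma admissible_Nil [simp]: "admissible []"
  by (simp add: admissible_def)

lemma admissible_Cons: "admissible (l # w) \<longleftrightarrow> (\<forall>c. l = Cst c \<longrightarrow> 0 \<le> c \<and> c \<le> 1) \<and> admissible w"
  by (auto simp: admissible_def)

lemma lval_cong:
  assumes "\<And>i. i \<in> {1..ldim l} \<Longrightarrow> x i = y i"
  shows "lval l (x 1) (x 2) = lval l (y 1) (y 2)"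
  using assms by (cases l) auto

lemma ev_cong:
  assumes "\<And>i. i \<in> {1..wdim w} \<Longrightarrow> x i = y i"
  shows "ev w x j = ev w y j"
  using assms
proof (induction w arbitrary: x y j)
  case (Cons l w)
  have "lval l (x 1) (x 2) = lval l (y 1) (y 2)"
    using Cons.prems by (intro lval_cong) auto
  moreover have "ev w (\<lambda>i. x (i + ldim l)) (j - 1) = ev w (\<lambda>i. y (i + ldim l)) (j - 1)"
    using Cons.prems by (intro Cons.IH) auto
  ultimately show ?case
    by simp
qed simp

lemma ev_undefined: "j \<notin> {1..length w} \<Longrightarrow> ev w x j = undefined"
proof (induction w arbitrary: x j)
  case (Cons l w)
  have "ev w (\<lambda>i. x (i + ldim l)) (j - 1) = undefined" if "j \<noteq> 0"
    using that Cons.prems by (intro Cons.IH) auto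
  then show ?case
    using Cons.prems by auto
qed simp

lemma Sq_bounds: "0 \<le> t \<Longrightarrow> t \<le> 1 \<Longrightarrow> 0 \<le> s \<Longrightarrow> s \<le> 1 \<Longrightarrow> 0 \<le> s + t / 2 * (1 - s) \<and> s + t / 2 * (1 - s) \<le> (1 :: real)"
  using mult_right_mono[of "t / 2" 1 "1 - s"] by (auto intro!: add_nonneg_nonneg)

lemma ev_bounds:
  assumes "admissible w" "\<And>i. i \<in> {1..wdim w} \<Longrightarrow> 0 \<le> x i \<and> x i \<le> 1" "j \<in> {1..length w}"
  shows "0 \<le> ev w x j \<and> ev w x j \<le> 1"
  using assms
proof (induction w arbitrary: x j)
  case (Cons l w)
  have x: "0 \<le> x i" "x i \<le> 1" if "1 \<le> i" "i \<le> ldim l" for i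
    using Cons.prems(2)[of i] that by auto
  have "0 \<le> lval l (x 1) (x 2) \<and> lval l (x 1) (x 2) \<le> 1"
    using x[of 1] x[of 2] Cons.prems(1) Sq_bounds by (cases l) (auto simp: admissible_Cons)
  moreover have "0 \<le> ev w (\<lambda>i. x (i + ldim l)) (j - 1) \<and> ev w (\<lambda>i. x (i + ldim l)) (j - 1) \<le> 1" if "j \<noteq> 1"
    using Cons.prems that by (intro Cons.IH) (auto simp: admissible_Cons)
  ultimately show ?case
    using Cons.prems by simp
qed simp

lemma ev_cube: "admissible w \<Longrightarrow> x \<in> cube (wdim w) \<Longrightarrow> ev w x \<in> cube (length w)"
  using ev_bounds[of w x] ev_undefined[of _ w x] by (simp add: cube_iff)

text \<open>The factor 2 counts the two arguments of \<open>Sq\<close>, each of which contributes at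
  most \<delta>.\<close>

lemma lval_Lipschitz:
  assumes "0 \<le> t" "t \<le> 1" "0 \<le> s'" "s' \<le> 1" "\<bar>t - t'\<bar> \<le> \<delta>" "\<bar>s - s'\<bar> \<le> \<delta>"
  shows "\<bar>(s + t / 2 * (1 - s)) - (s' + t' / 2 * (1 - s'))\<bar> \<le> 2 * (\<delta> :: real)"
proof -
  have "(s + t / 2 * (1 - s)) - (s' + t' / 2 * (1 - s'))
      = (s - s') * (1 - t / 2) + (t - t') * ((1 - s') / 2)"
    by (simp add: field_simps)
  also have "\<bar>\<dots>\<bar> \<le> \<bar>s - s'\<bar> * \<bar>1 - t / 2\<bar> + \<bar>t - t'\<bar> * \<bar>(1 - s') / 2\<bar>"
    by (metis abs_mult abs_triangle_ineq)
  also have "\<dots> \<le> \<delta> * 1 + \<delta> * 1"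
    using assms by (intro add_mono mult_mono) auto
  finally show ?thesis
    by simp
qed

text \<open>Each coordinate of the value depends on the variables of one letter, so the constant
  does not grow with the length of the word.\<close>

lemma ev_Lipschitz:
  assumes "\<And>i. i \<in> {1..wdim w} \<Longrightarrow> 0 \<le> x i \<and> x i \<le> 1" "\<And>i. i \<in> {1..wdim w} \<Longrightarrow> 0 \<le> y i \<and> y i \<le> 1"
    "\<And>i. i \<in> {1..wdim w} \<Longrightarrow> \<bar>x i - y i\<bar> \<le> \<delta>" "\<delta> \<ge> 0"
  shows "\<bar>ev w x j - ev w y j\<bar> \<le> 2 * \<delta>"
  using assms
proof (induction w arbitrary: x y j)
  case (Cons l w)
  have xy: "0 \<le> x i" "x i \<le> 1" "0 \<le> y i" "y i \<le> 1" "\<bar>x i - y i\<bar> \<le> \<delta>" if "1 \<le> i" "i \<le> ldim l" for i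
    using Cons.prems(1-3)[of i] that by auto
  have "\<bar>lval l (x 1) (x 2) - lval l (y 1) (y 2)\<bar> \<le> 2 * \<delta>"
  proof (cases l)
    case Sq
    then show ?thesis
      using xy[of 1] xy[of 2] lval_Lipschitz[of "x 1" "y 2" "y 1" \<delta> "x 2"] by simp
  qed (use xy[of 1] Cons.prems(4) in \<open>auto simp: abs_if field_simps split: if_splits\<close>)
  moreover have "\<bar>ev w (\<lambda>i. x (i + ldim l)) (j - 1) - ev w (\<lambda>i. y (i + ldim l)) (j - 1)\<bar> \<le> 2 * \<delta>"
    using Cons.prems by (intro Cons.IH) auto
  ultimately show ?case
    using Cons.prems(4) by simp
qed simp

lemma restrict_cmapsI:
  assumes g: "\<And>x. x \<in> cube m \<Longrightarrow> g x \<in> cube n"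
    and L: "\<And>x y \<delta>. x \<in> cube m \<Longrightarrow> y \<in> cube m \<Longrightarrow> \<delta> \<ge> 0 \<Longrightarrow> (\<And>i. i \<in> {1..m} \<Longrightarrow> \<bar>x i - y i\<bar> \<le> \<delta>) \<Longrightarrow>
       \<forall>j\<in>{1..n}. \<bar>g x j - g y j\<bar> \<le> 2 * \<delta>"
  shows "restrict g (cube m) \<in> cmaps (cpower int_I m) (cpower int_I n)"
  unfolding cmaps_def
proof (intro CollectI conjI allI impI subsetI)
  show "restrict g (cube m) \<in> cube m \<rightarrow>\<^sub>E cube n"
    using g by auto
  fix S z assume S: "S \<subseteq> cube m" and "z \<in> restrict g (cube m) ` cls (cpower int_I m) S"
  then obtain x where x: "x \<in> cube m" "x \<in> cls (cpower int_I m) S" "z = g x"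
    using cls_cpower_sub[of int_I m S] by auto
  have gS: "restrict g (cube m) ` S \<subseteq> cube n"
    using S g by auto
  have "\<exists>s\<in>restrict g (cube m) ` S. \<forall>j\<in>{1..n}. \<bar>s j - z j\<bar> < e" if e: "e > 0" for e
  proof -
    \<comment> \<open>The Lipschitz constant 2 turns \<open>e / 4\<close> into \<open>e / 2\<close>,
      which is strictly below \<open>e\<close>.\<close>
    obtain s where s: "s \<in> S" "\<forall>i\<in>{1..m}. \<bar>s i - x i\<bar> < e / 4"
      using x(2) cls_cube_iff[OF S x(1)] e by (metis zero_less_divide_iff zero_less_numeral)
    have "\<forall>j\<in>{1..n}. \<bar>g s j - g x j\<bar> \<le> 2 * (e / 4)"
    proof (rule L)
      show "\<bar>s i - x i\<bar> \<le> e / 4" if "i \<in> {1..m}" for i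
        using s(2) that by (auto intro: less_imp_le)
    qed (use s(1) S x e in auto)
    then have "\<forall>j\<in>{1..n}. \<bar>restrict g (cube m) s j - z j\<bar> < e"
      using s(1) S x(3) e by fastforce
    then show ?thesis
      using s(1) by blast
  qed
  then show "z \<in> cls (cpower int_I n) (restrict g (cube m) ` S)"
    using cls_cube_iff[OF gS, of z] g[OF x(1)] x(3) by blast
qed

section \<open>Singular cubes precomposed with words\<close>

definition subst_cube :: "((nat \<Rightarrow> real) \<Rightarrow> 'a) \<Rightarrow> word \<Rightarrow> ((nat \<Rightarrow> real) \<Rightarrow> 'a)" where
  "subst_cube \<sigma> w = (\<lambda>x\<in>cube (wdim w). \<sigma> (ev w x))"

lemma subst_cube_maps_in:
  assumes "\<sigma> \<in> maps_in (cpower int_I (length w)) X A" "admissible w"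
  shows "subst_cube \<sigma> w \<in> maps_in (cpower int_I (wdim w)) X A"
proof -
  have "restrict (ev w) (cube (wdim w)) \<in> cmaps (cpower int_I (wdim w)) (cpower int_I (length w))"
    using ev_cube[OF assms(2)] by (intro restrict_cmapsI ballI ev_Lipschitz) (auto simp: cube_iff)
  then have "(\<lambda>x\<in>cube (wdim w). \<sigma> (restrict (ev w) (cube (wdim w)) x)) \<in> cmaps (cpower int_I (wdim w)) X"
    using subsetD[OF maps_in_sub assms(1)] by (rule cmaps_compose[OF _ _ cls_cpower_sub])
  moreover have "(\<lambda>x\<in>cube (wdim w). \<sigma> (restrict (ev w) (cube (wdim w)) x)) = subst_cube \<sigma> w"
    by (auto simp: subst_cube_def)
  ultimately show ?thesis
    using assms(1) ev_cube[OF assms(2)] by (auto simp: maps_in_def subst_cube_def)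
qed

lemma wdim_wface: "i \<in> {1..wdim w} \<Longrightarrow> e \<in> {0, 1} \<Longrightarrow> Suc (wdim (wface w i e)) = wdim w"
proof (induction w arbitrary: i)
  case (Cons l w)
  show ?case
  proof (cases "i \<le> ldim l")
    case True
    then show ?thesis
      using Cons.prems by (cases l) auto
  next
    case False
    then have "i - ldim l \<in> {1..wdim w}"
      using Cons.prems by auto
    then show ?thesis
      using Cons.IH[OF _ Cons.prems(2)] False by simp
  qed
qed simp

text \<open>\<open>insert_coord\<close> without a bound on the dimension, as an induction over words
  changes the dimension at every letter.\<close>

definition insert_at :: "nat \<Rightarrow> real \<Rightarrow> (nat \<Rightarrow> real) \<Rightarrow> nat \<Rightarrow> real" where
  "insert_at i e x k = (if k < i then x k else if k = i then e else x (k - 1))"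

lemma lval_lface:
  assumes "1 \<le> i" "i \<le> ldim l" "e \<in> {0, 1}"
  shows "lval (lface l i e) (x 1) (x 2) = lval l (insert_at i e x 1) (insert_at i e x 2)"
  using assms by (cases l) (auto simp: insert_at_def numeral_2_eq_2 le_Suc_eq)

lemma ev_wface:
  assumes "i \<in> {1..wdim w}" "e \<in> {0, 1}"
  shows "ev (wface w i e) x j = ev w (insert_at i e x) j"
  using assms
proof (induction w arbitrary: i x j)
  case (Cons l w)
  show ?case
  proof (cases "i \<le> ldim l")
    case True
    \<comment> \<open>A face lowers the dimension of its letter by exactly one, so the remaining
      word reads the same variables before and after the insertion.\<close>
    obtain m where "ldim l = Suc m" "ldim (lface l i e) = m"
      using True Cons.prems by (cases l) auto
    then have "ev w (\<lambda>k. x (k + ldim (lface l i e))) (j - 1) = ev w (\<lambda>k. insert_at i e x (k + ldim l)) (j - 1)"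
      using True by (intro ev_cong) (auto simp: insert_at_def)
    then show ?thesis
      using True Cons.prems lval_lface[of i l e x] by simp
  next
    case False
    have "ev (wface w (i - ldim l) e) (\<lambda>k. x (k + ldim l)) (j - 1)
        = ev w (insert_at (i - ldim l) e (\<lambda>k. x (k + ldim l))) (j - 1)"
      using False Cons.prems by (intro Cons.IH) auto
    also have "insert_at (i - ldim l) e (\<lambda>k. x (k + ldim l)) = (\<lambda>k. insert_at i e x (k + ldim l))"
      using False by (auto simp: insert_at_def fun_eq_iff)
    finally have "ev (wface w (i - ldim l) e) (\<lambda>k. x (k + ldim l)) (j - 1)
        = ev w (\<lambda>k. insert_at i e x (k + ldim l)) (j - 1)" .
    moreover have "lval l (x 1) (x 2) = lval l (insert_at i e x 1) (insert_at i e x 2)"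
      using False by (intro lval_cong) (auto simp: insert_at_def)
    ultimately show ?thesis
      using False by simp
  qed
qed simp

lemma cube_face_subst_cube:
  assumes "wdim w = Suc m" "i \<in> {1..Suc m}" "e \<in> {0, 1}"
  shows "cube_face int_I m i e (subst_cube \<sigma> w) = subst_cube \<sigma> (wface w i e)"
proof
  fix x
  have dim: "wdim (wface w i e) = m"
    using wdim_wface[of i w e] assms by simp
  have "ev w (insert_coord m i e x) = ev (wface w i e) x"
  proof
    fix j
    show "ev w (insert_coord m i e x) j = ev (wface w i e) x j"
      using assms by (subst ev_wface) (auto intro!: ev_cong simp: insert_at_def insert_coord_def)
  qed
  then show "cube_face int_I m i e (subst_cube \<sigma> w) x = subst_cube \<sigma> (wface w i e) x"
    using insert_coord_pts[of x int_I m i e] assms by (auto simp: cube_face_def subst_cube_def dim pts_int_I)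
qed

text \<open>A letter of positive dimension owns a variable that no other letter reads, and
  \<open>Deg\<close> does not read its own. Both degeneracy lemmas below use this variable.\<close>

lemma ev_other_coords:
  assumes "i < length w" "ldim (w ! i) \<ge> 1"
  shows "\<exists>k\<in>{1..wdim w}. \<forall>x t. (\<forall>j. j \<noteq> Suc i \<longrightarrow> ev w (x(k := t)) j = ev w x j) \<and>
     (w ! i = Deg \<longrightarrow> ev w (x(k := t)) (Suc i) = ev w x (Suc i))"
  using assms
proof (induction w arbitrary: i)
  case (Cons l w)
  show ?case
  proof (cases i)
    case 0
    have "ev w (\<lambda>m. (x(1 := t)) (m + ldim l)) j = ev w (\<lambda>m. x (m + ldim l)) j" for x t j
      using Cons.prems 0 by (intro ev_cong) auto
    then show ?thesis
      using 0 Cons.prems by (intro bexI[of _ 1]) auto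
  next
    case (Suc i')
    then obtain k where k: "k \<in> {1..wdim w}"
      "\<forall>x t. (\<forall>j. j \<noteq> Suc i' \<longrightarrow> ev w (x(k := t)) j = ev w x j) \<and>
         (w ! i' = Deg \<longrightarrow> ev w (x(k := t)) (Suc i') = ev w x (Suc i'))"
      using Cons.IH[of i'] Cons.prems unfolding Suc by (auto simp del: fun_upd_apply)
    then have k': "\<And>x t j. j \<noteq> Suc i' \<Longrightarrow> ev w (x(k := t)) j = ev w x j"
      "\<And>x t. w ! i' = Deg \<Longrightarrow> ev w (x(k := t)) (Suc i') = ev w x (Suc i')"
      by blast+
    have shift: "(\<lambda>m. (x(k + ldim l := t)) (m + ldim l)) = (\<lambda>m. x (m + ldim l))(k := t)" for x :: "nat \<Rightarrow> real" and t
      by (auto simp: fun_eq_iff)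
    have lv: "lval l ((x(k + ldim l := t)) 1) ((x(k + ldim l := t)) 2) = lval l (x 1) (x 2)" for x t
      using k(1) by (intro lval_cong) auto
    show ?thesis
    proof (intro bexI allI conjI impI)
      show "k + ldim l \<in> {1..wdim (l # w)}"
        using k(1) by auto
      fix x t j
      show "ev (l # w) (x(k + ldim l := t)) j = ev (l # w) x j" if "j \<noteq> Suc i"
        using that Suc k'(1)[of "j - 1"] unfolding ev.simps shift lv by auto
      show "ev (l # w) (x(k + ldim l := t)) (Suc i) = ev (l # w) x (Suc i)" if "(l # w) ! i = Deg"
        using that Suc k'(2) unfolding ev.simps shift lv by auto
    qed
  qed
qed simp

lemma subst_cube_Deg:
  assumes "Deg \<in> set w" "subst_cube \<sigma> w \<in> cubes int_I (wdim w) X"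
  shows "subst_cube \<sigma> w \<in> I.degenerates (wdim w) X"
proof -
  obtain i where i: "i < length w" "w ! i = Deg"
    using assms(1) by (auto simp: in_set_conv_nth)
  then have "ldim (w ! i) \<ge> 1"
    by simp
  from ev_other_coords[OF i(1) this] obtain k where k: "k \<in> {1..wdim w}"
      "\<And>x t j. ev w (x(k := t)) j = ev w x j"
    using i(2) by metis
  have "ev w (x(k := t)) = ev w x" for x t
    using k(2) by blast
  then have "subst_cube \<sigma> w (x(k := t)) = subst_cube \<sigma> w x" if "x \<in> cube (wdim w)" "t \<in> pts int_I" for x t
    using that cpower_update[OF that(1) k(1) that(2)] by (simp add: subst_cube_def)
  then have "degenerate_cube int_I (wdim w) (subst_cube \<sigma> w)"
    using k(1) unfolding degenerate_cube_def by blast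
  then show ?thesis
    using assms(2) by (simp add: I.degenerates_def)
qed

text \<open>If \<sigma> ignores a coordinate, the substituted cube ignores the variable owned by the
  letter there. A constant letter owns none, hence the condition on dimensions.\<close>

lemma subst_cube_degenerate:
  assumes \<sigma>: "\<sigma> \<in> I.degenerates (length w) X" and w: "admissible w" "\<And>l. l \<in> set w \<Longrightarrow> ldim l \<ge> 1"
  shows "subst_cube \<sigma> w \<in> I.degenerates (wdim w) X"
proof -
  obtain i where i: "i \<in> {1..length w}"
      "\<And>x t. x \<in> cube (length w) \<Longrightarrow> t \<in> pts int_I \<Longrightarrow> \<sigma> (x(i := t)) = \<sigma> x"
    using \<sigma> by (auto simp: I.degenerates_def degenerate_cube_def)
  have "i - 1 < length w" "ldim (w ! (i - 1)) \<ge> 1"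
    using i(1) w(2) by auto
  from ev_other_coords[OF this] obtain k where k: "k \<in> {1..wdim w}"
      "\<And>x t j. j \<noteq> i \<Longrightarrow> ev w (x(k := t)) j = ev w x j"
    using i(1) by (auto simp del: fun_upd_apply)
  have eq: "subst_cube \<sigma> w (x(k := t)) = subst_cube \<sigma> w x" if x: "x \<in> cube (wdim w)" and t: "t \<in> pts int_I" for x t
  proof -
    have x': "x(k := t) \<in> cube (wdim w)"
      by (rule cpower_update[OF x k(1) t])
    have "ev w (x(k := t)) = (ev w x)(i := ev w (x(k := t)) i)"
      using k(2) by (auto simp: fun_eq_iff)
    moreover have "ev w (x(k := t)) i \<in> pts int_I"
      using ev_cube[OF w(1) x'] i(1) by (auto simp: cube_iff pts_int_I)
    ultimately have "\<sigma> (ev w (x(k := t))) = \<sigma> (ev w x)"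
      using i(2)[OF ev_cube[OF w(1) x]] by metis
    then show ?thesis
      using x x' by (simp add: subst_cube_def)
  qed
  have "degenerate_cube int_I (wdim w) (subst_cube \<sigma> w)"
    unfolding degenerate_cube_def by (intro bexI[OF _ k(1)] ballI eq)
  moreover have "subst_cube \<sigma> w \<in> cubes int_I (wdim w) X"
    using subst_cube_maps_in[OF _ w(1), of \<sigma> X "pts X"] \<sigma> by (auto simp: I.degenerates_def I.cubes_maps_in)
  ultimately show ?thesis
    by (simp add: I.degenerates_def)
qed


section \<open>The chain homotopy on words\<close>

definition prepend :: "letter \<Rightarrow> (word \<Rightarrow>\<^sub>0 int) \<Rightarrow> (word \<Rightarrow>\<^sub>0 int)" where
  "prepend l = frag_extend (\<lambda>w. frag_of (l # w))"

lemma prepend_simps [simp]: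
  "prepend l 0 = 0" "prepend l (frag_of w) = frag_of (l # w)"
  "prepend l (a + b) = prepend l a + prepend l b" "prepend l (a - b) = prepend l a - prepend l b"
  "prepend l (- a) = - prepend l a" "prepend l (frag_cmul k a) = frag_cmul k (prepend l a)"
  by (simp_all add: prepend_def frag_extend_add frag_extend_diff frag_extend_minus frag_extend_cmul)

lemma prepend_sum: "finite A \<Longrightarrow> prepend l (\<Sum>i\<in>A. f i) = (\<Sum>i\<in>A. prepend l (f i))"
  by (simp add: prepend_def frag_extend_sum o_def)

text \<open>Signed faces in the variables of the leading letter. For \<open>Deg\<close> the two ends
  coincide and cancel, and for \<open>Sq\<close> the signs make the four edges read halves minus
  whole minus constant.\<close>

fun lbd :: "letter \<Rightarrow> word \<Rightarrow> (word \<Rightarrow>\<^sub>0 int)" where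
  "lbd Lid w = frag_of (Cst 1 # w) - frag_of (Cst 0 # w)"
| "lbd Lo w = frag_of (Cst (1/2) # w) - frag_of (Cst 0 # w)"
| "lbd Hi w = frag_of (Cst 1 # w) - frag_of (Cst (1/2) # w)"
| "lbd Sq w = frag_of (Lo # w) + frag_of (Hi # w) - frag_of (Lid # w) - frag_of (Deg # w)"
| "lbd Deg w = 0"
| "lbd (Cst c) w = 0"

fun wbd :: "word \<Rightarrow> (word \<Rightarrow>\<^sub>0 int)" where
  "wbd [] = 0"
| "wbd (l # w) = lbd l w + frag_cmul ((-1) ^ ldim l) (prepend l (wbd w))"

text \<open>The first \<open>ldim l\<close> directions give the boundary of the leading letter;
  shifting the others by \<open>ldim l\<close> produces the sign of the Leibniz rule.\<close>

lemma wbd_eq: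
  "wbd w = (\<Sum>i<wdim w. frag_cmul ((-1) ^ Suc i) (frag_of (wface w (Suc i) 0) - frag_of (wface w (Suc i) 1)))"
proof (induction w)
  case (Cons l w)
  let ?g = "\<lambda>i. frag_cmul ((-1) ^ Suc i) (frag_of (wface (l # w) (Suc i) 0) - frag_of (wface (l # w) (Suc i) 1))"
  have "(\<Sum>i<ldim l + wdim w. ?g i) = (\<Sum>i<ldim l. ?g i) + (\<Sum>i<wdim w. ?g (i + ldim l))"
    using sum.atLeastLessThan_concat[of 0 "ldim l" "ldim l + wdim w" ?g]
      sum.shift_bounds_nat_ivl[of ?g 0 "ldim l" "wdim w"]
    by (simp add: atLeast0LessThan add.commute)
  also have "(\<Sum>i<ldim l. ?g i) = lbd l w"
    by (cases l) (simp_all add: numeral_2_eq_2)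
  also have "(\<Sum>i<wdim w. ?g (i + ldim l)) = frag_cmul ((-1) ^ ldim l) (prepend l (wbd w))"
    by (simp add: Cons prepend_sum frag_cmul_sum power_add frag_cmul_diff_right mult.commute)
  finally show ?case
    by simp
qed simp

text \<open>The usual homotopy on a product: \<open>Sq\<close> moves the first interval while the
  rest is kept, then the rest is moved with the first interval already halved. The minus sign is
  that of a letter of degree 1; constants have degree 0.\<close>

fun whtpy :: "word \<Rightarrow> (word \<Rightarrow>\<^sub>0 int)" where
  "whtpy [] = 0"
| "whtpy (l # w) = (if l = Lid then frag_of (Sq # w) - prepend Lo (whtpy w) - prepend Hi (whtpy w)
     else prepend l (whtpy w))"

fun wsub :: "word \<Rightarrow> (word \<Rightarrow>\<^sub>0 int)" where
  "wsub [] = frag_of []"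
| "wsub (l # w) = (if l = Lid then prepend Lo (wsub w) + prepend Hi (wsub w) else prepend l (wsub w))"

text \<open>The degenerate error term of the homotopy.\<close>

fun wdeg :: "word \<Rightarrow> (word \<Rightarrow>\<^sub>0 int)" where
  "wdeg [] = 0"
| "wdeg (l # w) = (if l = Lid then frag_of (Deg # w) + prepend Lo (wdeg w) + prepend Hi (wdeg w)
     else prepend l (wdeg w))"

abbreviation "wBD \<equiv> frag_extend wbd"
abbreviation "wHT \<equiv> frag_extend whtpy"

lemma wBD_prepend:
  "wBD (prepend l c) = frag_extend (lbd l) c + frag_cmul ((-1) ^ ldim l) (prepend l (wBD c))"
  using subset_UNIV
proof (induction c rule: frag_induction)
  case (diff a b)
  then show ?case
    by (simp add: frag_extend_diff frag_cmul_diff_right)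
qed auto

lemma wHT_prepend_Lid: "wHT (prepend Lid c) = prepend Sq c - prepend Lo (wHT c) - prepend Hi (wHT c)"
  using subset_UNIV by (induction c rule: frag_induction) (auto simp: frag_extend_diff)

lemma wHT_prepend_Cst: "wHT (prepend (Cst e) c) = prepend (Cst e) (wHT c)"
  using subset_UNIV by (induction c rule: frag_induction) (auto simp: frag_extend_diff)

text \<open>The midpoint \<open>Cst (1/2)\<close> cancels, so the two halves together have the
  boundary of the whole interval.\<close>

lemma lbd_halves:
  "frag_extend (lbd Lo) c + frag_extend (lbd Hi) c = prepend (Cst 1) c - prepend (Cst 0) c"
  using subset_UNIV by (induction c rule: frag_induction) (auto simp: frag_extend_diff algebra_simps)

text \<open>Restricted to words in \<open>Lid\<close> and constants, which are the cube itself and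
  its faces, the boundary stays within such words, on which \<open>whtpy\<close> is the intended
  homotopy.\<close>

lemma word_homotopy:
  assumes "set w \<subseteq> insert Lid (range Cst)"
  shows "wBD (whtpy w) + wHT (wbd w) = wsub w - frag_of w - wdeg w"
  using assms
proof (induction w)
  case (Cons l w)
  then have IH: "wBD (whtpy w) + wHT (wbd w) = wsub w - frag_of w - wdeg w"
    by simp
  show ?case
  proof (cases "l = Lid")
    case True
    let ?h = "whtpy w" and ?d = "wbd w"
    have "wBD (whtpy (Lid # w)) = lbd Sq w + prepend Sq ?d
        - (frag_extend (lbd Lo) ?h + frag_extend (lbd Hi) ?h) + prepend Lo (wBD ?h) + prepend Hi (wBD ?h)"
      by (simp add: frag_extend_diff wBD_prepend)
    also have "\<dots> = lbd Sq w + prepend Sq ?d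
        - (prepend (Cst 1) ?h - prepend (Cst 0) ?h) + prepend Lo (wBD ?h) + prepend Hi (wBD ?h)"
      by (simp only: lbd_halves)
    finally have 1: "wBD (whtpy (Lid # w)) = \<dots>" .
    have 2: "wHT (wbd (Lid # w)) = prepend (Cst 1) ?h - prepend (Cst 0) ?h
        - (prepend Sq ?d - prepend Lo (wHT ?d) - prepend Hi (wHT ?d))"
      by (simp add: frag_extend_diff frag_extend_minus frag_extend_add wHT_prepend_Lid algebra_simps)
    \<comment> \<open>The terms at the two ends cancel by \<open>lbd_halves\<close> and the
      \<open>Sq\<close> terms cancel because \<open>Sq\<close> is even while \<open>Lid\<close> is
      odd. What is left are the edges of \<open>Sq\<close> and the induction hypothesis under each
      half.\<close>
    have "wBD (whtpy (Lid # w)) + wHT (wbd (Lid # w))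
        = lbd Sq w + prepend Lo (wBD ?h + wHT ?d) + prepend Hi (wBD ?h + wHT ?d)"
      unfolding 1 2 by (simp add: algebra_simps)
    also have "\<dots> = wsub (Lid # w) - frag_of (Lid # w) - wdeg (Lid # w)"
      unfolding IH by (simp add: algebra_simps)
    finally show ?thesis
      using True by simp
  next
    case False
    then obtain c where c: "l = Cst c"
      using Cons.prems by auto
    have "frag_extend (lbd (Cst c)) (whtpy w) = 0"
      by (rule frag_extend_eq_0) simp
    then have "wBD (whtpy (l # w)) + wHT (wbd (l # w)) = prepend l (wBD (whtpy w) + wHT (wbd w))"
      by (simp add: c wBD_prepend wHT_prepend_Cst)
    then show ?thesis
      unfolding IH by (simp add: c)
  qed
qed simp

lemma prepend_frags:
  "c \<in> frags P \<Longrightarrow> (\<And>w. w \<in> P \<Longrightarrow> l # w \<in> Q) \<Longrightarrow> prepend l c \<in> frags Q"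
  by (rule linear_frags) auto

abbreviation Lids :: "nat \<Rightarrow> word" where
  "Lids n \<equiv> replicate n Lid"

lemma wdim_Lids: "wdim (Lids n) = n"
  by (induction n) auto

lemma ev_Lids: "j \<in> {1..n} \<Longrightarrow> ev (Lids n) x j = x j"
proof (induction n arbitrary: x j)
  case (Suc n)
  have "ev (Lids n) (\<lambda>i. x (i + 1)) (j - 1) = x (j - 1 + 1)" if "j \<noteq> 1"
    using Suc.prems that by (intro Suc.IH) auto
  then show ?case
    using Suc.prems by auto
qed simp

lemma wsub_words: "wsub (Lids n) \<in> frags {w. length w = n \<and> set w \<subseteq> {Lo, Hi}}"
proof (induction n)
  case (Suc n)
  show ?case
    by (auto intro!: frags_add prepend_frags[OF Suc.IH])
qed simp

lemma wdim_halves: "set w \<subseteq> {Lo, Hi} \<Longrightarrow> wdim w = length w"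
  by (induction w) auto

lemma whtpy_words:
  "whtpy (Lids n) \<in> frags {w. length w = n \<and> wdim w = Suc n \<and> set w \<subseteq> {Lid, Lo, Hi, Sq}}"
proof (induction n)
  case (Suc n)
  have "set (Lids n) \<subseteq> {Lid}"
    by auto
  then show ?case
    by (auto intro!: frags_diff prepend_frags[OF Suc.IH] simp: wdim_Lids)
qed simp

lemma wdeg_words:
  "wdeg (Lids n) \<in> frags {w. length w = n \<and> wdim w = n \<and> set w \<subseteq> {Lid, Lo, Hi, Deg} \<and> Deg \<in> set w}"
proof (induction n)
  case (Suc n)
  have "set (Lids n) \<subseteq> {Lid}"
    by auto
  then show ?case
    by (auto intro!: frags_add prepend_frags[OF Suc.IH] simp: wdim_Lids)
qed simp

lemma wbd_words:
  "wbd (Lids n) \<in> frags {w. length w = n \<and> Suc (wdim w) = n \<and> set w \<subseteq> {Lid, Cst 0, Cst 1}}"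
proof (induction n)
  case (Suc n)
  have "set (Lids n) \<subseteq> {Lid}"
    by auto
  then show ?case
    by (auto intro!: frags_diff frags_add prepend_frags[OF Suc.IH] simp: wdim_Lids)
qed simp

section \<open>From chains of words back to singular chains\<close>

definition cube_push :: "((nat \<Rightarrow> real) \<Rightarrow> 'a) \<Rightarrow> (word \<Rightarrow>\<^sub>0 int) \<Rightarrow> (((nat \<Rightarrow> real) \<Rightarrow> 'a) \<Rightarrow>\<^sub>0 int)" where
  "cube_push \<sigma> = frag_extend (\<lambda>w. frag_of (subst_cube \<sigma> w))"

lemma cube_push_simps [simp]:
  "cube_push \<sigma> 0 = 0" "cube_push \<sigma> (frag_of w) = frag_of (subst_cube \<sigma> w)"
  "cube_push \<sigma> (a + b) = cube_push \<sigma> a + cube_push \<sigma> b" "cube_push \<sigma> (a - b) = cube_push \<sigma> a - cube_push \<sigma> b"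
  by (simp_all add: cube_push_def frag_extend_add frag_extend_diff)

lemma cube_bd_push:
  assumes "c \<in> frags {w. wdim w = Suc m}"
  shows "cube_bd int_I m (cube_push \<sigma> c) = cube_push \<sigma> (wBD c)"
  using assms
proof (induction rule: frags_induct)
  case (one w)
  then have w: "wdim w = Suc m"
    by simp
  have "cube_bd int_I m (frag_of (subst_cube \<sigma> w)) = (\<Sum>i<Suc m. frag_cmul ((-1) ^ Suc i)
      (frag_of (subst_cube \<sigma> (wface w (Suc i) 0)) - frag_of (subst_cube \<sigma> (wface w (Suc i) 1))))"
    unfolding I.cube_bd_of lessThan_Suc_atMost
    by (intro sum.cong refl) (simp add: cube_face_subst_cube[OF w])
  also have "\<dots> = cube_push \<sigma> (wbd w)"
    unfolding wbd_eq w by (simp add: cube_push_def frag_extend_sum frag_extend_cmul frag_extend_diff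
        o_def del: sum.lessThan_Suc)
  finally show ?case
    by simp
qed (simp_all add: I.cube_bd_0 I.cube_bd_diff frag_extend_diff)

lemma subst_cube_Lids:
  assumes "\<sigma> \<in> cubes int_I n X"
  shows "subst_cube \<sigma> (Lids n) = \<sigma>"
proof
  fix x
  have "ev (Lids n) x j = x j" if "x \<in> cube n" for j
    using that ev_Lids[of j n x] ev_undefined[of j "Lids n" x] by (cases "j \<in> {1..n}") (auto simp: cube_iff)
  then have "ev (Lids n) x = x" if "x \<in> cube n"
    using that by blast
  then show "subst_cube \<sigma> (Lids n) x = \<sigma> x"
    using assms by (auto simp: subst_cube_def wdim_Lids cubes_def cmaps_def PiE_iff extensional_def)
qed

lemma cube_push_maps_in:
  assumes \<sigma>: "\<sigma> \<in> maps_in (cpower int_I n) X A"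
    and c: "c \<in> frags {w. length w = n \<and> wdim w = m \<and> admissible w}"
  shows "cube_push \<sigma> c \<in> frags (maps_in (cpower int_I m) X A)"
  using c by (rule linear_frags) (use \<sigma> subst_cube_maps_in in auto)

lemma cube_push_degenerates:
  assumes \<sigma>: "\<sigma> \<in> I.degenerates n X"
    and c: "c \<in> frags {w. length w = n \<and> wdim w = m \<and> admissible w \<and> (\<forall>l\<in>set w. ldim l \<ge> 1)}"
  shows "cube_push \<sigma> c \<in> frags (I.degenerates m X)"
  using c by (rule linear_frags) (use \<sigma> subst_cube_degenerate in auto)

text \<open>
  The faces of a cube are given by words in \<open>Lid\<close> and constants. Substituting for the letters \<open>Lid\<close>
  of such a word expresses the naturality of the homotopy with respect to faces.
\<close>

fun fill :: "word \<Rightarrow> word \<Rightarrow> word" where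
  "fill [] v = []"
| "fill (l # w) v = (if l = Lid then hd v # fill w (tl v) else l # fill w v)"

lemma wdim_fill:
  "set w \<subseteq> insert Lid (range Cst) \<Longrightarrow> length v = wdim w \<Longrightarrow> wdim (fill w v) = wdim v"
proof (induction w arbitrary: v)
  case (Cons l w)
  then show ?case
    by (cases v) auto
qed simp

lemma ev_fill:
  "set w \<subseteq> insert Lid (range Cst) \<Longrightarrow> length v = wdim w \<Longrightarrow> ev (fill w v) x j = ev w (ev v x) j"
proof (induction w arbitrary: v x j)
  case (Cons l w)
  show ?case
  proof (cases "l = Lid")
    case True
    then obtain l' v' where v: "v = l' # v'" "length v' = wdim w"
      using Cons.prems by (cases v) auto
    have "ev (fill w v') (\<lambda>i. x (i + ldim l')) (j - 1) = ev w (ev v' (\<lambda>i. x (i + ldim l'))) (j - 1)"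
      using Cons.prems v by (intro Cons.IH) auto
    also have "\<dots> = ev w (\<lambda>i. ev v x (i + ldim Lid)) (j - 1)"
      using v by (intro ev_cong) auto
    finally show ?thesis
      using True v by (simp del: ldim.simps)
  next
    case False
    then obtain c where "l = Cst c"
      using Cons.prems by auto
    then show ?thesis
      using Cons.IH[of v x "j - 1"] Cons.prems by auto
  qed
qed simp

lemma subst_cube_subst_cube:
  assumes "set w \<subseteq> insert Lid (range Cst)" "length v = wdim w" "admissible v"
  shows "subst_cube (subst_cube \<sigma> w) v = subst_cube \<sigma> (fill w v)"
proof
  fix x
  have "ev (fill w v) x = ev w (ev v x)"
    using ev_fill[OF assms(1,2)] by blast
  then show "subst_cube (subst_cube \<sigma> w) v x = subst_cube \<sigma> (fill w v) x"
    using ev_cube[OF assms(3), of x] assms(2) by (simp add: subst_cube_def wdim_fill[OF assms(1,2)])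
qed

abbreviation wfill :: "word \<Rightarrow> (word \<Rightarrow>\<^sub>0 int) \<Rightarrow> (word \<Rightarrow>\<^sub>0 int)" where
  "wfill w \<equiv> frag_extend (\<lambda>v. frag_of (fill w v))"

lemma wfill_Lid: "wfill (Lid # w) (prepend l c) = prepend l (wfill w c)"
  using subset_UNIV by (induction c rule: frag_induction) (auto simp: frag_extend_diff)

lemma wfill_Cst: "wfill (Cst e # w) c = prepend (Cst e) (wfill w c)"
  using subset_UNIV by (induction c rule: frag_induction) (auto simp: frag_extend_diff)

lemma fill_Lids: "set w \<subseteq> insert Lid (range Cst) \<Longrightarrow> fill w (Lids (wdim w)) = w"
  by (induction w) auto

text \<open>Constants pass through \<open>whtpy\<close> unchanged, and each \<open>Lid\<close>
  contributes the letter that is to fill its place.\<close>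

lemma whtpy_fill:
  "set w \<subseteq> insert Lid (range Cst) \<Longrightarrow> whtpy w = wfill w (whtpy (Lids (wdim w)))"
proof (induction w)
  case (Cons l w)
  show ?case
  proof (cases "l = Lid")
    case True
    then show ?thesis
      using Cons by (simp add: frag_extend_diff wfill_Lid fill_Lids del: fill.simps) (simp add: fill_Lids)
  next
    case False
    then obtain c where "l = Cst c"
      using Cons.prems by auto
    then show ?thesis
      using Cons by (simp add: wfill_Cst del: fill.simps)
  qed
qed simp

definition cube_htpy :: "nat \<Rightarrow> (((nat \<Rightarrow> real) \<Rightarrow> 'a) \<Rightarrow>\<^sub>0 int) \<Rightarrow> (((nat \<Rightarrow> real) \<Rightarrow> 'a) \<Rightarrow>\<^sub>0 int)" where
  "cube_htpy n = frag_extend (\<lambda>\<sigma>. cube_push \<sigma> (whtpy (Lids n)))"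

definition cube_sub :: "nat \<Rightarrow> (((nat \<Rightarrow> real) \<Rightarrow> 'a) \<Rightarrow>\<^sub>0 int) \<Rightarrow> (((nat \<Rightarrow> real) \<Rightarrow> 'a) \<Rightarrow>\<^sub>0 int)" where
  "cube_sub n = frag_extend (\<lambda>\<sigma>. cube_push \<sigma> (wsub (Lids n)))"

lemma cube_htpy_push:
  assumes "c \<in> frags {w. wdim w = n \<and> set w \<subseteq> insert Lid (range Cst)}"
  shows "cube_htpy n (cube_push \<sigma> c) = cube_push \<sigma> (wHT c)"
  using assms
proof (induction rule: frags_induct)
  case (one w)
  then have w: "wdim w = n" "set w \<subseteq> insert Lid (range Cst)"
    by auto
  have "cube_push (subst_cube \<sigma> w) (whtpy (Lids n)) = frag_extend (\<lambda>v. frag_of (subst_cube \<sigma> (fill w v))) (whtpy (Lids n))"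
    unfolding cube_push_def
  proof (rule frag_extend_eq)
    fix v assume "v \<in> Poly_Mapping.keys (whtpy (Lids n))"
    then have "length v = n" "set v \<subseteq> {Lid, Lo, Hi, Sq}"
      using whtpy_words[of n] by (auto simp: frags_def)
    then have "subst_cube (subst_cube \<sigma> w) v = subst_cube \<sigma> (fill w v)"
      using w by (intro subst_cube_subst_cube) (auto simp: admissible_def)
    then show "frag_of (subst_cube (subst_cube \<sigma> w) v) = frag_of (subst_cube \<sigma> (fill w v))"
      by simp
  qed
  also have "\<dots> = cube_push \<sigma> (wfill w (whtpy (Lids n)))"
    using frag_extend_compose[of "\<lambda>w. frag_of (subst_cube \<sigma> w)" "fill w" "whtpy (Lids n)"]
    by (simp add: cube_push_def o_def)
  also have "\<dots> = cube_push \<sigma> (whtpy w)"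
    using whtpy_fill[OF w(2)] w(1) by simp
  finally show ?case
    by (simp add: cube_htpy_def)
qed (simp_all add: cube_htpy_def frag_extend_diff)

text \<open>Since \<sigma> is the substitution of the identity word, it and its faces are images
  under \<open>cube_push\<close>; the claim is the image of \<open>word_homotopy\<close>.\<close>

lemma cube_homotopy:
  assumes "\<sigma> \<in> cubes int_I (Suc m) X"
  shows "cube_bd int_I (Suc m) (cube_htpy (Suc m) (frag_of \<sigma>)) + cube_htpy m (cube_bd int_I m (frag_of \<sigma>))
     = cube_sub (Suc m) (frag_of \<sigma>) - frag_of \<sigma> - cube_push \<sigma> (wdeg (Lids (Suc m)))"
proof -
  let ?u = "Lids (Suc m)"
  have "frags {w. length w = Suc m \<and> wdim w = Suc (Suc m) \<and> set w \<subseteq> {Lid, Lo, Hi, Sq}}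
      \<subseteq> frags {w. wdim w = Suc (Suc m)}"
    by (auto simp: frags_def)
  then have 1: "cube_bd int_I (Suc m) (cube_htpy (Suc m) (frag_of \<sigma>)) = cube_push \<sigma> (wBD (whtpy ?u))"
    using whtpy_words[of "Suc m"] unfolding cube_htpy_def frag_extend_of by (intro cube_bd_push) blast
  have "cube_bd int_I m (frag_of \<sigma>) = cube_bd int_I m (cube_push \<sigma> (frag_of ?u))"
    using subst_cube_Lids[OF assms] by simp
  also have "\<dots> = cube_push \<sigma> (wbd ?u)"
    using cube_bd_push[of "frag_of ?u" m \<sigma>] by (simp add: wdim_Lids)
  finally have "cube_htpy m (cube_bd int_I m (frag_of \<sigma>)) = cube_htpy m (cube_push \<sigma> (wbd ?u))"
    by simp
  moreover have "frags {w. length w = Suc m \<and> Suc (wdim w) = Suc m \<and> set w \<subseteq> {Lid, Cst 0, Cst 1}}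
      \<subseteq> frags {w. wdim w = m \<and> set w \<subseteq> insert Lid (range Cst)}"
    by (intro subsetI, erule frags_mono) auto
  ultimately have 2: "cube_htpy m (cube_bd int_I m (frag_of \<sigma>)) = cube_push \<sigma> (wHT (wbd ?u))"
    using wbd_words[of "Suc m"] by (metis (no_types, lifting) cube_htpy_push subsetD)
  have "set ?u \<subseteq> insert Lid (range Cst)"
    by auto
  then have "cube_push \<sigma> (wBD (whtpy ?u) + wHT (wbd ?u)) = cube_push \<sigma> (wsub ?u - frag_of ?u - wdeg ?u)"
    by (simp only: word_homotopy)
  then show ?thesis
    unfolding 1 2 using subst_cube_Lids[OF assms] by (simp add: cube_sub_def del: replicate.simps)
qed

section \<open>Iterated subdivision makes cubes small\<close>

lemma ev_halves:
  "set w \<subseteq> {Lo, Hi} \<Longrightarrow> j \<in> {1..length w} \<Longrightarrow> ev w x j - ev w y j = (x j - y j) / 2"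
proof (induction w arbitrary: x y j)
  case (Cons l w)
  show ?case
  proof (cases "j = 1")
    case True
    then show ?thesis
      using Cons.prems by (auto simp: field_simps)
  next
    case False
    have "ev w (\<lambda>i. x (i + 1)) (j - 1) - ev w (\<lambda>i. y (i + 1)) (j - 1) = (x (j - 1 + 1) - y (j - 1 + 1)) / 2"
      using False Cons.prems by (intro Cons.IH) auto
    moreover have "ldim l = 1"
      using Cons.prems by auto
    ultimately show ?thesis
      using False Cons.prems by simp
  qed
qed simp

text \<open>Keeps of a cube of the \<open>k\<close>-th subdivision what smallness requires: it is
  \<sigma> after a self-map \<open>g\<close> of the cube that contracts every coordinate by
  \<open>(1 / 2) ^ k\<close>. In this form the condition is stable under composition with one more
  word.\<close>

definition shrunk :: "nat \<Rightarrow> 'a cspace \<Rightarrow> ((nat \<Rightarrow> real) \<Rightarrow> 'a) \<Rightarrow> nat \<Rightarrow> ((nat \<Rightarrow> real) \<Rightarrow> 'a) set" where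
  "shrunk n X \<sigma> k = {\<tau> \<in> cubes int_I n X. \<exists>g. (\<forall>x\<in>cube n. g x \<in> cube n \<and> \<tau> x = \<sigma> (g x)) \<and>
     (\<forall>x\<in>cube n. \<forall>y\<in>cube n. \<forall>i\<in>{1..n}. \<bar>g x i - g y i\<bar> \<le> (1 / 2) ^ k * \<bar>x i - y i\<bar>)}"

lemma subst_cube_shrunk:
  assumes \<tau>: "\<tau> \<in> shrunk n X \<sigma> k" and w: "length w = n" "set w \<subseteq> {Lo, Hi}"
  shows "subst_cube \<tau> w \<in> shrunk n X \<sigma> (Suc k)"
proof -
  obtain g where g: "\<And>x. x \<in> cube n \<Longrightarrow> g x \<in> cube n \<and> \<tau> x = \<sigma> (g x)"
      "\<And>x y i. x \<in> cube n \<Longrightarrow> y \<in> cube n \<Longrightarrow> i \<in> {1..n} \<Longrightarrow> \<bar>g x i - g y i\<bar> \<le> (1 / 2) ^ k * \<bar>x i - y i\<bar>"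
    using \<tau> unfolding shrunk_def by blast
  have dim: "wdim w = n" and adm: "admissible w"
    using wdim_halves[OF w(2)] w by (auto simp: admissible_def)
  have ev: "ev w x \<in> cube n" if "x \<in> cube n" for x
    using ev_cube[OF adm, of x] that dim w(1) by simp
  have "\<bar>g (ev w x) i - g (ev w y) i\<bar> \<le> (1 / 2) ^ Suc k * \<bar>x i - y i\<bar>"
    if "x \<in> cube n" "y \<in> cube n" "i \<in> {1..n}" for x y i
  proof -
    have eq: "ev w x i - ev w y i = (x i - y i) / 2"
      using that(3) w(1) by (intro ev_halves[OF w(2)]) simp
    show ?thesis
      using g(2)[OF ev[OF that(1)] ev[OF that(2)] that(3)] unfolding eq by simp
  qed
  moreover have "subst_cube \<tau> w \<in> cubes int_I n X"
    using subst_cube_maps_in[OF _ adm, of \<tau> X "pts X"] \<tau> dim w(1) by (auto simp: shrunk_def I.cubes_maps_in)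
  moreover have "subst_cube \<tau> w x = \<sigma> (g (ev w x))" if "x \<in> cube n" for x
    using g(1)[OF ev[OF that]] that dim by (simp add: subst_cube_def)
  ultimately show ?thesis
    using g(1) ev unfolding shrunk_def by (intro CollectI conjI exI[of _ "\<lambda>x. g (ev w x)"]) auto
qed

lemma cube_sub_diff: "cube_sub n (a - b) = cube_sub n a - cube_sub n b"
  by (simp add: cube_sub_def frag_extend_diff)

lemma cube_htpy_diff: "cube_htpy n (a - b) = cube_htpy n a - cube_htpy n b"
  by (simp add: cube_htpy_def frag_extend_diff)

lemma cube_sub_shrunk:
  assumes "\<sigma> \<in> cubes int_I n X"
  shows "(cube_sub n ^^ k) (frag_of \<sigma>) \<in> frags (shrunk n X \<sigma> k)"
proof (induction k)
  case 0
  show ?case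
    using assms unfolding shrunk_def by (auto intro!: exI[of _ "\<lambda>x. x"])
next
  case (Suc k)
  have "cube_sub n (frag_of \<tau>) \<in> frags (shrunk n X \<sigma> (Suc k))" if "\<tau> \<in> shrunk n X \<sigma> k" for \<tau>
    unfolding cube_sub_def frag_extend_of
    by (rule linear_frags[OF wsub_words]) (use subst_cube_shrunk[OF that] in auto)
  then show ?case
    using linear_frags[OF Suc, of "cube_sub n", OF _ cube_sub_diff] by simp
qed

lemma cubical_excision_I:
  assumes X: "closure_space X" and G: "comm_group G" and cov: "interior_cover X {A, B}"
  shows "cubical_incl_iso int_I n B (A \<inter> B) X A G"
proof (rule I.cubical_excision[OF _ _ G])
  let ?U = "\<lambda>n. cubes int_I n X"
  let ?m = "\<lambda>n. maps_in (cpower int_I n) X"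
  let ?S = "\<lambda>n. I.degenerates n X \<union> ?m n A \<union> ?m n B"
  have sub: "?S n \<subseteq> ?U n" for n
    using I.degenerates_sub maps_in_sub unfolding cubes_def by blast
  have incl: "frags (I.degenerates n X) \<subseteq> frags (?S n)" "frags (?m n A) \<subseteq> frags (?S n)" "frags (?m n B) \<subseteq> frags (?S n)" for n
    by (auto simp: frags_def)
  have bd_S: "cube_bd int_I n x \<in> frags (?S n)" if "x \<in> frags (?S (Suc n))" for n x
    using that
  proof (rule linear_frags)
    fix \<sigma> assume "\<sigma> \<in> ?S (Suc n)"
    then consider "\<sigma> \<in> I.degenerates (Suc n) X" | "\<sigma> \<in> ?m (Suc n) A" | "\<sigma> \<in> ?m (Suc n) B"
      by blast
    then show "cube_bd int_I n (frag_of \<sigma>) \<in> frags (?S n)"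
    proof cases
      case 1
      then show ?thesis
        using I.cube_bd_degenerates[of "frag_of \<sigma>" n X] incl(1)[of n] by auto
    next
      case 2
      then show ?thesis
        using I.cube_bd_maps_in[of "frag_of \<sigma>" n X A] incl(2)[of n] by auto
    next
      case 3
      then show ?thesis
        using I.cube_bd_maps_in[of "frag_of \<sigma>" n X B] incl(3)[of n] by auto
    qed
  qed (rule I.cube_bd_diff)
  \<comment> \<open>The words of the homotopy contain no constants, so
    \<open>cube_push_degenerates\<close> shows that it preserves degenerate cubes.\<close>
  have hw: "whtpy (Lids n) \<in> frags {w. length w = n \<and> wdim w = Suc n \<and> admissible w \<and> (\<forall>l\<in>set w. ldim l \<ge> 1)}" for n
    by (rule frags_mono[OF whtpy_words]) (auto simp: admissible_def)
  have hw': "whtpy (Lids n) \<in> frags {w. length w = n \<and> wdim w = Suc n \<and> admissible w}" for n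
    by (rule frags_mono[OF hw]) auto
  have sw: "wsub (Lids n) \<in> frags {w. length w = n \<and> wdim w = n \<and> admissible w}" for n
    by (rule frags_mono[OF wsub_words]) (auto simp: admissible_def wdim_halves)
  have dw: "wdeg (Lids n) \<in> frags {w. length w = n \<and> wdim w = n \<and> admissible w \<and> Deg \<in> set w}" for n
    by (rule frags_mono[OF wdeg_words]) (auto simp: admissible_def)
  have htpy_S: "cube_htpy n x \<in> frags (?S (Suc n))" if "x \<in> frags (?S n)" for n x
    using that
  proof (rule linear_frags)
    fix \<sigma> assume "\<sigma> \<in> ?S n"
    then consider "\<sigma> \<in> I.degenerates n X" | "\<sigma> \<in> ?m n A" | "\<sigma> \<in> ?m n B"
      by blast
    then show "cube_htpy n (frag_of \<sigma>) \<in> frags (?S (Suc n))"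
    proof cases
      case 1
      then show ?thesis
        using cube_push_degenerates[OF 1 hw] incl(1)[of "Suc n"] by (auto simp: cube_htpy_def)
    next
      case 2
      then show ?thesis
        using cube_push_maps_in[OF 2 hw'] incl(2)[of "Suc n"] by (auto simp: cube_htpy_def)
    next
      case 3
      then show ?thesis
        using cube_push_maps_in[OF 3 hw'] incl(3)[of "Suc n"] by (auto simp: cube_htpy_def)
    qed
  qed (rule cube_htpy_diff)
  \<comment> \<open>Every word of the error term contains \<open>Deg\<close>, so the error is
    degenerate and disappears modulo \<open>S\<close>.\<close>
  have deg: "cube_push \<sigma> (wdeg (Lids n)) \<in> frags (?S n)" if \<sigma>: "\<sigma> \<in> ?U n" for \<sigma> n
    using dw
  proof (rule linear_frags)
    fix w assume "w \<in> {w. length w = n \<and> wdim w = n \<and> admissible w \<and> Deg \<in> set w}"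
    then have w: "length w = n" "wdim w = n" "admissible w" "Deg \<in> set w"
      by auto
    then have "subst_cube \<sigma> w \<in> cubes int_I (wdim w) X"
      using subst_cube_maps_in[OF _ w(3), of \<sigma> X "pts X"] \<sigma> by (auto simp: I.cubes_maps_in)
    then show "cube_push \<sigma> (frag_of w) \<in> frags (?S n)"
      using subst_cube_Deg[OF w(4)] w(2) by auto
  qed simp
  show "acyclic_mod ?U ?S (cube_bd int_I)"
  proof (rule acyclic_mod_subdivision[where sd = cube_sub and h = cube_htpy])
    fix n and x :: "((nat \<Rightarrow> real) \<Rightarrow> 'a) \<Rightarrow>\<^sub>0 int"
    show "?S n \<subseteq> ?U n"
      by (rule sub)
    show "cube_bd int_I n x \<in> frags (?U n)" if "x \<in> frags (?U (Suc n))"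
      using that I.cube_bd_maps_in unfolding I.cubes_maps_in by blast
    show "cube_bd int_I n x \<in> frags (?S n)" if "x \<in> frags (?S (Suc n))"
      using that by (rule bd_S)
    show "cube_sub n x \<in> frags (?U n)" if "x \<in> frags (?U n)"
      using that unfolding I.cubes_maps_in
      by (rule linear_frags) (simp_all add: cube_sub_diff, simp add: cube_sub_def cube_push_maps_in[OF _ sw])
    show "cube_htpy n x \<in> frags (?U (Suc n))" if "x \<in> frags (?U n)"
      using that unfolding I.cubes_maps_in
      by (rule linear_frags) (simp_all add: cube_htpy_diff, simp add: cube_htpy_def cube_push_maps_in[OF _ hw'])
    show "cube_htpy n x \<in> frags (?S (Suc n))" if "x \<in> frags (?S n)"
      using that by (rule htpy_S)
    show "cube_bd int_I 0 (cube_htpy 0 x) - (cube_sub 0 x - x) \<in> frags (?S 0)" if "x \<in> frags (?U 0)"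
      using that
    proof (rule linear_frags)
      \<comment> \<open>In degree 0 the one word is empty: the homotopy is zero and the subdivision
        is the identity.\<close>
      show "cube_bd int_I 0 (cube_htpy 0 (frag_of \<sigma>)) - (cube_sub 0 (frag_of \<sigma>) - frag_of \<sigma>) \<in> frags (?S 0)"
        if "\<sigma> \<in> ?U 0" for \<sigma>
        using subst_cube_Lids[OF that] by (simp add: cube_htpy_def cube_sub_def I.cube_bd_0)
    qed (simp add: cube_htpy_diff cube_sub_diff I.cube_bd_diff)
    show "cube_bd int_I (Suc n) (cube_htpy (Suc n) x) + cube_htpy n (cube_bd int_I n x) - (cube_sub (Suc n) x - x)
        \<in> frags (?S (Suc n))" if "x \<in> frags (?U (Suc n))"
      using that
    proof (rule linear_frags)
      show "cube_bd int_I (Suc n) (cube_htpy (Suc n) (frag_of \<sigma>)) + cube_htpy n (cube_bd int_I n (frag_of \<sigma>))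
          - (cube_sub (Suc n) (frag_of \<sigma>) - frag_of \<sigma>) \<in> frags (?S (Suc n))"
        if \<sigma>: "\<sigma> \<in> ?U (Suc n)" for \<sigma>
        unfolding cube_homotopy[OF \<sigma>] using deg[OF \<sigma>] by (simp del: replicate.simps)
    qed (simp add: cube_htpy_diff cube_sub_diff I.cube_bd_diff)
    show "\<exists>N. \<forall>k\<ge>N. (cube_sub n ^^ k) (frag_of \<sigma>) \<in> frags (?S n)" if \<sigma>: "\<sigma> \<in> ?U n" for \<sigma>
    proof -
      obtain \<delta> where \<delta>: "\<delta> > 0" "\<And>Q. Q \<subseteq> cube n \<Longrightarrow>
          (\<forall>x\<in>Q. \<forall>y\<in>Q. \<forall>i\<in>{1..n}. \<bar>x i - y i\<bar> < \<delta>) \<Longrightarrow> \<sigma> ` Q \<subseteq> A \<or> \<sigma> ` Q \<subseteq> B"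
        using cube_Lebesgue_number[OF X cov \<sigma>] by metis
      \<comment> \<open>All sides of the cube have length 1, so a cube of the \<open>k\<close>-th
        subdivision is \<sigma> on a set of width at most \<open>(1 / 2) ^ k\<close>, to be compared
        with the Lebesgue number.\<close>
      obtain N where N: "(1 / 2) ^ N < \<delta>"
        using real_arch_pow_inv[OF \<delta>(1), of "1 / 2"] by auto
      have "shrunk n X \<sigma> k \<subseteq> ?S n" if k: "N \<le> k" for k
      proof
        fix \<tau> assume \<tau>: "\<tau> \<in> shrunk n X \<sigma> k"
        then obtain g where g: "\<And>x. x \<in> cube n \<Longrightarrow> g x \<in> cube n \<and> \<tau> x = \<sigma> (g x)"
            "\<And>x y i. x \<in> cube n \<Longrightarrow> y \<in> cube n \<Longrightarrow> i \<in> {1..n} \<Longrightarrow>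
               \<bar>g x i - g y i\<bar> \<le> (1 / 2) ^ k * \<bar>x i - y i\<bar>"
          unfolding shrunk_def by blast
        have "\<bar>g x i - g y i\<bar> < \<delta>" if "x \<in> cube n" "y \<in> cube n" "i \<in> {1..n}" for x y i
        proof -
          have "\<bar>x i - y i\<bar> \<le> 1"
            using that by (auto simp: cube_iff abs_le_iff) (smt (verit) atLeastAtMost_iff)+
          then have "(1 / 2) ^ k * \<bar>x i - y i\<bar> \<le> (1 / 2 :: real) ^ k"
            by (simp add: mult_left_le)
          also have "\<dots> \<le> (1 / 2) ^ N"
            using k by (intro power_decreasing) auto
          finally show ?thesis
            using g(2)[OF that] N by linarith
        qed
        then have "\<sigma> ` g ` cube n \<subseteq> A \<or> \<sigma> ` g ` cube n \<subseteq> B"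
          using g(1) by (intro \<delta>(2)) auto
        moreover have "\<tau> ` cube n = \<sigma> ` g ` cube n"
          using g(1) by (auto simp: image_image)
        ultimately show "\<tau> \<in> ?S n"
          using \<tau> by (auto simp: shrunk_def maps_in_def cubes_def)
      qed
      then show ?thesis
        using frags_mono[OF cube_sub_shrunk[OF \<sigma>]] by blast
    qed
  qed (rule I.cube_bd_diff I.cube_bd_bd cube_sub_diff)+
qed (use interior_cover_sub[OF cov] in auto)

text \<open>The interior of the complement of \<open>Z\<close> is the complement of the closure of
  \<open>Z\<close>, so the hypothesis on \<open>Z\<close> says exactly that the two interiors leave
  no point uncovered.\<close>

lemma complement_interior_cover:
  assumes X: "closure_space X" and "Z \<subseteq> A" "A \<subseteq> pts X" "cls X Z \<subseteq> cinterior X A"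
  shows "interior_cover X {A, pts X - Z}"
proof -
  have "cinterior X (pts X - Z) = pts X - cls X Z"
    using assms by (simp add: cinterior_def double_diff)
  moreover have "cinterior X A \<subseteq> pts X"
    by (auto simp: cinterior_def)
  ultimately show ?thesis
    using assms by (auto simp: interior_cover_def)
qed

theorem theorem6p10:
  fixes X :: "'a cspace" and G :: "('g, 'm) monoid_scheme"
  assumes "closure_space X" and "comm_group G"
  shows
    "(\<forall>A Z. Z \<subseteq> A \<and> A \<subseteq> pts X \<and> cls X Z \<subseteq> cinterior X A \<longrightarrow>
       (\<forall>n. simplicial_incl_iso simp_I n (pts X - Z) (A - Z) X A G \<and>
            simplicial_incl_iso simp_J1 n (pts X - Z) (A - Z) X A G \<and>
            simplicial_incl_iso simp_Jplus n (pts X - Z) (A - Z) X A G \<and>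
            (\<forall>J\<in>{int_I, int_J1, int_Jplus}.
               cubical_incl_iso J n (pts X - Z) (A - Z) X A G))) \<and>
     (\<forall>A B. interior_cover X {A, B} \<longrightarrow>
       (\<forall>n. simplicial_incl_iso simp_I n B (A \<inter> B) X A G \<and>
            simplicial_incl_iso simp_J1 n B (A \<inter> B) X A G \<and>
            simplicial_incl_iso simp_Jplus n B (A \<inter> B) X A G \<and>
            (\<forall>J\<in>{int_I, int_J1, int_Jplus}.
               cubical_incl_iso J n B (A \<inter> B) X A G)))"
proof -
  define iso where "iso Y C A \<longleftrightarrow> (\<forall>n. simplicial_incl_iso simp_I n Y C X A G \<and>
      simplicial_incl_iso simp_J1 n Y C X A G \<and> simplicial_incl_iso simp_Jplus n Y C X A G \<and>
      (\<forall>J\<in>{int_I, int_J1, int_Jplus}. cubical_incl_iso J n Y C X A G))" for Y C A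
  have cover: "iso B (A \<inter> B) A" if "interior_cover X {A, B}" for A B
    using assms that
    by (simp add: iso_def simplicial_excision_I simplicial_excision_J1 simplicial_excision_Jplus
        cubical_excision_I cubical_excision_J1 cubical_excision_Jplus)
  have complement: "iso (pts X - Z) (A - Z) A"
    if "Z \<subseteq> A \<and> A \<subseteq> pts X \<and> cls X Z \<subseteq> cinterior X A" for A Z
  proof -
    \<comment> \<open>With \<open>B\<close> the complement of \<open>Z\<close>, the first form of
      excision becomes an instance of the second.\<close>
    have "A - Z = A \<inter> (pts X - Z)"
      using that by blast
    then show ?thesis
      using cover[OF complement_interior_cover[OF assms(1)]] that by simp
  qed
  show ?thesis
    unfolding iso_def[symmetric] using cover complement by blast
qed

end
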